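(* Let $k$ be a positive integer and $\tau=2k$, and let $n$ be sufficiently large with $\tau\mid n$. Let $\mathcal D_{n,2k}$ be the set of connected graphs on $n$ vertices with dissociation number $2k$. If $G$ has the minimum spectral radius among all graphs in $\mathcal D_{n,2k}\setminus\mathcal T_{n,2k}$, then $G$ is isomorphic to the aligned CP-cycle $\mathcal C_k(n/k)$.
   Context: The spectral radius is the largest adjacency eigenvalue. The dissociation number is the largest size of a vertex set inducing a subgraph of maximum degree at most $1$. For even $m$, $CP_m$ is the complement of a perfect matching in $K_m$. $\mathcal T_{n,2k}$ is the set of all graphs obtained from $k$ vertex-disjoint copies of $CP_{n/k}$ by adding $k-1$ edges between distinct copies so that the result is connected. The aligned CP-cycle $\mathcal C_l(m)$ ($m$ even): take $l$ disjoint copies $C_1,\dots,C_l$ of $CP_m$, in each $C_i$ choose a pair of non-adjacent vertices $u_i,v_i$, and add the edges $v_iu_{i+1}$ for $1\le i\le l-1$ and $v_lu_1$ (the result is unique up to isomorphism). *)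

theory Defs
  imports Complex_Main "Graph_Theory.Graph_Theory" "Jordan_Normal_Form.Char_Poly"
begin

text \<open>
  A finite simple graph is a \<open>pair_graph\<close>: a finite vertex set with a symmetric irreflexive arc
  relation, so an edge \<open>uv\<close> is the pair of arcs \<open>(u, v)\<close> and \<open>(v, u)\<close>, and
  \<open>out_degree\<close> is the degree of a vertex. Graphs of order \<open>n\<close> have vertex set
  \<open>{..<n}\<close>.
\<close>

definition graph_iso :: "'a pair_pre_digraph \<Rightarrow> 'b pair_pre_digraph \<Rightarrow> bool" where
  "graph_iso G H \<longleftrightarrow> digraph_iso (with_proj G) (with_proj H)"

text \<open>The adjacency matrix is meaningful for graphs whose vertex set is an initial segment of the
  naturals.\<close>

definition adj_mat :: "nat pair_pre_digraph \<Rightarrow> real mat" where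
  "adj_mat G = mat (card (pverts G)) (card (pverts G)) (\<lambda>(u, v). if (u, v) \<in> parcs G then 1 else 0)"

text \<open>As \<open>adj_mat G\<close> is a real symmetric matrix, its eigenvalues are exactly its real ones.\<close>

definition graph_spectral_radius :: "nat pair_pre_digraph \<Rightarrow> real" where
  "graph_spectral_radius G = Max {x. eigenvalue (adj_mat G) x}"

definition dissociation_set :: "'a pair_pre_digraph \<Rightarrow> 'a set \<Rightarrow> bool" where
  "dissociation_set G S \<longleftrightarrow>
     S \<subseteq> pverts G \<and> (\<forall>v\<in>S. out_degree (induce_subgraph (with_proj G) S) v \<le> 1)"

definition dissociation_number :: "'a pair_pre_digraph \<Rightarrow> nat" where
  "dissociation_number G = Max {card S | S. dissociation_set G S}"

definition dissoc_class :: "nat \<Rightarrow> nat \<Rightarrow> nat pair_pre_digraph set" where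
  "dissoc_class n \<tau> =
     {G. pair_graph G \<and> pverts G = {..<n} \<and> Digraph_Component.connected (with_proj G)
         \<and> dissociation_number G = \<tau>}"

text \<open>\<open>CP\<^sub>m\<close> for even \<open>m\<close>, the removed perfect matching of \<open>K\<^sub>m\<close> being
  \<open>{0, 1}, {2, 3}, \<dots>, {m - 2, m - 1}\<close>. Two vertices have the same half exactly if they
  are equal or matched.\<close>

definition cp_graph :: "nat \<Rightarrow> nat pair_pre_digraph" where
  "cp_graph m = \<lparr>pverts = {..<m}, parcs = {(a, b). a < m \<and> b < m \<and> a div 2 \<noteq> b div 2}\<rparr>"

definition disjoint_copies :: "nat \<Rightarrow> 'a pair_pre_digraph \<Rightarrow> (nat \<times> 'a) pair_pre_digraph" where
  "disjoint_copies l G =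
     \<lparr>pverts = {..<l} \<times> pverts G, parcs = {((i, a), (i, b)) | i a b. i < l \<and> (a, b) \<in> parcs G}\<rparr>"

definition add_edges :: "'a pair_pre_digraph \<Rightarrow> ('a \<times> 'a) set \<Rightarrow> 'a pair_pre_digraph" where
  "add_edges G F = \<lparr>pverts = pverts G, parcs = parcs G \<union> F \<union> F\<inverse>\<rparr>"

text \<open>The added edges are oriented from the copy of smaller index to that of larger index, so that
  \<open>card F\<close> counts each of them once.\<close>

definition cp_tree_class :: "nat \<Rightarrow> nat \<Rightarrow> nat pair_pre_digraph set" where
  "cp_tree_class n k =
     {G. pverts G = {..<n} \<and> Digraph_Component.connected (with_proj G) \<and>
         (\<exists>F. F \<subseteq> {((i, a), (j, b)). i < j \<and> j < k \<and> a < n div k \<and> b < n div k} \<and>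
              card F = k - 1 \<and>
              graph_iso G (add_edges (disjoint_copies k (cp_graph (n div k))) F))}"

text \<open>Copies are indexed from \<open>0\<close>, and the chosen non-adjacent vertices of copy \<open>i\<close> are
  \<open>u\<^sub>i = (i, 0)\<close> and \<open>v\<^sub>i = (i, 1)\<close>.\<close>

definition aligned_cp_cycle :: "nat \<Rightarrow> nat \<Rightarrow> (nat \<times> nat) pair_pre_digraph" where
  "aligned_cp_cycle l m =
     add_edges (disjoint_copies l (cp_graph m)) {((i, 1), (Suc i mod l, 0)) | i. i < l}"

end

theory Submission
  imports Defs
begin

text \<open>
  Put \<open>m = n / k\<close> and let \<open>t > 0\<close> solve \<open>2t\<^sup>2 + (m - 1)t = 1\<close>. The vector that is \<open>1 + t\<close> on the linking
  vertices \<open>u\<^sub>i, v\<^sub>i\<close> and \<open>1\<close> elsewhere is the Perron vector of the aligned cycle, whose spectral radius is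
  \<open>m - 2 + 2t\<close>. A minimiser \<open>G\<close> therefore has spectral radius at most \<open>m - 2 + 2t \<le> m - 2 + 3/m\<close>, so every
  induced subgraph of \<open>G\<close> has average degree at most \<open>m - 2 + 3/m\<close>.

  A stability argument turns this into structure. By an Erdos--Stone count for the complement, \<open>G\<close>
  contains \<open>k\<close> large sets of vertices of degree about \<open>m\<close> with no edges between different sets. Since
  no \<open>2k + 1\<close> vertices are dissociated, every vertex is adjacent to all but at most one vertex of some
  of these sets, and the vertices that clearly belong to one set induce a graph whose complement is a
  matching. Repeating the classification with the nearly complete parts so obtained leaves no vertex
  over: \<open>G\<close> is \<open>k\<close> disjoint copies of \<open>CP\<^sub>m\<close> plus extra edges.

  Since \<open>G\<close> is connected but not a tree of copies, there are at least \<open>k\<close> extra edges. Let \<open>e\<close> be the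
  degree in the extra edges. The Rayleigh quotient of \<open>1 + te\<close> exceeds \<open>m - 2 + 2t\<close> unless there are
  exactly \<open>k\<close> extra edges, they form a matching, and their ends in each copy are pairwise non-adjacent
  there. Then each copy contains exactly one non-adjacent pair of ends, and connectedness makes the
  copies a single cycle.
\<close>

section \<open>Degree sums and the Erdos--Stone bound\<close>

text \<open>The slack is constant, which makes exact structure reachable: \<open>k\<close> disjoint
  copies of \<open>CP_m\<close> have degree sum \<open>k * m * (m - 2)\<close>, and the bound
  \<open>m - 2 + 3 / m\<close> on the average degree allows only \<open>3 * k\<close> more on the
  whole vertex set. A vertex outside the parts would create a surplus of about \<open>m / 4\<close>,
  so for large \<open>m\<close> not even one can exist.

  The classification is run twice because the Erdos-Stone count gives separated sets of bounded size
  only. Compared with these, a small fraction of \<open>m\<close> vertices may stay unclassified;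
  sets of nearly \<open>m\<close> vertices are needed before the threshold for neighbours in a
  second set can be \<open>m / 4\<close>. Both rounds bound the edges leaving the chosen sets, so
  vertices of degree above \<open>(1 + \<delta>) * m\<close> are first shown to be few and then
  avoided.

  On the spectral side, a positive test vector bounds all eigenvalues of the cycle from above
  (Collatz-Wielandt), and a Rayleigh quotient bounds the radius of \<open>G\<close> from below. With
  \<open>t\<close> taken from the eigenvalue equation of the cycle, the gap between the two splits
  into nonnegative terms.\<close>

definition nbrs :: "('a \<Rightarrow> 'a \<Rightarrow> bool) \<Rightarrow> 'a set \<Rightarrow> 'a \<Rightarrow> 'a set" where
  "nbrs E X v = {u \<in> X. E v u}"

text \<open>Twice the number of edges inside \<open>X\<close> when \<open>E\<close> is symmetric and
  irreflexive. As a sum over ordered pairs it is the value of the adjacency quadratic form at the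
  indicator vector of \<open>X\<close>, so a spectral bound controls it for every
  \<open>X\<close>.\<close>

definition degsum :: "('a \<Rightarrow> 'a \<Rightarrow> bool) \<Rightarrow> 'a set \<Rightarrow> real" where
  "degsum E X = (\<Sum>v\<in>X. real (card (nbrs E X v)))"

text \<open>In the complement graph this is a complete \<open>r\<close>-partite subgraph with all
  classes of size \<open>t\<close>; edges inside the classes are unrestricted. The condition
  \<open>x \<noteq> y\<close> makes the classes disjoint, which non-adjacency alone does not do in a
  loopless graph.\<close>

definition separated_family :: "('a \<Rightarrow> 'a \<Rightarrow> bool) \<Rightarrow> 'a set \<Rightarrow> nat \<Rightarrow> nat \<Rightarrow> (nat \<Rightarrow> 'a set) \<Rightarrow> bool" where
  "separated_family E V r t A \<longleftrightarrow> (\<forall>i<r. A i \<subseteq> V \<and> card (A i) = t) \<and>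
     (\<forall>i<r. \<forall>j<r. i \<noteq> j \<longrightarrow> (\<forall>x\<in>A i. \<forall>y\<in>A j. x \<noteq> y \<and> \<not> E x y))"

lemma finite_nbrs [simp]: "finite X \<Longrightarrow> finite (nbrs E X v)"
  by (simp add: nbrs_def)

lemma nbrs_subset: "nbrs E X v \<subseteq> X"
  by (auto simp: nbrs_def)

lemma card_nbrs_le: "finite X \<Longrightarrow> card (nbrs E X v) \<le> card X"
  by (simp add: card_mono nbrs_subset)

lemma nbrs_mono: "X \<subseteq> Y \<Longrightarrow> nbrs E X v \<subseteq> nbrs E Y v"
  by (auto simp: nbrs_def)

lemma card_nbrs_mono: "finite Y \<Longrightarrow> X \<subseteq> Y \<Longrightarrow> card (nbrs E X v) \<le> card (nbrs E Y v)"
  by (simp add: card_mono nbrs_mono)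

lemma card_nbrs_Un:
  "finite X \<Longrightarrow> finite Y \<Longrightarrow> X \<inter> Y = {} \<Longrightarrow>
   card (nbrs E (X \<union> Y) v) = card (nbrs E X v) + card (nbrs E Y v)"
proof -
  assume *: "finite X" "finite Y" "X \<inter> Y = {}"
  have "nbrs E (X \<union> Y) v = nbrs E X v \<union> nbrs E Y v" by (auto simp: nbrs_def)
  thus ?thesis using * by (simp add: card_Un_disjoint nbrs_def disjoint_iff)
qed

lemma sum_nbrs_swap:
  assumes "symp E" "finite X" "finite Y"
  shows "(\<Sum>v\<in>X. real (card (nbrs E Y v))) = (\<Sum>v\<in>Y. real (card (nbrs E X v)))"
proof -
  have c: "real (card (nbrs E Z v)) = (\<Sum>u\<in>Z. if E v u then 1 else 0)" if "finite Z" for Z v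
    using that by (simp add: nbrs_def sum.If_cases Int_def)
  have "(\<Sum>v\<in>X. real (card (nbrs E Y v))) = (\<Sum>v\<in>X. \<Sum>u\<in>Y. if E v u then 1 else 0)"
    using assms by (simp add: c)
  also have "\<dots> = (\<Sum>u\<in>Y. \<Sum>v\<in>X. if E v u then 1 else 0)" by (rule sum.swap)
  also have "\<dots> = (\<Sum>u\<in>Y. \<Sum>v\<in>X. if E u v then 1 else 0)"
    using assms(1) by (intro sum.cong refl) (metis sympD)
  finally show ?thesis using assms by (simp add: c)
qed

lemma degsum_nonneg: "0 \<le> degsum E X"
  by (simp add: degsum_def sum_nonneg)

lemma degsum_Un:
  assumes "symp E" "finite X" "finite Y" "X \<inter> Y = {}"
  shows "degsum E (X \<union> Y) = degsum E X + degsum E Y + 2 * (\<Sum>v\<in>X. real (card (nbrs E Y v)))"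
  using assms sum_nbrs_swap[OF assms(1-3)]
  by (simp add: degsum_def sum.union_disjoint card_nbrs_Un sum.distrib)

lemma separated_family_mono: "separated_family E X r t A \<Longrightarrow> X \<subseteq> Y \<Longrightarrow> separated_family E Y r t A"
  unfolding separated_family_def by blast

text \<open>The Erdos--Stone theorem for the complement. Deleting \<open>k\<close> separated sets of large size \<open>T\<close>
  removes about \<open>T\<close> edges per remaining vertex, and all but boundedly many vertices are adjacent to
  almost all of one of these sets, since \<open>t\<close> exceptions of the same type would give \<open>k + 1\<close> separated
  sets.\<close>

lemma erdos_stone_complement:
  fixes \<epsilon> :: real
  assumes \<epsilon>: "0 < \<epsilon>" "\<epsilon> \<le> 1"
  shows "\<exists>C\<ge>0. \<forall>(E :: 'a \<Rightarrow> 'a \<Rightarrow> bool) V. symp E \<longrightarrow> finite V \<longrightarrow>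
    (\<nexists>A. separated_family E V (Suc k) t A) \<longrightarrow>
    (1 - \<epsilon>) * (real (card V))\<^sup>2 - C * real (card V) \<le> real k * degsum E V"
proof (induction k arbitrary: t)
  case 0
  show ?case
  \<comment> \<open>Without one set of \<open>t\<close> vertices, \<open>card V < t\<close>, so the
    quadratic term is at most \<open>t * card V\<close>; the right-hand side is 0.\<close>
  proof (intro exI[of _ "real t"] conjI allI impI)
    fix E :: "'a \<Rightarrow> 'a \<Rightarrow> bool" and V
    assume V: "finite V" and no: "\<nexists>A. separated_family E V (Suc 0) t A"
    have "card V < t"
    proof (rule ccontr)
      assume "\<not> card V < t"
      then obtain W where "W \<subseteq> V" "card W = t"
        by (metis not_less obtain_subset_with_card_n)
      hence "separated_family E V (Suc 0) t (\<lambda>_. W)" by (simp add: separated_family_def)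
      thus False using no by blast
    qed
    hence "(1 - \<epsilon>) * (real (card V))\<^sup>2 \<le> 1 * (real t * real (card V))"
      using \<epsilon> by (intro mult_mono) (auto simp: power2_eq_square intro!: mult_right_mono)
    thus "(1 - \<epsilon>) * (real (card V))\<^sup>2 - real t * real (card V) \<le> real 0 * degsum E V" by simp
  qed auto
next
  case (Suc k)
  define r where "r = Suc k"
  \<comment> \<open>With \<open>t \<le> \<epsilon> * T\<close>, a vertex that misses fewer than
    \<open>t\<close> members of a set of size \<open>T\<close> still has at least
    \<open>(1 - \<epsilon>) * T\<close> neighbours in it.\<close>
  obtain T :: nat where T: "real t / \<epsilon> < real T" using reals_Archimedean2 by blast
  hence T0: "0 < T" using \<epsilon> by (metis divide_nonneg_pos gr0I linorder_not_le of_nat_0 of_nat_0_le_iff)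
  have tT: "real t \<le> \<epsilon> * real T" using T \<epsilon> by (simp add: field_simps)
  obtain C1 where C1: "C1 \<ge> 0" and IH: "\<And>(E :: 'a \<Rightarrow> 'a \<Rightarrow> bool) V. symp E \<Longrightarrow> finite V \<Longrightarrow>
    \<nexists>A. separated_family E V (Suc k) T A \<Longrightarrow>
    (1 - \<epsilon>) * (real (card V))\<^sup>2 - C1 * real (card V) \<le> real k * degsum E V"
    using Suc[of T] by blast
  \<comment> \<open>Pigeonhole bound: a vertex has one of \<open>2 ^ (r * T)\<close> possible traces
    on the \<open>r * T\<close> vertices of the separated sets, and more than \<open>t\<close>
    exceptional vertices with equal trace are already too many.\<close>
  define C2 :: real where "C2 = real t * 2 ^ (r * T)"
  \<comment> \<open>\<open>C1\<close> covers the case without a large family. The rest pays for the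
    removal of \<open>r * T\<close> vertices: \<open>C * (r * T)\<close> absorbs the lower-order
    terms left when the square is expanded and up to \<open>C2\<close> vertices are ignored.\<close>
  define C where "C = C1 + real r * real T + 2 * C2"
  have C2: "C2 \<ge> 0" by (simp add: C2_def)
  have main: "(1 - \<epsilon>) * (real (card V))\<^sup>2 - C * real (card V) \<le> real r * degsum E V"
    if E: "symp E" and "finite V" "\<nexists>A. separated_family E V (Suc r) t A"
    for E :: "'a \<Rightarrow> 'a \<Rightarrow> bool" and V
    using that(2,3)
  proof (induction "card V" arbitrary: V rule: less_induct)
    case less
    show ?case
    proof (cases "\<exists>A. separated_family E V r T A")
      case False
      have "(1 - \<epsilon>) * (real (card V))\<^sup>2 - C1 * real (card V) \<le> real k * degsum E V"
        using IH[OF E less.prems(1)] False r_def by simp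
      moreover have "C1 * real (card V) \<le> C * real (card V)"
        using C2 by (intro mult_right_mono) (auto simp: C_def)
      moreover have "real k * degsum E V \<le> real r * degsum E V"
        by (intro mult_right_mono) (auto simp: r_def degsum_nonneg)
      ultimately show ?thesis by linarith
    next
      case True
      then obtain A where A: "separated_family E V r T A" by blast
      have AV: "A i \<subseteq> V" and cA: "card (A i) = T" if "i < r" for i
        using A that by (auto simp: separated_family_def)
      have fA: "finite (A i)" if "i < r" for i using AV[OF that] less.prems(1) finite_subset by blast
      have disj: "A i \<inter> A j = {}" if "i < r" "j < r" "i \<noteq> j" for i j
        using A that unfolding separated_family_def by blast
      define U where "U = (\<Union>i<r. A i)"
      have UV: "U \<subseteq> V" using AV by (auto simp: U_def)
      have fU: "finite U" using UV less.prems(1) finite_subset by blast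
      have cU: "card U = r * T"
        unfolding U_def using fA disj cA by (subst card_UN_disjoint) auto
      define V' where "V' = V - U"
      have fV': "finite V'" and V'V: "V' \<subseteq> V" using less.prems(1) by (auto simp: V'_def)
      have VU: "V = V' \<union> U" "V' \<inter> U = {}" using UV by (auto simp: V'_def)
      have cV: "card V = card V' + r * T"
        using VU fV' fU cU card_Un_disjoint by metis
      define Z where "Z = {v \<in> V'. \<forall>i<r. t \<le> card (A i - nbrs E (A i) v)}"
      have fZ: "finite Z" using fV' by (simp add: Z_def)
      have cZ: "real (card Z) \<le> C2"
      proof (rule ccontr)
        assume "\<not> real (card Z) \<le> C2"
        hence "real (t * 2 ^ (r * T)) < real (card Z)" by (simp add: C2_def)
        hence big: "t * 2 ^ (r * T) < card Z" using of_nat_less_iff by blast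
        have "\<exists>P\<in>Pow U. t < card {v\<in>Z. nbrs E U v = P}"
        proof (rule ccontr)
          assume neg: "\<not> (\<exists>P\<in>Pow U. t < card {v\<in>Z. nbrs E U v = P})"
          have *: "card {v\<in>Z. nbrs E U v = P} \<le> t" if "P \<in> Pow U" for P
            using neg that by (meson not_le)
          have "Z \<subseteq> (\<Union>P\<in>Pow U. {v\<in>Z. nbrs E U v = P})" using nbrs_subset[of E U] by blast
          hence "card Z \<le> card (\<Union>P\<in>Pow U. {v\<in>Z. nbrs E U v = P})"
            using fU fZ by (intro card_mono) auto
          also have "\<dots> \<le> (\<Sum>P\<in>Pow U. card {v\<in>Z. nbrs E U v = P})"
            using fU by (intro card_UN_le) auto
          also have "\<dots> \<le> (\<Sum>P\<in>Pow U. t)" by (rule sum_mono) (rule *)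
          also have "\<dots> = t * 2 ^ (r * T)" using fU by (simp add: card_Pow cU)
          finally show False using big by simp
        qed
        then obtain P W where W: "W \<subseteq> {v\<in>Z. nbrs E U v = P}" "card W = t"
          by (meson less_imp_le obtain_subset_with_card_n)
        \<comment> \<open>A representative of the common trace; if \<open>t = 0\<close> then
          \<open>W\<close> is empty and any vertex of \<open>Z\<close> will do.\<close>
        obtain w0 where w0: "w0 \<in> Z" "\<forall>w\<in>W. nbrs E U w = nbrs E U w0"
        proof (cases "W = {}")
          case True
          have "Z \<noteq> {}" using big by auto
          thus thesis using that True by blast
        next
          case False
          then obtain w0 where "w0 \<in> W" by blast
          thus thesis using that[of w0] W(1) by blast
        qed
        have "\<exists>B\<subseteq>A i - nbrs E (A i) w0. card B = t" if "i < r" for i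
          using w0(1) that unfolding Z_def by (auto intro: obtain_subset_with_card_n)
        then obtain B where B: "\<And>i. i < r \<Longrightarrow> B i \<subseteq> A i - nbrs E (A i) w0 \<and> card (B i) = t"
          by metis
        have BW: "x \<noteq> y \<and> \<not> E x y \<and> \<not> E y x" if "i < r" "x \<in> B i" "y \<in> W" for i x y
        proof -
          have x: "x \<in> A i" "\<not> E w0 x" using B[OF that(1)] that(2) by (auto simp: nbrs_def)
          have "x \<in> U" using x(1) that(1) by (auto simp: U_def)
          moreover have "nbrs E U y = nbrs E U w0" using w0 that(3) by blast
          ultimately have "\<not> E y x" using x(2) by (auto simp: nbrs_def)
          moreover have "y \<in> V'" using W(1) that(3) by (auto simp: Z_def)
          ultimately show ?thesis using \<open>x \<in> U\<close> E by (auto simp: V'_def dest: sympD)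
        qed
        \<comment> \<open>Inside each \<open>A i\<close> there are \<open>t\<close> vertices missed
          by the common trace; together with \<open>W\<close> as a further class they form
          \<open>r + 1\<close> separated sets.\<close>
        have "separated_family E V (Suc r) t (\<lambda>i. if i < r then B i else W)"
          unfolding separated_family_def
        proof (intro conjI allI impI ballI)
          fix i assume i: "i < Suc r"
          show "(if i < r then B i else W) \<subseteq> V" "card (if i < r then B i else W) = t"
            using B[of i] AV[of i] W V'V by (auto simp: Z_def)
        next
          fix i j x y
          assume *: "i < Suc r" "j < Suc r" "i \<noteq> j" "x \<in> (if i < r then B i else W)"
            "y \<in> (if j < r then B j else W)"
          have "x \<noteq> y \<and> \<not> E x y"
          proof (cases "i < r \<and> j < r")
            case True
            hence "x \<in> A i" "y \<in> A j" using * B[of i] B[of j] by auto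
            thus ?thesis using True * A unfolding separated_family_def by blast
          next
            case False
            thus ?thesis using * BW[of i x y] BW[of j y x] by (auto split: if_splits)
          qed
          thus "x \<noteq> y" "\<not> E x y" by auto
        qed
        thus False using less.prems(2) by blast
      qed
      have nb: "(1 - \<epsilon>) * real T \<le> real (card (nbrs E U v))" if v: "v \<in> V' - Z" for v
      proof -
        obtain i where i: "i < r" "card (A i - nbrs E (A i) v) < t"
          using v by (auto simp: Z_def not_le)
        have "card (A i - nbrs E (A i) v) = T - card (nbrs E (A i) v)"
          using i fA cA nbrs_subset by (metis card_Diff_subset finite_nbrs)
        hence "real T \<le> real t + real (card (nbrs E (A i) v))" using i by linarith
        moreover have "card (nbrs E (A i) v) \<le> card (nbrs E U v)"
          using fU i by (intro card_nbrs_mono) (auto simp: U_def)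
        ultimately show ?thesis using tT by (simp add: algebra_simps)
      qed
      have "(1 - \<epsilon>) * real T * (real (card V') - C2) \<le> (1 - \<epsilon>) * real T * real (card (V' - Z))"
      proof (intro mult_left_mono)
        have "card V' \<le> card (V' - Z) + card Z"
          using diff_card_le_card_Diff[OF fZ, of V'] by linarith
        thus "real (card V') - C2 \<le> real (card (V' - Z))" using cZ by linarith
      qed (use \<epsilon> in auto)
      also have "\<dots> = (\<Sum>v\<in>V' - Z. (1 - \<epsilon>) * real T)" by simp
      also have "\<dots> \<le> (\<Sum>v\<in>V' - Z. real (card (nbrs E U v)))" by (rule sum_mono) (rule nb)
      also have "\<dots> \<le> (\<Sum>v\<in>V'. real (card (nbrs E U v)))" using fV' by (intro sum_mono2) auto
      finally have cross: "(1 - \<epsilon>) * real T * (real (card V') - C2) \<le> (\<Sum>v\<in>V'. real (card (nbrs E U v)))" .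
      have "degsum E V = degsum E V' + degsum E U + 2 * (\<Sum>v\<in>V'. real (card (nbrs E U v)))"
        using degsum_Un[OF E fV' fU VU(2)] VU(1) by simp
      hence dV: "degsum E V' + 2 * ((1 - \<epsilon>) * real T * (real (card V') - C2)) \<le> degsum E V"
        using cross degsum_nonneg[of E U] by linarith
      have rT: "0 < r * T" using T0 by (simp add: r_def)
      have IHV: "(1 - \<epsilon>) * (real (card V'))\<^sup>2 - C * real (card V') \<le> real r * degsum E V'"
        using less.hyps[of V'] fV' cV rT less.prems(2) separated_family_mono[OF _ V'V] by fastforce
      have "(1 - \<epsilon>) * (real r * real T * (real r * real T + 2 * C2)) \<le> 1 * (real r * real T * (real r * real T + 2 * C2))"
        using C2 \<epsilon> by (intro mult_right_mono) auto
      also have "\<dots> \<le> real r * real T * C" using C1 unfolding C_def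
        by (simp add: mult_left_mono)
      finally have c: "(1 - \<epsilon>) * (real r * real T * (real r * real T + 2 * C2)) \<le> real r * real T * C" .
      have "(1 - \<epsilon>) * (real (card V))\<^sup>2 - C * real (card V)
        = ((1 - \<epsilon>) * (real (card V'))\<^sup>2 - C * real (card V'))
          + real r * (2 * ((1 - \<epsilon>) * real T * (real (card V') - C2)))
          + (1 - \<epsilon>) * (real r * real T * (real r * real T + 2 * C2)) - real r * real T * C"
        unfolding cV by (simp add: algebra_simps power2_eq_square)
      also have "\<dots> \<le> real r * degsum E V' + real r * (2 * ((1 - \<epsilon>) * real T * (real (card V') - C2)))"
        using IHV c by linarith
      also have "\<dots> = real r * (degsum E V' + 2 * ((1 - \<epsilon>) * real T * (real (card V') - C2)))"
        by (simp add: algebra_simps)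
      also have "\<dots> \<le> real r * degsum E V" using dV by (intro mult_left_mono) auto
      finally show ?thesis .
    qed
  qed
  have "C \<ge> 0" using C1 C2 by (simp add: C_def)
  thus ?case using main by (auto simp: r_def)
qed

section \<open>Classification of vertices by dissociated sets\<close>

definition non_nbrs :: "('a \<Rightarrow> 'a \<Rightarrow> bool) \<Rightarrow> 'a set \<Rightarrow> 'a \<Rightarrow> 'a set" where
  "non_nbrs E X v = X - nbrs E X v - {v}"

text \<open>The complement of \<open>E\<close> on \<open>X\<close> has maximum degree at most 1. The
  form with three vertices is the one that \<open>part_comatching\<close> needs: a vertex missing
  two others forms with them a dissociated set of size 3.\<close>

definition comatching :: "('a \<Rightarrow> 'a \<Rightarrow> bool) \<Rightarrow> 'a set \<Rightarrow> bool" where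
  "comatching E X \<longleftrightarrow> (\<forall>v\<in>X. \<forall>w\<in>X. \<forall>w'\<in>X. v \<noteq> w \<longrightarrow> v \<noteq> w' \<longrightarrow> w \<noteq> w' \<longrightarrow> \<not> E v w \<longrightarrow> E v w')"

lemma comatchingD:
  "comatching E X \<Longrightarrow> v \<in> X \<Longrightarrow> w \<in> X \<Longrightarrow> w' \<in> X \<Longrightarrow> v \<noteq> w \<Longrightarrow> v \<noteq> w' \<Longrightarrow> w \<noteq> w' \<Longrightarrow>
   \<not> E v w \<Longrightarrow> E v w'"
  by (simp add: comatching_def)

lemma card_le_nbrs_non_nbrs:
  assumes "finite X"
  shows "card X \<le> card (nbrs E X v) + card (non_nbrs E X v) + 1"
proof -
  have "X \<subseteq> insert v (nbrs E X v \<union> non_nbrs E X v)" by (auto simp: non_nbrs_def)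
  hence "card X \<le> card (insert v (nbrs E X v \<union> non_nbrs E X v))"
    using assms by (intro card_mono) (auto simp: non_nbrs_def)
  also have "\<dots> \<le> card (nbrs E X v \<union> non_nbrs E X v) + 1"
    using assms by (simp add: card_insert_if non_nbrs_def)
  also have "\<dots> \<le> card (nbrs E X v) + card (non_nbrs E X v) + 1" by (simp add: card_Un_le)
  finally show ?thesis .
qed

lemma comatching_card_nbrs:
  assumes "finite X" "comatching E X" "v \<in> X"
  shows "card X \<le> card (nbrs E X v) + 2"
proof -
  have "w = w'" if "w \<in> non_nbrs E X v" "w' \<in> non_nbrs E X v" for w w'
  proof (rule ccontr)
    assume "w \<noteq> w'"
    moreover have "w \<in> X" "w' \<in> X" "v \<noteq> w" "v \<noteq> w'" "\<not> E v w" "\<not> E v w'"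
      using that by (auto simp: non_nbrs_def nbrs_def)
    ultimately show False using comatchingD[OF assms(2,3), of w w'] by simp
  qed
  moreover have "finite (non_nbrs E X v)" using assms(1) by (simp add: non_nbrs_def)
  ultimately have "card (non_nbrs E X v) \<le> 1" by (simp add: card_le_Suc0_iff_eq)
  thus ?thesis using card_le_nbrs_non_nbrs[OF assms(1), of E v] by linarith
qed

lemma comatching_degsum:
  assumes "finite X" "comatching E X"
  shows "real (card X) * (real (card X) - 2) \<le> degsum E X"
proof -
  have "(\<Sum>v\<in>X. real (card X) - 2) \<le> degsum E X"
    unfolding degsum_def using comatching_card_nbrs[OF assms] by (intro sum_mono) fastforce
  thus ?thesis by simp
qed

text \<open>Greedy choice: once a pair is taken from one set, its at most
  \<open>2 * \<sigma>\<close> neighbours are deleted from each remaining set. Hence the reserve of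
  \<open>2 * \<sigma>\<close> vertices per index, with 2 left at the end.\<close>

lemma separated_pairs:
  assumes "finite I" "symp E"
    and "\<And>i. i \<in> I \<Longrightarrow> finite (X i)"
    and "\<And>i j x. i \<in> I \<Longrightarrow> j \<in> I \<Longrightarrow> i \<noteq> j \<Longrightarrow> x \<in> X i \<Longrightarrow> card (nbrs E (X j) x) \<le> \<sigma>"
    and "\<And>i. i \<in> I \<Longrightarrow> 2 * card I * \<sigma> + 2 \<le> card (X i)"
  shows "\<exists>P. (\<forall>i\<in>I. P i \<subseteq> X i \<and> card (P i) = 2) \<and>
    (\<forall>i\<in>I. \<forall>j\<in>I. i \<noteq> j \<longrightarrow> (\<forall>x\<in>P i. \<forall>y\<in>P j. \<not> E x y))"
  using assms
proof (induction I arbitrary: X rule: finite_induct)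
  case empty
  show ?case by simp
next
  case (insert i I)
  have "2 \<le> card (X i)" using insert.prems(4)[of i] by simp
  then obtain Q where Q: "Q \<subseteq> X i" "card Q = 2" by (metis obtain_subset_with_card_n)
  then obtain a b where ab: "Q = {a, b}" "a \<noteq> b" by (meson card_2_iff)
  define Y where "Y j = X j - nbrs E (X j) a - nbrs E (X j) b" for j
  have Yc: "2 * card I * \<sigma> + 2 \<le> card (Y j)" if "j \<in> I" for j
  proof -
    have j: "i \<noteq> j" using that insert.hyps by blast
    have n: "card (nbrs E (X j) a) \<le> \<sigma>" "card (nbrs E (X j) b) \<le> \<sigma>"
      using insert.prems(3)[of i j] Q ab that j by auto
    have f: "finite (X j)" using insert.prems(2) that by blast
    have "2 * (card I + 1) * \<sigma> + 2 \<le> card (X j)"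
      using insert.prems(4)[of j] that insert.hyps by simp
    moreover have "card (X j) - card (nbrs E (X j) a) - card (nbrs E (X j) b) \<le> card (Y j)"
      unfolding Y_def using f diff_card_le_card_Diff[of "nbrs E (X j) a" "X j"]
        diff_card_le_card_Diff[of "nbrs E (X j) b" "X j - nbrs E (X j) a"] by simp
    ultimately show ?thesis using n by (simp add: algebra_simps)
  qed
  have "\<exists>P. (\<forall>i\<in>I. P i \<subseteq> Y i \<and> card (P i) = 2) \<and>
    (\<forall>i\<in>I. \<forall>j\<in>I. i \<noteq> j \<longrightarrow> (\<forall>x\<in>P i. \<forall>y\<in>P j. \<not> E x y))"
  proof (rule insert.IH)
    fix i' j x assume *: "i' \<in> I" "j \<in> I" "i' \<noteq> j" "x \<in> Y i'"
    have "card (nbrs E (Y j) x) \<le> card (nbrs E (X j) x)"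
      using insert.prems(2) * by (intro card_nbrs_mono) (auto simp: Y_def)
    thus "card (nbrs E (Y j) x) \<le> \<sigma>" using insert.prems(3)[of i' j x] * by (auto simp: Y_def)
  qed (use insert.prems Yc in \<open>auto simp: Y_def\<close>)
  then obtain P where P': "\<forall>i\<in>I. P i \<subseteq> Y i \<and> card (P i) = 2"
    "\<forall>i\<in>I. \<forall>j\<in>I. i \<noteq> j \<longrightarrow> (\<forall>x\<in>P i. \<forall>y\<in>P j. \<not> E x y)" by (elim exE conjE) (rule that)
  have P: "P j \<subseteq> Y j \<and> card (P j) = 2" if "j \<in> I" for j
    using P'(1) that by (rule bspec)
  have P2: "\<not> E x y" if "j \<in> I" "l \<in> I" "j \<noteq> l" "x \<in> P j" "y \<in> P l" for j l x y
    using P'(2) that by simp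
  have QP: "\<not> E x y \<and> \<not> E y x" if "x \<in> Q" "j \<in> I" "y \<in> P j" for x y j
  proof -
    have "y \<in> Y j" using P that by blast
    hence "\<not> E x y" using that(1) ab by (auto simp: Y_def nbrs_def)
    thus ?thesis using insert.prems(1) by (auto dest: sympD)
  qed
  show ?case
  proof (intro exI[of _ "P(i := Q)"] conjI ballI impI)
    fix j assume "j \<in> insert i I"
    thus "(P(i := Q)) j \<subseteq> X j" "card ((P(i := Q)) j) = 2" using P[of j] Q by (auto simp: Y_def)
  next
    fix j l x y assume "j \<in> insert i I" "l \<in> insert i I" "j \<noteq> l" "x \<in> (P(i := Q)) j" "y \<in> (P(i := Q)) l"
    thus "\<not> E x y" using P2[of j l x y] QP[of x l y] QP[of y j x] by (auto split: if_splits)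
  qed
qed

section \<open>Extending dissociated sets by pairs, and the resulting parts\<close>

locale bounded_dissociation =
  fixes V :: "'a set" and E :: "'a \<Rightarrow> 'a \<Rightarrow> bool" and k :: nat
  assumes finite_V: "finite V"
    and sym: "symp E"
    and irrefl: "irreflp E"
    and dissociated_le: "\<And>S. S \<subseteq> V \<Longrightarrow> \<forall>v\<in>S. card (nbrs E S v) \<le> 1 \<Longrightarrow> card S \<le> 2 * k"
begin

lemma finite_subV: "X \<subseteq> V \<Longrightarrow> finite X"
  using finite_V finite_subset by blast

text \<open>\<open>S0\<close> together with one pair from each \<open>X i\<close> is dissociated,
  because edges survive only inside a pair or inside \<open>S0\<close>. It is applied with
  \<open>S0\<close> of size 1 and \<open>k\<close> sets, of size 3 and \<open>k - 1\<close> sets,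
  and empty with \<open>k + 1\<close> sets; each time the total would exceed
  \<open>2 * k\<close>.\<close>

lemma dissociated_extend_le:
  assumes S0: "S0 \<subseteq> V" "\<And>v. v \<in> S0 \<Longrightarrow> card (nbrs E S0 v) \<le> 1"
    and I: "finite I"
    and X: "\<And>i. i \<in> I \<Longrightarrow> X i \<subseteq> V"
    and disj: "\<And>i j. i \<in> I \<Longrightarrow> j \<in> I \<Longrightarrow> i \<noteq> j \<Longrightarrow> X i \<inter> X j = {}"
    and cross: "\<And>i j x. i \<in> I \<Longrightarrow> j \<in> I \<Longrightarrow> i \<noteq> j \<Longrightarrow> x \<in> X i \<Longrightarrow> card (nbrs E (X j) x) \<le> \<sigma>"
    and size: "\<And>i. i \<in> I \<Longrightarrow> 2 * card I * \<sigma> + 2 \<le> card (X i)"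
    and S0X: "\<And>i x s. i \<in> I \<Longrightarrow> x \<in> X i \<Longrightarrow> s \<in> S0 \<Longrightarrow> x \<noteq> s \<and> \<not> E s x"
  shows "card S0 + 2 * card I \<le> 2 * k"
proof -
  have "\<exists>P. (\<forall>i\<in>I. P i \<subseteq> X i \<and> card (P i) = 2) \<and>
    (\<forall>i\<in>I. \<forall>j\<in>I. i \<noteq> j \<longrightarrow> (\<forall>x\<in>P i. \<forall>y\<in>P j. \<not> E x y))"
    by (rule separated_pairs[OF I sym _ cross size]) (use X finite_subV in auto)
  then obtain P where P': "\<forall>i\<in>I. P i \<subseteq> X i \<and> card (P i) = 2"
    "\<forall>i\<in>I. \<forall>j\<in>I. i \<noteq> j \<longrightarrow> (\<forall>x\<in>P i. \<forall>y\<in>P j. \<not> E x y)" by (elim exE conjE) (rule that)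
  have P: "P j \<subseteq> X j" "card (P j) = 2" if "j \<in> I" for j
    using bspec[OF P'(1) that] by auto
  have P2: "\<not> E x y" if "j \<in> I" "l \<in> I" "j \<noteq> l" "x \<in> P j" "y \<in> P l" for j l x y
    using P'(2) that by simp
  define U where "U = (\<Union>i\<in>I. P i)"
  have UV: "U \<subseteq> V" using P X by (fastforce simp: U_def)
  have fP: "finite (P j)" if "j \<in> I" for j using P(2)[OF that] card.infinite by fastforce
  have "card U = (\<Sum>i\<in>I. card (P i))"
    unfolding U_def
  proof (rule card_UN_disjoint[OF I]; intro ballI impI)
    show "finite (P i)" if "i \<in> I" for i using fP[OF that] .
    show "P i \<inter> P j = {}" if "i \<in> I" "j \<in> I" "i \<noteq> j" for i j
      using disj[OF that] P(1)[OF that(1)] P(1)[OF that(2)] by blast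
  qed
  hence cU: "card U = 2 * card I" using P by simp
  have S0U: "S0 \<inter> U = {}" using S0X P(1) by (fastforce simp: U_def)
  have "card (S0 \<union> U) \<le> 2 * k"
  proof (rule dissociated_le)
    show "S0 \<union> U \<subseteq> V" using S0 UV by blast
    show "\<forall>v\<in>S0 \<union> U. card (nbrs E (S0 \<union> U) v) \<le> 1"
    proof
      fix v assume v: "v \<in> S0 \<union> U"
      show "card (nbrs E (S0 \<union> U) v) \<le> 1"
      proof (cases "v \<in> S0")
        case True
        have "nbrs E (S0 \<union> U) v \<subseteq> nbrs E S0 v"
        proof
          fix y assume y: "y \<in> nbrs E (S0 \<union> U) v"
          have "y \<notin> U" using S0X P(1) True y unfolding U_def nbrs_def by fastforce
          thus "y \<in> nbrs E S0 v" using y by (auto simp: nbrs_def)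
        qed
        hence "card (nbrs E (S0 \<union> U) v) \<le> card (nbrs E S0 v)"
          using S0(1) finite_subV by (intro card_mono) auto
        thus ?thesis using S0(2)[OF True] by linarith
      next
        case False
        then obtain i where i: "i \<in> I" "v \<in> P i" using v by (auto simp: U_def)
        have "nbrs E (S0 \<union> U) v \<subseteq> P i - {v}"
        proof
          fix y assume y: "y \<in> nbrs E (S0 \<union> U) v"
          hence Evy: "E v y" by (simp add: nbrs_def)
          hence Eyv: "E y v" using sym by (auto dest: sympD)
          have "y \<notin> S0" using S0X[OF i(1), of v y] P(1)[OF i(1)] i(2) Eyv by blast
          then obtain j where j: "j \<in> I" "y \<in> P j" using y by (auto simp: U_def nbrs_def)
          hence "j = i" using P2[OF i(1) j(1) _ i(2) j(2)] Evy by blast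
          moreover have "y \<noteq> v" using Evy irrefl by (auto dest: irreflpD)
          ultimately show "y \<in> P i - {v}" using j by blast
        qed
        hence "card (nbrs E (S0 \<union> U) v) \<le> card (P i - {v})" using fP[OF i(1)] by (intro card_mono) auto
        also have "\<dots> = 1" using i P(2)[OF i(1)] fP[OF i(1)] by simp
        finally show ?thesis .
      qed
    qed
  qed
  moreover have "card (S0 \<union> U) = card S0 + card U"
    using S0(1) UV S0U finite_subV by (intro card_Un_disjoint) auto
  ultimately show ?thesis using cU by simp
qed

end

text \<open>The sets \<open>M i\<close> are approximations of the \<open>k\<close> parts we are looking for; \<open>part i\<close> collects the
  vertices that look as if they belonged with \<open>M i\<close>.\<close>

locale part_classification = bounded_dissociation +
  fixes M :: "nat \<Rightarrow> 'a set" and \<sigma> q \<kappa> :: nat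
  assumes M_sub: "\<And>i. i < k \<Longrightarrow> M i \<subseteq> V"
    and M_disj: "\<And>i j. i < k \<Longrightarrow> j < k \<Longrightarrow> i \<noteq> j \<Longrightarrow> M i \<inter> M j = {}"
    and M_cross: "\<And>i j x. i < k \<Longrightarrow> j < k \<Longrightarrow> i \<noteq> j \<Longrightarrow> x \<in> M i \<Longrightarrow> card (nbrs E (M j) x) \<le> \<sigma>"
    and kappa: "\<kappa> = 2 * k * \<sigma> + 2"
    and M_size: "\<And>i. i < k \<Longrightarrow> 3 * q + \<kappa> + 3 \<le> card (M i)"
begin

definition part :: "nat \<Rightarrow> 'a set" where
  "part i = {v\<in>V. card (non_nbrs E (M i) v) < \<kappa> \<and> (\<forall>j<k. j \<noteq> i \<longrightarrow> card (nbrs E (M j) v) \<le> q)}"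

lemma finite_M: "i < k \<Longrightarrow> finite (M i)"
  using M_sub finite_subV by blast

lemma part_sub: "part i \<subseteq> V"
  by (auto simp: part_def)

text \<open>If \<open>v\<close> missed at least \<open>\<kappa>\<close> vertices of every
  \<open>M i\<close>, pairs from these sets of non-neighbours would extend \<open>{v}\<close> to
  \<open>2 * k + 1\<close> dissociated vertices; \<open>\<kappa>\<close> is the size at which such
  pairs can be chosen in all \<open>k\<close> sets.\<close>

lemma few_non_nbrs:
  assumes "v \<in> V"
  shows "\<exists>i<k. card (non_nbrs E (M i) v) < \<kappa>"
proof (rule ccontr)
  assume neg: "\<not> ?thesis"
  have "card {v} + 2 * card {..<k} \<le> 2 * k"
  proof (rule dissociated_extend_le[where X = "\<lambda>i. non_nbrs E (M i) v" and \<sigma> = \<sigma>])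
    have "nbrs E {v} v = {}" using irrefl by (auto simp: nbrs_def dest: irreflpD)
    thus "\<And>w. w \<in> {v} \<Longrightarrow> card (nbrs E {v} w) \<le> 1" by simp
    show "non_nbrs E (M i) v \<subseteq> V" if "i \<in> {..<k}" for i using M_sub[of i] that by (auto simp: non_nbrs_def)
    show "non_nbrs E (M i) v \<inter> non_nbrs E (M j) v = {}" if "i \<in> {..<k}" "j \<in> {..<k}" "i \<noteq> j" for i j
      using M_disj[of i j] that by (auto simp: non_nbrs_def)
    show "card (nbrs E (non_nbrs E (M j) v) x) \<le> \<sigma>"
      if "i \<in> {..<k}" "j \<in> {..<k}" "i \<noteq> j" "x \<in> non_nbrs E (M i) v" for i j x
    proof -
      have "card (nbrs E (non_nbrs E (M j) v) x) \<le> card (nbrs E (M j) x)"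
        using that finite_M by (intro card_nbrs_mono) (auto simp: non_nbrs_def)
      thus ?thesis using M_cross[of i j x] that by (auto simp: non_nbrs_def)
    qed
    show "2 * card {..<k} * \<sigma> + 2 \<le> card (non_nbrs E (M i) v)" if "i \<in> {..<k}" for i
      using neg that unfolding kappa by (metis card_lessThan lessThan_iff not_less)
    show "x \<noteq> s \<and> \<not> E s x" if "x \<in> non_nbrs E (M i) v" "s \<in> {v}" for i x s
      using that by (auto simp: non_nbrs_def nbrs_def)
  qed (use assms in auto)
  thus False by simp
qed

lemma many_nbrs:
  assumes "i < k" "card (non_nbrs E (M i) v) < \<kappa>"
  shows "card (M i) \<le> card (nbrs E (M i) v) + \<kappa>"
  using card_le_nbrs_non_nbrs[OF finite_M[OF assms(1)], of E v] assms(2) by linarith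

lemma part_disj:
  assumes "i < k" "j < k" "i \<noteq> j"
  shows "part i \<inter> part j = {}"
proof -
  have False if "v \<in> part i" "v \<in> part j" for v
  proof -
    have "card (M i) \<le> card (nbrs E (M i) v) + \<kappa>" using many_nbrs[OF assms(1)] that(1) by (simp add: part_def)
    moreover have "card (nbrs E (M i) v) \<le> q" using that(2) assms by (simp add: part_def)
    ultimately show False using M_size[OF assms(1)] by linarith
  qed
  thus ?thesis by blast
qed

text \<open>Vertices of one part have at most \<open>q\<close> neighbours in every other
  \<open>M j\<close>. If one of them missed two others, the three would be dissociated; deleting
  them and their neighbours from another \<open>M j\<close> costs at most \<open>3 * q + 3\<close>
  vertices and leaves \<open>\<kappa>\<close>, enough for a pair in each of the \<open>k - 1\<close>
  other sets, so \<open>3 + 2 * (k - 1)\<close> dissociated vertices.\<close>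

lemma part_comatching:
  assumes i: "i < k"
  shows "comatching E (part i)"
  unfolding comatching_def
proof (intro ballI impI, rule ccontr)
  fix v w w' assume *: "v \<in> part i" "w \<in> part i" "w' \<in> part i" "v \<noteq> w" "v \<noteq> w'" "w \<noteq> w'" "\<not> E v w" "\<not> E v w'"
  have sw: "\<not> E w v" "\<not> E w' v" using * sym by (auto dest: sympD)
  define X where "X j = M j - nbrs E (M j) v - nbrs E (M j) w - nbrs E (M j) w' - {v, w, w'}" for j
  have cI: "card ({..<k} - {i}) = k - 1" using i by simp
  have "card {v, w, w'} + 2 * card ({..<k} - {i}) \<le> 2 * k"
  proof (rule dissociated_extend_le[where X = X and \<sigma> = \<sigma>])
    show "card (nbrs E {v, w, w'} u) \<le> 1" if "u \<in> {v, w, w'}" for u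
    proof -
      have "nbrs E {v, w, w'} v = {}" "nbrs E {v, w, w'} w \<subseteq> {w'}" "nbrs E {v, w, w'} w' \<subseteq> {w}"
        using * sw irrefl by (auto simp: nbrs_def dest: irreflpD)
      thus ?thesis using that card_mono[of "{w'}" "nbrs E {v, w, w'} w"] card_mono[of "{w}" "nbrs E {v, w, w'} w'"]
        by auto
    qed
    show "X j \<subseteq> V" if "j \<in> {..<k} - {i}" for j using that M_sub[of j] by (auto simp: X_def)
    show "X j \<inter> X l = {}" if "j \<in> {..<k} - {i}" "l \<in> {..<k} - {i}" "j \<noteq> l" for j l
      using that M_disj[of j l] by (auto simp: X_def)
    show "card (nbrs E (X l) x) \<le> \<sigma>" if "j \<in> {..<k} - {i}" "l \<in> {..<k} - {i}" "j \<noteq> l" "x \<in> X j" for j l x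
    proof -
      have "card (nbrs E (X l) x) \<le> card (nbrs E (M l) x)"
        using that finite_M by (intro card_nbrs_mono) (auto simp: X_def)
      thus ?thesis using M_cross[of j l x] that by (auto simp: X_def)
    qed
    show "2 * card ({..<k} - {i}) * \<sigma> + 2 \<le> card (X j)" if j: "j \<in> {..<k} - {i}" for j
    proof -
      have n: "card (nbrs E (M j) u) \<le> q" if "u \<in> part i" for u using that j by (simp add: part_def)
      define Y1 where "Y1 = M j - nbrs E (M j) v"
      define Y2 where "Y2 = Y1 - nbrs E (M j) w"
      define Y3 where "Y3 = Y2 - nbrs E (M j) w'"
      have f: "finite (M j)" "finite Y1" "finite Y2" "finite Y3" using finite_M j by (auto simp: Y1_def Y2_def Y3_def)
      have "card (M j) - q \<le> card Y1" "card Y1 - q \<le> card Y2" "card Y2 - q \<le> card Y3"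
        using diff_card_le_card_Diff[of "nbrs E (M j) v" "M j"] diff_card_le_card_Diff[of "nbrs E (M j) w" Y1]
          diff_card_le_card_Diff[of "nbrs E (M j) w'" Y2] n[OF *(1)] n[OF *(2)] n[OF *(3)] f
        by (auto simp: Y1_def Y2_def Y3_def)
      moreover have "card Y3 - 3 \<le> card (X j)"
        using diff_card_le_card_Diff[of "{v, w, w'}" Y3] *(4-6) f by (simp add: X_def Y1_def Y2_def Y3_def)
      moreover have "2 * card ({..<k} - {i}) * \<sigma> + 2 \<le> \<kappa>" unfolding cI kappa by simp
      ultimately show ?thesis using M_size[of j] j by auto
    qed
    show "x \<noteq> s \<and> \<not> E s x" if "x \<in> X j" "s \<in> {v, w, w'}" for j x s
      using that by (auto simp: X_def nbrs_def)
  qed (use * part_sub in auto)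
  moreover have "card {v, w, w'} = 3" using * by simp
  ultimately show False using cI i by simp
qed

text \<open>Every vertex fits some \<open>M i\<close> by \<open>few_non_nbrs\<close>, so it can stay
  unclassified only by having many neighbours in a second set. These surplus neighbours are what the
  edge counts use against such vertices.\<close>

lemma unclassified:
  assumes "v \<in> V" "\<forall>i<k. v \<notin> part i"
  shows "\<exists>i<k. \<exists>j<k. i \<noteq> j \<and> card (M i) \<le> card (nbrs E (M i) v) + \<kappa> \<and> q < card (nbrs E (M j) v)"
proof -
  obtain i where i: "i < k" "card (non_nbrs E (M i) v) < \<kappa>" using few_non_nbrs[OF assms(1)] by blast
  then obtain j where "j < k" "j \<noteq> i" "q < card (nbrs E (M j) v)"
    using assms by (auto simp: part_def not_le)
  thus ?thesis using i many_nbrs[OF i] by blast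
qed

end

section \<open>Edge counting: few vertices of high degree, and parts of exact size\<close>

lemma degsum_le_card_sq:
  assumes "finite X"
  shows "degsum E X \<le> (real (card X))\<^sup>2"
proof -
  have "degsum E X \<le> (\<Sum>v\<in>X. real (card X))"
    unfolding degsum_def using card_nbrs_le[OF assms] by (intro sum_mono) simp
  thus ?thesis by (simp add: power2_eq_square)
qed

lemma degsum_ge_Diff:
  assumes "symp E" "finite V" "W \<subseteq> V"
  shows "degsum E (V - W) + 2 * (\<Sum>v\<in>W. real (card (nbrs E V v))) - (real (card W))\<^sup>2 \<le> degsum E V"
proof -
  have f: "finite W" "finite (V - W)" using assms finite_subset by auto
  have V: "V = W \<union> (V - W)" "W \<inter> (V - W) = {}" using assms by auto
  have "degsum E V = degsum E W + degsum E (V - W) + 2 * (\<Sum>v\<in>W. real (card (nbrs E (V - W) v)))"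
    using degsum_Un[OF assms(1) f V(2)] V(1) by simp
  moreover have "(\<Sum>v\<in>W. real (card (nbrs E V v))) = degsum E W + (\<Sum>v\<in>W. real (card (nbrs E (V - W) v)))"
    unfolding degsum_def sum.distrib[symmetric]
    by (rule sum.cong[OF refl]) (use card_nbrs_Un[OF f V(2), of E] V(1) in simp)
  ultimately show ?thesis using degsum_le_card_sq[OF f(1), of E] by linarith
qed

text \<open>By \<open>es\<close> the graph left after deleting \<open>s\<close> vertices still has
  nearly the extremal number of edges. Deleting vertices of degree above
  \<open>(1 + \<delta>) * m\<close> thus leaves a surplus of \<open>2 * \<delta> * n * s\<close> in
  \<open>k\<close> times the degree sum, of which the correction for edges inside the deleted set
  uses at most half. The error \<open>\<delta>\<^sup>2 / (4 * k)\<close> is chosen to stay below the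
  other half.\<close>

lemma few_high_degree:
  fixes \<delta> C :: real
  assumes "symp E" "finite V" "card V = k * m" "k \<ge> 1" "0 < \<delta>" "0 \<le> C"
    and dens: "degsum E V \<le> real m * real (card V)"
    and es: "\<And>X. X \<subseteq> V \<Longrightarrow> (1 - \<delta>\<^sup>2 / (4 * real k)) * (real (card X))\<^sup>2 - C * real (card X) \<le> real k * degsum E X"
    and m: "2 / \<delta> \<le> real m" "4 * C / \<delta>\<^sup>2 < real m"
  shows "real (card {v\<in>V. (1 + \<delta>) * real m < real (card (nbrs E V v))}) \<le> \<delta> * real m"
proof (rule ccontr)
  define H where "H = {v\<in>V. (1 + \<delta>) * real m < real (card (nbrs E V v))}"
  assume "\<not> ?thesis"
  hence big: "\<delta> * real m < real (card H)" by (simp add: H_def)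
  \<comment> \<open>Only \<open>s \<le> \<delta> * m\<close> of these vertices are deleted, so that
    the correction \<open>k * s\<^sup>2\<close> is at most \<open>\<delta> * n * s\<close>.\<close>
  define s where "s = nat \<lfloor>\<delta> * real m\<rfloor>"
  have sm: "real s \<le> \<delta> * real m" "\<delta> * real m - 1 \<le> real s"
    using assms(5) by (auto simp: s_def)
  have s2: "\<delta> * real m / 2 \<le> real s" using sm m(1) assms(5) by (simp add: field_simps)
  have "s \<le> card H" using sm big by linarith
  then obtain W where W: "W \<subseteq> H" "card W = s" by (metis obtain_subset_with_card_n)
  have WV: "W \<subseteq> V" using W by (auto simp: H_def)
  define n where "n = real (card V)"
  have n: "n = real k * real m" using assms(3) by (simp add: n_def)
  have mpos: "0 < real m" using m(1) assms(5) by (smt (verit) divide_pos_pos)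
  have npos: "0 < n" using mpos assms(4) n by simp
  have "(\<Sum>v\<in>W. (1 + \<delta>) * real m) \<le> (\<Sum>v\<in>W. real (card (nbrs E V v)))"
    using W by (intro sum_mono) (auto simp: H_def less_imp_le)
  hence dW: "real s * ((1 + \<delta>) * real m) \<le> (\<Sum>v\<in>W. real (card (nbrs E V v)))" using W by simp
  have "degsum E (V - W) + 2 * (real s * ((1 + \<delta>) * real m)) - (real s)\<^sup>2 \<le> real m * n"
    using degsum_ge_Diff[OF assms(1,2) WV] dW W(2) dens by (simp add: n_def)
  hence "real k * (degsum E (V - W) + 2 * (real s * ((1 + \<delta>) * real m)) - (real s)\<^sup>2) \<le> real k * (real m * n)"
    by (intro mult_left_mono) auto
  hence 1: "real k * degsum E (V - W) + 2 * real s * (1 + \<delta>) * n - real k * (real s)\<^sup>2 \<le> n\<^sup>2"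
    by (simp add: n algebra_simps power2_eq_square)
  have fW: "finite W" using WV assms(2) finite_subset by blast
  have cX: "real (card (V - W)) = n - real s"
    using card_Diff_subset[OF fW WV] card_mono[OF assms(2) WV] W(2) by (simp add: n_def of_nat_diff)
  have sn: "real s \<le> n" using card_mono[OF assms(2) WV] W(2) by (simp add: n_def)
  define e where "e = \<delta>\<^sup>2 / (4 * real k)"
  have e: "0 \<le> e" by (simp add: e_def)
  have 2: "(1 - e) * (n - real s)\<^sup>2 - C * (n - real s) \<le> real k * degsum E (V - W)"
    using es[of "V - W"] by (simp add: cX e_def)
  have "e * (n - real s)\<^sup>2 \<le> e * n\<^sup>2" using sn e by (intro mult_left_mono power_mono) auto
  moreover have "C * (n - real s) \<le> C * n" using assms(6) by (intro mult_left_mono) auto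
  moreover have "(n - real s)\<^sup>2 = n\<^sup>2 - 2 * real s * n + (real s)\<^sup>2" by (simp add: power2_eq_square algebra_simps)
  ultimately have 3: "n\<^sup>2 - 2 * real s * n + (real s)\<^sup>2 - e * n\<^sup>2 - C * n \<le> real k * degsum E (V - W)"
    using 2 by (simp add: left_diff_distrib)
  have "real k * (real s)\<^sup>2 = (real k * real s) * real s" by (simp add: power2_eq_square)
  also have "\<dots> \<le> (real k * (\<delta> * real m)) * real s" using sm by (intro mult_right_mono mult_left_mono) auto
  also have "\<dots> = \<delta> * n * real s" by (simp add: n)
  finally have 4: "real k * (real s)\<^sup>2 \<le> \<delta> * n * real s" .
  have "\<delta> * n * real s \<le> e * n\<^sup>2 + C * n"
  proof -
    have "2 * real s * (1 + \<delta>) * n = 2 * real s * n + 2 * (\<delta> * n * real s)" by (simp add: algebra_simps)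
    thus ?thesis using 1 3 4 zero_le_power2[of "real s"] by linarith
  qed
  hence "n * (\<delta> * real s) \<le> n * (e * n + C)" by (simp add: algebra_simps power2_eq_square)
  hence "\<delta> * real s \<le> e * n + C" using npos by simp
  moreover have "\<delta> * (\<delta> * real m / 2) \<le> \<delta> * real s" using s2 assms(5) by (intro mult_left_mono) auto
  moreover have "e * n = \<delta>\<^sup>2 * real m / 4" using assms(4) by (simp add: e_def n)
  ultimately have "\<delta>\<^sup>2 * real m / 4 \<le> C" by (simp add: power2_eq_square)
  thus False using m(2) assms(5) by (simp add: field_simps)
qed

context part_classification
begin

lemma nbrs_union_ge:
  assumes "v \<in> V"
  shows "\<exists>i<k. card (M i) \<le> card (nbrs E (\<Union>i<k. M i) v) + \<kappa>"
proof -
  obtain i where i: "i < k" "card (non_nbrs E (M i) v) < \<kappa>" using few_non_nbrs[OF assms] by blast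
  have "card (nbrs E (M i) v) \<le> card (nbrs E (\<Union>i<k. M i) v)"
    using i finite_M by (intro card_nbrs_mono) auto
  thus ?thesis using many_nbrs[OF i] i(1) by (intro exI[of _ i]) simp
qed

lemma unclassified_nbrs_union_ge:
  assumes "v \<in> V" "\<forall>i<k. v \<notin> part i"
  shows "\<exists>i<k. card (M i) + q + 1 \<le> card (nbrs E (\<Union>i<k. M i) v) + \<kappa>"
proof -
  obtain i j where ij: "i < k" "j < k" "i \<noteq> j" "card (M i) \<le> card (nbrs E (M i) v) + \<kappa>" "q < card (nbrs E (M j) v)"
    using unclassified[OF assms] by blast
  have "card (nbrs E (M i \<union> M j) v) \<le> card (nbrs E (\<Union>i<k. M i) v)"
    using ij finite_M by (intro card_nbrs_mono) auto
  moreover have "card (nbrs E (M i \<union> M j) v) = card (nbrs E (M i) v) + card (nbrs E (M j) v)"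
    using ij finite_M M_disj by (intro card_nbrs_Un) auto
  ultimately show ?thesis using ij by (intro exI[of _ i]) simp
qed

lemma card_parts:
  "card V = (\<Sum>i<k. card (part i)) + card (V - (\<Union>i<k. part i))"
proof -
  have "card (\<Union>i<k. part i) = (\<Sum>i<k. card (part i))"
    using part_sub finite_subV part_disj by (intro card_UN_disjoint) auto
  moreover have "(\<Union>i<k. part i) \<subseteq> V" using part_sub by blast
  ultimately show ?thesis
    by (metis card_Diff_subset card_mono finite_V finite_subset le_add_diff_inverse)
qed

end

text \<open>All degrees are at least \<open>card X - 2\<close>, so more than \<open>m\<close>
  vertices would have average degree at least \<open>m - 1\<close>, while
  \<open>3 / m < 1\<close>.\<close>

lemma comatching_card_le:
  assumes "finite X" "comatching E X" "degsum E X \<le> (real m - 2 + 3 / real m) * real (card X)" "m > 3"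
  shows "card X \<le> m"
proof (rule ccontr)
  assume "\<not> ?thesis"
  hence c: "real m + 1 \<le> real (card X)" by linarith
  have "real (card X) * (real (card X) - 2) \<le> real (card X) * (real m - 2 + 3 / real m)"
    using comatching_degsum[OF assms(1,2)] assms(3) by (simp add: mult.commute)
  hence "real (card X) - 2 \<le> real m - 2 + 3 / real m" using c by (subst (asm) mult_le_cancel_left) linarith
  moreover have "3 / real m < 1" using assms(4) by simp
  ultimately show False using c by linarith
qed

text \<open>If the sets \<open>M i\<close> fill up all but few vertices, an unclassified vertex has degree at least about
  \<open>9/8 m\<close>, which the edge count forbids.\<close>

lemma (in part_classification) parts_exact:
  fixes m :: nat
  assumes k: "k \<ge> 1"
    and V: "card V = k * m"
    and dens: "\<And>X. X \<subseteq> V \<Longrightarrow> degsum E X \<le> (real m - 2 + 3 / real m) * real (card X)"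
    and M_part: "\<And>i. i < k \<Longrightarrow> M i \<subseteq> part i"
    and rest: "32 * (k * m - card (\<Union>i<k. M i)) \<le> m"
    and high: "\<And>i. i < k \<Longrightarrow> 9 * m + 8 * \<kappa> \<le> 8 * (card (M i) + q + 1)"
    and m: "24 * k < m"
  shows "(\<forall>i<k. card (part i) = m) \<and> (\<Union>i<k. part i) = V"
proof -
  define P where "P = (\<Union>i<k. part i)"
  define B where "B = V - P"
  have PV: "P \<subseteq> V" using part_sub by (auto simp: P_def)
  have fin: "finite P" "finite B" "finite V" using PV finite_V finite_subset by (auto simp: B_def)
  have m3: "3 < m" using m k by linarith
  have c: "card (part i) \<le> m" if "i < k" for i
    using that part_sub finite_subV part_comatching dens m3 by (intro comatching_card_le) auto
  have cB: "k * m = (\<Sum>i<k. card (part i)) + card B" using card_parts V by (simp add: B_def P_def)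
  have "(\<Union>i<k. M i) \<subseteq> P" using M_part by (auto simp: P_def)
  hence "card (\<Union>i<k. M i) \<le> card P" using fin by (intro card_mono)
  moreover have "card B = card V - card P" using PV fin by (simp add: B_def card_Diff_subset)
  ultimately have B32: "32 * card B \<le> m" using rest V by linarith
  have degB: "9 / 8 * real m \<le> real (card (nbrs E V v))" if "v \<in> B" for v
  proof -
    have v: "v \<in> V" "\<forall>i<k. v \<notin> part i" using that by (auto simp: B_def P_def)
    then obtain i where i: "i < k" "card (M i) + q + 1 \<le> card (nbrs E (\<Union>i<k. M i) v) + \<kappa>"
      using unclassified_nbrs_union_ge by blast
    have "card (nbrs E (\<Union>i<k. M i) v) \<le> card (nbrs E V v)"
      using M_sub fin by (intro card_nbrs_mono) auto
    hence "card (M i) + q + 1 \<le> card (nbrs E V v) + \<kappa>" using i(2) by (rule le_trans[rotated, OF add_right_mono])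
    hence "9 * m \<le> 8 * card (nbrs E V v)" using high[OF i(1)] by simp
    thus ?thesis by linarith
  qed
  have dP: "(\<Sum>i<k. degsum E (part i)) \<le> degsum E P"
  proof -
    have "degsum E P = (\<Sum>i<k. \<Sum>v\<in>part i. real (card (nbrs E P v)))"
      unfolding degsum_def P_def using part_sub finite_subV part_disj
      by (subst sum.UNION_disjoint) auto
    moreover have "degsum E (part i) \<le> (\<Sum>v\<in>part i. real (card (nbrs E P v)))" if "i < k" for i
      unfolding degsum_def using that fin by (intro sum_mono of_nat_mono card_nbrs_mono) (auto simp: P_def)
    ultimately show ?thesis by (metis (no_types, lifting) lessThan_iff sum_mono)
  qed
  \<comment> \<open>The tangent of \<open>x * (x - 2)\<close> at \<open>x = m\<close>: being linear
    in the deficit \<open>m - card (part i)\<close>, it sums to a bound that involves only the total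
    deficit \<open>card B\<close>.\<close>
  have dpart: "real m * (real m - 2) - 2 * (real m - 1) * (real m - real (card (part i))) \<le> degsum E (part i)"
    if "i < k" for i
  proof -
    have "real m * (real m - 2) - 2 * (real m - 1) * (real m - real (card (part i)))
      = real (card (part i)) * (real (card (part i)) - 2) - (real m - real (card (part i)))\<^sup>2"
      by (simp add: algebra_simps power2_eq_square)
    also have "\<dots> \<le> real (card (part i)) * (real (card (part i)) - 2)" by simp
    also have "\<dots> \<le> degsum E (part i)"
      using that part_sub finite_subV part_comatching by (intro comatching_degsum) auto
    finally show ?thesis .
  qed
  have cBr: "(\<Sum>i<k. real m - real (card (part i))) = real (card B)"
    using cB by (simp add: sum_subtractf flip: of_nat_sum of_nat_mult)
  have "real k * (real m * (real m - 2)) - 2 * (real m - 1) * real (card B)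
      = (\<Sum>i<k. real m * (real m - 2) - 2 * (real m - 1) * (real m - real (card (part i))))"
    by (simp add: sum_subtractf sum_distrib_left[symmetric] cBr[symmetric])
  also have "\<dots> \<le> degsum E P" using dP dpart sum_mono[of "{..<k}"] by (smt (verit) lessThan_iff)
  finally have dP': "real k * (real m * (real m - 2)) - 2 * (real m - 1) * real (card B) \<le> degsum E P" .
  have "(\<Sum>v\<in>B. 9 / 8 * real m) \<le> (\<Sum>v\<in>B. real (card (nbrs E V v)))" by (rule sum_mono) (rule degB)
  hence dB: "real (card B) * (9 / 8 * real m) \<le> (\<Sum>v\<in>B. real (card (nbrs E V v)))" by simp
  have BV: "B \<subseteq> V" and "V - B = P" using PV by (auto simp: B_def)
  hence "degsum E P + 2 * (real (card B) * (9 / 8 * real m)) - (real (card B))\<^sup>2 \<le> degsum E V"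
    using degsum_ge_Diff[OF sym fin(3) BV] dB unfolding \<open>V - B = P\<close> by linarith
  \<comment> \<open>Over all \<open>k * m\<close> vertices the slack \<open>3 / m\<close> amounts to
    \<open>3 * k\<close>, independently of \<open>m\<close>.\<close>
  also have "degsum E V \<le> real k * (real m * (real m - 2)) + 3 * real k"
  proof -
    have "(real m - 2 + 3 / real m) * (real k * real m) = real k * (real m * (real m - 2)) + 3 * real k"
      using m3 by (simp add: field_simps)
    thus ?thesis using dens[of V] V by simp
  qed
  \<comment> \<open>A vertex outside the parts adds \<open>9 / 4 * m\<close> to the degree sum,
    whereas each vertex lacking in a part costs only \<open>2 * (m - 1)\<close>; the subtracted
    \<open>card B\<close> accounts for edges inside \<open>B\<close>.\<close>
  finally have fin_ineq: "real (card B) * (real m / 4 + 2 - real (card B)) \<le> 3 * real k"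
    using dP' by (simp add: algebra_simps power2_eq_square)
  have B0: "card B = 0"
  proof (rule ccontr)
    assume "card B \<noteq> 0"
    hence b1: "1 \<le> real (card B)" by simp
    have mb: "real m / 8 \<le> real m / 4 + 2 - real (card B)" using B32 by linarith
    have "1 * (real m / 8) \<le> real (card B) * (real m / 4 + 2 - real (card B))"
      by (rule mult_mono[OF b1 mb]) auto
    thus False using fin_ineq m by linarith
  qed
  have "(\<Sum>i<k. m - card (part i)) = 0"
  proof -
    have "(\<Sum>i<k. real m - real (card (part i))) = 0" using cBr B0 by simp
    hence "\<forall>i\<in>{..<k}. real m - real (card (part i)) = 0" using c
      by (subst sum_nonneg_eq_0_iff[symmetric]) auto
    thus ?thesis by simp
  qed
  hence "\<forall>i<k. card (part i) = m" using c by (auto simp: le_antisym)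
  moreover have "P = V" using B0 fin PV by (auto simp: B_def)
  ultimately show ?thesis by (simp add: P_def)
qed

text \<open>The first round compares vertices with separated sets of bounded size, chosen among
  vertices of degree at most \<open>(1 + \<delta>) * m\<close>; it leaves at most
  \<open>\<eta> * m\<close> vertices unclassified. Its parts, without the vertices of high degree,
  serve as the sets of the second round, to which \<open>parts_exact\<close> applies.\<close>

theorem comatching_partition:
  fixes k :: nat
  assumes k: "k \<ge> 1"
  shows "\<exists>m0. \<forall>m\<ge>m0. \<forall>(V :: 'a set) E. bounded_dissociation V E k \<longrightarrow> card V = k * m \<longrightarrow>
    (\<forall>X\<subseteq>V. degsum E X \<le> (real m - 2 + 3 / real m) * real (card X)) \<longrightarrow>
    (\<exists>P. (\<forall>i<k. card (P i) = m \<and> comatching E (P i)) \<and>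
      (\<forall>i<k. \<forall>j<k. i \<noteq> j \<longrightarrow> P i \<inter> P j = {}) \<and> (\<Union>i<k. P i) = V)"
proof -
  \<comment> \<open>\<open>(2 * k + 1) * \<eta> = 1 / 16\<close> bounds the loss in the second
    round: \<open>\<kappa>\<close> is about \<open>2 * k * \<eta> * m\<close>, and each set falls
    short of \<open>m\<close> by at most \<open>\<eta> * m\<close>.\<close>
  define \<eta> :: real where "\<eta> = 1 / (16 * (2 * real k + 1))"
  define \<delta> where "\<delta> = \<eta> / (18 * real k)"
  have k1: "1 \<le> real k" using k by simp
  have \<eta>: "0 < \<eta>" "\<eta> \<le> 1 / 48" using k by (auto simp: \<eta>_def field_simps)
  have \<eta>k: "(2 * real k + 1) * \<eta> = 1 / 16" by (simp add: \<eta>_def add_pos_nonneg)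
  have \<delta>: "0 < \<delta>" "\<delta> \<le> 1 / 4" using \<eta> k by (auto simp: \<delta>_def field_simps)
  have \<delta>k: "18 * real k * \<delta> = \<eta>" using k by (simp add: \<delta>_def)
  obtain q0 :: nat where q0: "4 * real k / \<eta> < real q0" using reals_Archimedean2 by blast
  \<comment> \<open>The size \<open>3 * q + \<kappa> + 3\<close> that
    \<open>part_classification\<close> asks for, with \<open>q = q0\<close> and
    \<open>\<kappa> = 2\<close>, the value for \<open>\<sigma> = 0\<close>.\<close>
  define t where "t = 3 * q0 + 5"
  have e1: "0 < \<delta>\<^sup>2 / (4 * real k)" "\<delta>\<^sup>2 / (4 * real k) \<le> 1"
  proof -
    have "\<delta>\<^sup>2 \<le> 1" using \<delta> by (simp add: power_le_one)
    thus "0 < \<delta>\<^sup>2 / (4 * real k)" "\<delta>\<^sup>2 / (4 * real k) \<le> 1" using \<delta> k by (auto simp: field_simps)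
  qed
  \<comment> \<open>Two edge counts are prepared. There are no \<open>k + 1\<close> separated pairs,
    so every subset is nearly extremal for \<open>k\<close>; and without \<open>k\<close> separated
    sets of size \<open>t\<close>, the count for \<open>k - 1\<close> would force more edges than
    there are.\<close>
  obtain C1 where C1: "C1 \<ge> 0" "\<And>(E :: 'a \<Rightarrow> 'a \<Rightarrow> bool) V. symp E \<Longrightarrow> finite V \<Longrightarrow>
    (\<nexists>A. separated_family E V (Suc k) 2 A) \<Longrightarrow>
    (1 - \<delta>\<^sup>2 / (4 * real k)) * (real (card V))\<^sup>2 - C1 * real (card V) \<le> real k * degsum E V"
    using erdos_stone_complement[OF e1, where ?'a = 'a and k = k and t = 2] by blast
  have e2: "0 < 1 / (4 * real k)" "1 / (4 * real k) \<le> 1" using k by (auto simp: field_simps)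
  obtain C2 where C2: "C2 \<ge> 0" "\<And>(E :: 'a \<Rightarrow> 'a \<Rightarrow> bool) V. symp E \<Longrightarrow> finite V \<Longrightarrow>
    (\<nexists>A. separated_family E V (Suc (k - 1)) t A) \<Longrightarrow>
    (1 - 1 / (4 * real k)) * (real (card V))\<^sup>2 - C2 * real (card V) \<le> real (k - 1) * degsum E V"
    using erdos_stone_complement[OF e2, where ?'a = 'a and k = "k - 1" and t = t] by blast
  obtain m0 :: nat where m0: "max (max (2 / \<delta>) (4 * C1 / \<delta>\<^sup>2)) (max (2 * C2) (16 * (4 * real k + 6))) < real m0"
    using reals_Archimedean2 by blast
  show ?thesis
  proof (intro exI[of _ m0] allI impI)
    fix m :: nat and V :: "'a set" and E
    assume mm: "m0 \<le> m" and bd: "bounded_dissociation V E k" and cV: "card V = k * m"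
      and dens0: "\<forall>X\<subseteq>V. degsum E X \<le> (real m - 2 + 3 / real m) * real (card X)"
    interpret bounded_dissociation V E k by (rule bd)
    have mr: "2 / \<delta> \<le> real m" "4 * C1 / \<delta>\<^sup>2 < real m" "2 * C2 < real m" "16 * (4 * real k + 6) < real m"
      using m0 mm by (auto simp: less_le_trans)
    have m64: "64 * real k + 96 < real m" using mr(4) by simp
    have m100: "real m > 160" using m64 k1 by linarith
    have dens: "degsum E X \<le> (real m - 2 + 3 / real m) * real (card X)" if "X \<subseteq> V" for X
      using dens0 that by blast
    have densm: "degsum E X \<le> real m * real (card X)" if "X \<subseteq> V" for X
    proof -
      have "3 / real m \<le> 2" using m100 by (simp add: field_simps)
      hence "(real m - 2 + 3 / real m) * real (card X) \<le> real m * real (card X)" by (intro mult_right_mono) auto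
      thus ?thesis using dens[OF that] by linarith
    qed
    have nofam: "\<nexists>A. separated_family E X (Suc k) 2 A" if "X \<subseteq> V" for X
    proof
      assume "\<exists>A. separated_family E X (Suc k) 2 A"
      then obtain A where A: "separated_family E X (Suc k) 2 A" by blast
      have "card ({} :: 'a set) + 2 * card {..<Suc k} \<le> 2 * k"
      proof (rule dissociated_extend_le[where X = A and \<sigma> = 0])
        show "card (nbrs E (A j) x) \<le> 0" if "i \<in> {..<Suc k}" "j \<in> {..<Suc k}" "i \<noteq> j" "x \<in> A i" for i j x
        proof -
          have "nbrs E (A j) x = {}" using A that unfolding separated_family_def nbrs_def by blast
          thus ?thesis by simp
        qed
        show "A i \<subseteq> V" if "i \<in> {..<Suc k}" for i
          using A \<open>X \<subseteq> V\<close> that unfolding separated_family_def by blast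
        show "A i \<inter> A j = {}" if "i \<in> {..<Suc k}" "j \<in> {..<Suc k}" "i \<noteq> j" for i j
          using A that unfolding separated_family_def by blast
        show "2 * card {..<Suc k} * 0 + 2 \<le> card (A i)" if "i \<in> {..<Suc k}" for i
          using A that unfolding separated_family_def by simp
      qed auto
      thus False by simp
    qed
    define H where "H = {v\<in>V. (1 + \<delta>) * real m < real (card (nbrs E V v))}"
    have cH: "real (card H) \<le> \<delta> * real m"
      unfolding H_def
    proof (rule few_high_degree[OF sym finite_V cV k \<delta>(1) C1(1) densm[OF subset_refl] _ mr(1,2)])
      show "(1 - \<delta>\<^sup>2 / (4 * real k)) * (real (card X))\<^sup>2 - C1 * real (card X) \<le> real k * degsum E X"
        if "X \<subseteq> V" for X using C1(2)[OF sym finite_subV[OF that] nofam[OF that]] .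
    qed
    have HV: "H \<subseteq> V" and fH: "finite H" using finite_V by (auto simp: H_def)
    have fL: "finite (V - H)" using finite_V by simp
    have cVr: "real (card V) = real k * real m" using cV by simp
    have cL: "real (card (V - H)) = real k * real m - real (card H)"
      using card_Diff_subset[OF fH HV] card_mono[OF finite_V HV] cVr by (simp add: of_nat_diff)
    have "\<exists>A. separated_family E (V - H) (Suc (k - 1)) t A"
    proof (rule ccontr)
      assume no: "\<not> ?thesis"
      define x where "x = real (card (V - H))"
      have "\<delta> * real m \<le> 1 / 4 * real m" using \<delta> by (intro mult_right_mono) auto
      hence x: "(real k - 1 / 4) * real m \<le> x" using cL cH by (simp add: x_def algebra_simps)
      have "(1 - 1 / (4 * real k)) * x\<^sup>2 - C2 * x \<le> real (k - 1) * degsum E (V - H)"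
        using C2(2)[OF sym fL no] by (simp add: x_def)
      also have "\<dots> \<le> real (k - 1) * (real m * x)"
        using densm[of "V - H"] by (intro mult_left_mono) (auto simp: x_def)
      finally have "x * ((1 - 1 / (4 * real k)) * x - C2) \<le> x * ((real k - 1) * real m)"
        using k by (simp add: of_nat_diff algebra_simps power2_eq_square)
      moreover have "0 < (real k - 1 / 4) * real m" using k m100 by (intro mult_pos_pos) auto
      hence "0 < x" using x by linarith
      ultimately have u: "(1 - 1 / (4 * real k)) * x - C2 \<le> (real k - 1) * real m" by simp
      \<comment> \<open>The product is at least \<open>(k - 1 / 2) * m\<close>, which exceeds
        \<open>(k - 1) * m\<close> by half of \<open>m\<close> and so by more than
        \<open>C2\<close>.\<close>
      have "(1 - 1 / (4 * real k)) * ((real k - 1 / 4) * real m) \<le> (1 - 1 / (4 * real k)) * x"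
        using x e2 by (intro mult_left_mono) auto
      moreover have "(1 - 1 / (4 * real k)) * ((real k - 1 / 4) * real m) = (real k - 1 / 2 + 1 / (16 * real k)) * real m"
        using k by (simp add: field_simps)
      moreover have "(real k - 1 / 2 + 1 / (16 * real k)) * real m = (real k - 1 / 2) * real m + 1 / (16 * real k) * real m"
        by (rule distrib_right)
      moreover have "0 \<le> 1 / (16 * real k) * real m" by simp
      ultimately have "(real k - 1 / 2) * real m - C2 \<le> (real k - 1) * real m"
        using u by linarith
      hence "real m / 2 \<le> C2" by (simp add: algebra_simps)
      thus False using mr(3) by linarith
    qed
    then obtain A where A: "separated_family E (V - H) k t A" using k by auto
    have A': "A i \<subseteq> V - H" "card (A i) = t" if "i < k" for i
      using A that unfolding separated_family_def by auto
    have Adisj: "A i \<inter> A j = {}" if "i < k" "j < k" "i \<noteq> j" for i j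
      using A that unfolding separated_family_def by blast
    interpret A: part_classification V E k A 0 q0 2
    proof
      show "card (nbrs E (A j) x) \<le> 0" if "i < k" "j < k" "i \<noteq> j" "x \<in> A i" for i j x
      proof -
        have "nbrs E (A j) x = {}" using A that unfolding separated_family_def nbrs_def by blast
        thus ?thesis by simp
      qed
    qed (use A' Adisj t_def in auto)
    define U where "U = (\<Union>i<k. A i)"
    define B where "B = V - (\<Union>i<k. A.part i)"
    have UV: "U \<subseteq> V" "U \<subseteq> V - H" using A' by (auto simp: U_def)
    have fU: "finite U" using UV(1) finite_subV by blast
    have cU: "card U = k * t" unfolding U_def
      by (subst card_UN_disjoint) (use A' Adisj finite_subV A.finite_M in auto)
    have fB: "finite B" "B \<subseteq> V" using finite_V by (auto simp: B_def)
    \<comment> \<open>Edges between \<open>U\<close> and \<open>V\<close> are counted from both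
      sides. Every vertex has at least \<open>t - 2\<close> neighbours in \<open>U\<close>, an
      unclassified one at least \<open>t + q0 - 1\<close>, while the \<open>k * t\<close> vertices
      of \<open>U\<close> avoid \<open>H\<close> and have degree at most
      \<open>(1 + \<delta>) * m\<close>.\<close>
    have bb: "real (card B) * (real q0 + 1) \<le> (2 + real t * \<delta>) * (real k * real m)"
    proof -
      have "(\<Sum>v\<in>V. real t - 2 + (if v \<in> B then real q0 + 1 else 0)) \<le> (\<Sum>v\<in>V. real (card (nbrs E U v)))"
      proof (rule sum_mono)
        fix v assume v: "v \<in> V"
        have "t \<le> card (nbrs E U v) + 2" using A.nbrs_union_ge[OF v] A'(2) by (auto simp: U_def)
        moreover have "t + q0 + 1 \<le> card (nbrs E U v) + 2" if "v \<in> B"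
          using A.unclassified_nbrs_union_ge[OF v] that A'(2) by (auto simp: U_def B_def)
        ultimately show "real t - 2 + (if v \<in> B then real q0 + 1 else 0) \<le> real (card (nbrs E U v))"
          by (auto split: if_splits)
      qed
      also have "(\<Sum>v\<in>V. real (card (nbrs E U v))) = (\<Sum>v\<in>U. real (card (nbrs E V v)))"
        by (rule sum_nbrs_swap[OF sym finite_V fU])
      also have "\<dots> \<le> (\<Sum>v\<in>U. (1 + \<delta>) * real m)"
        using UV by (intro sum_mono) (auto simp: H_def not_less)
      also have "\<dots> = real t * (1 + \<delta>) * (real k * real m)" by (simp add: cU)
      also have "(\<Sum>v\<in>V. real t - 2 + (if v \<in> B then real q0 + 1 else 0))
        = (real t - 2) * (real k * real m) + real (card B) * (real q0 + 1)"
        using finite_V fB by (simp add: sum.distrib sum.If_cases cVr Int_absorb1)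
      finally show ?thesis by (simp add: algebra_simps)
    qed
    define Q where "Q = real q0 + 1"
    have Q: "4 * real k \<le> \<eta> * Q" "1 \<le> Q" using q0 \<eta> by (auto simp: Q_def field_simps)
    have t8: "real t \<le> 8 * Q" by (simp add: t_def Q_def)
    \<comment> \<open>Of \<open>\<eta> * m\<close>, a share of \<open>9 / 18\<close> goes to the
      term bounded by \<open>4 * k \<le> \<eta> * Q\<close>, \<open>8 / 18\<close> to the one
      bounded by \<open>t \<le> 8 * Q\<close>, and \<open>1 / 18\<close> to
      \<open>\<delta> * m\<close>.\<close>
    have cB\<delta>: "real (card B) + \<delta> * real m \<le> \<eta> * real m"
    proof -
      have "real (card B) * Q \<le> (2 + 8 * Q * \<delta>) * (real k * real m)"
      proof -
        have "real t * \<delta> \<le> 8 * Q * \<delta>" using t8 \<delta> by (intro mult_right_mono) auto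
        hence "(2 + real t * \<delta>) * (real k * real m) \<le> (2 + 8 * Q * \<delta>) * (real k * real m)"
          by (intro mult_right_mono) auto
        thus ?thesis using bb by (simp add: Q_def)
      qed
      also have "\<dots> = (2 * real k + 8 * Q * (real k * \<delta>)) * real m" by (simp add: algebra_simps)
      also have "\<dots> \<le> (\<eta> * Q / 2 + 8 * Q * (\<eta> / 18)) * real m"
        using Q \<delta>k by (intro mult_right_mono add_mono) (auto simp: field_simps)
      also have "\<dots> = Q * (17 / 18 * \<eta> * real m)" by (simp add: field_simps)
      finally have "real (card B) \<le> 17 / 18 * \<eta> * real m" using Q(2) by (simp add: mult.commute)
      moreover have "\<delta> * real m \<le> 1 / 18 * \<eta> * real m"
      proof (rule mult_right_mono)
        have "18 * \<delta> * 1 \<le> 18 * \<delta> * real k" using k \<delta> by (intro mult_left_mono) auto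
        thus "\<delta> \<le> 1 / 18 * \<eta>" using \<delta>k by (simp add: algebra_simps)
      qed auto
      ultimately show ?thesis by (simp add: algebra_simps)
    qed
    have cB: "real (card B) + real (card H) \<le> \<eta> * real m" using cB\<delta> cH by linarith
    have c1: "card (A.part i) \<le> m" if "i < k" for i
      using that A.part_sub finite_subV A.part_comatching dens m100 by (intro comatching_card_le) auto
    have c2: "m \<le> card (A.part i) + card B" if i: "i < k" for i
    proof -
      have "k * m = (\<Sum>j<k. card (A.part j)) + card B" using A.card_parts cV by (simp add: B_def)
      also have "(\<Sum>j<k. card (A.part j)) = card (A.part i) + (\<Sum>j\<in>{..<k} - {i}. card (A.part j))"
        using i by (simp add: sum.remove)
      also have "(\<Sum>j\<in>{..<k} - {i}. card (A.part j)) \<le> (\<Sum>j\<in>{..<k} - {i}. m)" using c1 by (intro sum_mono) auto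
      also have "\<dots> = (k - 1) * m" using i by simp
      finally have "k * m \<le> card (A.part i) + (k - 1) * m + card B" by simp
      moreover have "k * m = (k - 1) * m + m" using k by (cases k) auto
      ultimately show ?thesis by linarith
    qed
    define L where "L i = A.part i - H" for i
    have LV: "L i \<subseteq> V" for i using A.part_sub by (auto simp: L_def)
    have Ldisj: "L i \<inter> L j = {}" if "i < k" "j < k" "i \<noteq> j" for i j
      using A.part_disj[OF that] by (auto simp: L_def)
    have fLi: "finite (L i)" for i using LV finite_subV by blast
    have cLi: "real m - \<eta> * real m \<le> real (card (L i))" if "i < k" for i
    proof -
      have "card (A.part i) \<le> card (L i) + card H"
        unfolding L_def using diff_card_le_card_Diff[OF fH, of "A.part i"] by linarith
      thus ?thesis using c2[OF that] cB by linarith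
    qed
    \<comment> \<open>A vertex of \<open>L i\<close> has degree at most
      \<open>(1 + \<delta>) * m\<close> and at least \<open>m - card B - 2\<close> neighbours in its
      own part, hence at most \<open>card B + \<delta> * m + 2\<close> elsewhere.\<close>
    define \<sigma> where "\<sigma> = nat \<lfloor>\<eta> * real m\<rfloor> + 2"
    have \<sigma>: "real \<sigma> \<le> \<eta> * real m + 2" using \<eta> by (simp add: \<sigma>_def)
    have Lcross: "card (nbrs E (L j) x) \<le> \<sigma>" if "i < k" "j < k" "i \<noteq> j" "x \<in> L i" for i j x
    proof -
      have x: "x \<in> V" "x \<notin> H" "x \<in> A.part i" using that(4) A.part_sub by (auto simp: L_def)
      have "card (nbrs E (L j \<union> A.part i) x) \<le> card (nbrs E V x)"
        using LV A.part_sub finite_V by (intro card_nbrs_mono) auto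
      moreover have "card (nbrs E (L j \<union> A.part i) x) = card (nbrs E (L j) x) + card (nbrs E (A.part i) x)"
        using A.part_disj[OF that(1-3)] fLi A.part_sub finite_subV
        by (intro card_nbrs_Un) (auto simp: L_def)
      moreover have "card (A.part i) \<le> card (nbrs E (A.part i) x) + 2"
        using x(3) A.part_comatching[OF that(1)] A.part_sub finite_subV by (intro comatching_card_nbrs) auto
      moreover have "real (card (nbrs E V x)) \<le> real m + \<delta> * real m" using x by (auto simp: H_def not_less algebra_simps)
      ultimately have "real (card (nbrs E (L j) x)) - 2 \<le> \<eta> * real m"
        using c2[OF that(1)] cB\<delta> by linarith
      hence "int (card (nbrs E (L j) x)) - 2 \<le> \<lfloor>\<eta> * real m\<rfloor>" by (simp add: le_floor_iff)
      thus ?thesis by (simp add: \<sigma>_def)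
    qed
    define \<kappa> where "\<kappa> = 2 * k * \<sigma> + 2"
    \<comment> \<open>A quarter of \<open>m\<close> is small enough for
      \<open>3 * q + \<kappa> + 3\<close> to fit into a set of nearly \<open>m\<close> vertices, and
      large enough for \<open>card (L i) + q + 1 - \<kappa>\<close> to reach
      \<open>9 / 8 * m\<close>.\<close>
    define q where "q = m div 4"
    have q: "real m / 4 - 1 \<le> real q" "real q \<le> real m / 4" by (auto simp: q_def)
    have \<kappa>: "real \<kappa> \<le> 2 * real k * \<eta> * real m + 4 * real k + 2"
    proof -
      have "2 * real k * real \<sigma> \<le> 2 * real k * (\<eta> * real m + 2)" using \<sigma> by (intro mult_left_mono) auto
      thus ?thesis by (simp add: \<kappa>_def algebra_simps)
    qed
    have \<eta>m: "2 * real k * \<eta> * real m + \<eta> * real m = real m / 16"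
      using arg_cong[OF \<eta>k, of "\<lambda>x. x * real m"] by (simp add: algebra_simps)
    have \<eta>m48: "\<eta> * real m \<le> real m / 48" using mult_right_mono[OF \<eta>(2), of "real m"] by simp
    have Lsize: "3 * q + \<kappa> + 3 \<le> card (L i)" if "i < k" for i
    proof -
      have "3 * real q + real \<kappa> + 3 \<le> real (card (L i))"
        using q \<kappa> cLi[OF that] \<eta>m m64 by linarith
      thus ?thesis by linarith
    qed
    interpret L: part_classification V E k L \<sigma> q \<kappa>
    proof
      show "\<kappa> = 2 * k * \<sigma> + 2" by (rule \<kappa>_def)
    qed (use LV Ldisj Lcross Lsize in auto)
    have "(\<forall>i<k. card (L.part i) = m) \<and> (\<Union>i<k. L.part i) = V"
    proof (rule L.parts_exact[OF k cV dens])
      have \<sigma>q: "\<sigma> \<le> q"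
      proof -
        have "real \<sigma> \<le> real q" using \<sigma> q \<eta>m48 m100 by linarith
        thus ?thesis by simp
      qed
      show "L i \<subseteq> L.part i" if i: "i < k" for i
      proof
        fix v assume v: "v \<in> L i"
        have "L i \<subseteq> A.part i" by (auto simp: L_def)
        hence com: "comatching E (L i)" using A.part_comatching[OF i] unfolding comatching_def by (meson subsetD)
        have "finite (non_nbrs E (L i) v)" using fLi by (simp add: non_nbrs_def)
        moreover have "w = w'" if "w \<in> non_nbrs E (L i) v" "w' \<in> non_nbrs E (L i) v" for w w'
          using that comatchingD[OF com v, of w w'] by (auto simp: non_nbrs_def nbrs_def)
        ultimately have "card (non_nbrs E (L i) v) \<le> 1" by (simp add: card_le_Suc0_iff_eq)
        hence "card (non_nbrs E (L i) v) < \<kappa>" by (simp add: \<kappa>_def)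
        moreover have "card (nbrs E (L j) v) \<le> q" if "j < k" "j \<noteq> i" for j
          using Lcross[of i j v] i that v \<sigma>q by fastforce
        ultimately show "v \<in> L.part i" using v LV by (auto simp: L.part_def)
      qed
      show "32 * (k * m - card (\<Union>i<k. L i)) \<le> m"
      proof -
        have "card (\<Union>i<k. L i) = (\<Sum>i<k. card (L i))" using fLi Ldisj by (intro card_UN_disjoint) auto
        hence "real (card (\<Union>i<k. L i)) = (\<Sum>i<k. real (card (L i)))" by simp
        also have "\<dots> \<ge> (\<Sum>i<k. real m - \<eta> * real m)" using cLi by (intro sum_mono) auto
        finally have "real k * real m - real k * (\<eta> * real m) \<le> real (card (\<Union>i<k. L i))" by (simp add: algebra_simps)
        moreover have "2 * (real k * (\<eta> * real m)) \<le> real m / 16"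
        proof -
          have "0 \<le> \<eta> * real m" using \<eta> by simp
          moreover have "2 * real k * \<eta> * real m = 2 * (real k * (\<eta> * real m))" by simp
          ultimately show ?thesis using \<eta>m by linarith
        qed
        ultimately have "32 * real (k * m) \<le> real m + 32 * real (card (\<Union>i<k. L i))" by simp
        hence "32 * (k * m) \<le> m + 32 * card (\<Union>i<k. L i)" by linarith
        thus ?thesis by simp
      qed
      show "9 * m + 8 * \<kappa> \<le> 8 * (card (L i) + q + 1)" if "i < k" for i
      proof -
        have "9 * real m + 8 * real \<kappa> \<le> 8 * real (card (L i)) + 8 * real q + 8"
          using q \<kappa> cLi[OF that] \<eta>m m64 by linarith
        hence "9 * m + 8 * \<kappa> \<le> 8 * card (L i) + 8 * q + 8" by linarith
        thus ?thesis by simp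
      qed
      show "24 * k < m" using m64 by linarith
    qed auto
    thus "\<exists>P. (\<forall>i<k. card (P i) = m \<and> comatching E (P i)) \<and>
      (\<forall>i<k. \<forall>j<k. i \<noteq> j \<longrightarrow> P i \<inter> P j = {}) \<and> (\<Union>i<k. P i) = V"
      using L.part_comatching L.part_disj by (intro exI[of _ L.part]) auto
  qed
qed

section \<open>The spectral radius\<close>

definition quad_form :: "(nat \<Rightarrow> nat \<Rightarrow> real) \<Rightarrow> nat \<Rightarrow> (nat \<Rightarrow> real) \<Rightarrow> real" where
  "quad_form a n x = (\<Sum>i<n. \<Sum>j<n. a i j * x i * x j)"

definition sq_norm :: "nat \<Rightarrow> (nat \<Rightarrow> real) \<Rightarrow> real" where
  "sq_norm n x = (\<Sum>i<n. (x i)\<^sup>2)"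

text \<open>Bolzano-Weierstrass one coordinate at a time: a bounded real sequence has a monotone
  subsequence, and passing to it keeps the earlier coordinates convergent.\<close>

lemma coordinatewise_convergent_subseq:
  fixes X :: "nat \<Rightarrow> nat \<Rightarrow> real"
  assumes "\<And>j i. i < n \<Longrightarrow> \<bar>X j i\<bar> \<le> 1"
  shows "\<exists>r :: nat \<Rightarrow> nat. strict_mono r \<and> (\<forall>i<n. convergent (\<lambda>j. X (r j) i))"
  using assms
proof (induction n)
  case 0
  show ?case by (intro exI[of _ id]) (simp add: strict_mono_def)
next
  case (Suc n)
  then obtain r :: "nat \<Rightarrow> nat" where r: "strict_mono r" "\<And>i. i < n \<Longrightarrow> convergent (\<lambda>j. X (r j) i)"
    by (metis less_SucI)
  obtain f :: "nat \<Rightarrow> nat" where f: "strict_mono f" "monoseq (\<lambda>j. X (r (f j)) n)"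
    using seq_monosub[of "\<lambda>j. X (r j) n"] by blast
  have "Bseq (\<lambda>j. X (r (f j)) n)" using Suc.prems[of n] by (intro BseqI'[where K = 1]) simp
  hence "convergent (\<lambda>j. X (r (f j)) n)" using f(2) by (rule Bseq_monoseq_convergent)
  moreover have "convergent (\<lambda>j. X (r (f j)) i)" if "i < n" for i
    using convergent_subseq_convergent[OF r(2)[OF that] f(1)] by (simp add: o_def)
  ultimately have "\<forall>i<Suc n. convergent (\<lambda>j. X ((r \<circ> f) j) i)" by (simp add: less_Suc_eq)
  moreover have "strict_mono (r \<circ> f)" using r(1) f(1) by (rule strict_mono_o)
  ultimately show ?case by blast
qed

lemma sq_norm_nonneg: "0 \<le> sq_norm n x"
  by (simp add: sq_norm_def sum_nonneg)

lemma sq_norm_coord: "i < n \<Longrightarrow> (x i)\<^sup>2 \<le> sq_norm n x"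
  unfolding sq_norm_def by (rule member_le_sum) auto

lemma quad_form_scale: "quad_form a n (\<lambda>i. c * x i) = c\<^sup>2 * quad_form a n x"
  by (simp add: quad_form_def sum_distrib_left power2_eq_square mult_ac)

lemma sq_norm_scale: "sq_norm n (\<lambda>i. c * x i) = c\<^sup>2 * sq_norm n x"
  by (simp add: sq_norm_def sum_distrib_left power_mult_distrib)

text \<open>Compactness of the unit sphere, applied to vectors whose values approach the supremum;
  homogeneity of degree 2 turns the maximum on the sphere into a bound for every
  \<open>y\<close>.\<close>

lemma rayleigh_maximum:
  assumes "n > 0"
  shows "\<exists>x. sq_norm n x = 1 \<and> (\<forall>y. quad_form a n y \<le> quad_form a n x * sq_norm n y)"
proof -
  define S where "S = {quad_form a n y | y. sq_norm n y = 1}"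
  have bound1: "\<bar>y i\<bar> \<le> 1" if "sq_norm n y = 1" "i < n" for y i
    using sq_norm_coord[OF that(2), of y] that(1) by (simp add: abs_square_le_1)
  have "quad_form a n y \<le> (\<Sum>i<n. \<Sum>j<n. \<bar>a i j\<bar>)" if "sq_norm n y = 1" for y
    unfolding quad_form_def
  proof (intro sum_mono)
    fix i j assume "i \<in> {..<n}" "j \<in> {..<n}"
    hence "\<bar>y i\<bar> \<le> 1" "\<bar>y j\<bar> \<le> 1" using bound1[OF that] by auto
    hence "\<bar>a i j\<bar> * (\<bar>y i\<bar> * \<bar>y j\<bar>) \<le> \<bar>a i j\<bar> * (1 * 1)" by (intro mult_mono) auto
    moreover have "a i j * y i * y j \<le> \<bar>a i j\<bar> * (\<bar>y i\<bar> * \<bar>y j\<bar>)"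
      by (metis abs_ge_self abs_mult mult.assoc)
    ultimately show "a i j * y i * y j \<le> \<bar>a i j\<bar>" by simp
  qed
  hence bdd: "bdd_above S" unfolding S_def bdd_above_def by blast
  have "sq_norm n (\<lambda>i. if i = 0 then 1 else 0) = (\<Sum>i\<in>{..<n}. if i = 0 then 1 else 0)"
    unfolding sq_norm_def by (intro sum.cong) auto
  also have "\<dots> = 1" using assms by (simp add: sum.delta)
  finally have ne: "S \<noteq> {}" unfolding S_def by blast
  define l where "l = Sup S"
  have up: "quad_form a n y \<le> l" if "sq_norm n y = 1" for y
    unfolding l_def by (rule cSup_upper[OF _ bdd]) (use that in \<open>auto simp: S_def\<close>)
  have "\<exists>y. sq_norm n y = 1 \<and> l - inverse (real (Suc j)) < quad_form a n y" for j
  proof -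
    have "l - inverse (real (Suc j)) < Sup S" by (simp add: l_def)
    then obtain s where "s \<in> S" "l - inverse (real (Suc j)) < s" using less_cSup_iff[OF ne bdd] by blast
    thus ?thesis by (auto simp: S_def)
  qed
  then obtain X where X: "\<And>j. sq_norm n (X j) = 1" "\<And>j. l - inverse (real (Suc j)) < quad_form a n (X j)" by metis
  have "\<bar>X j i\<bar> \<le> 1" if "i < n" for j i using bound1[OF X(1) that] .
  from coordinatewise_convergent_subseq[where X = X and n = n, OF this]
  obtain r :: "nat \<Rightarrow> nat" where r: "strict_mono r" "\<forall>i<n. convergent (\<lambda>j. X (r j) i)" by blast
  define x where "x i = lim (\<lambda>j. X (r j) i)" for i
  have lim: "(\<lambda>j. X (r j) i) \<longlonglongrightarrow> x i" if "i < n" for i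
    using r(2) that by (simp add: x_def convergent_LIMSEQ_iff)
  have "(\<lambda>j. sq_norm n (X (r j))) \<longlonglongrightarrow> sq_norm n x"
    unfolding sq_norm_def by (intro tendsto_sum tendsto_power lim) simp
  hence x1: "sq_norm n x = 1" using X(1) by (simp add: LIMSEQ_const_iff)
  have q: "(\<lambda>j. quad_form a n (X (r j))) \<longlonglongrightarrow> quad_form a n x"
    unfolding quad_form_def by (intro tendsto_sum tendsto_mult tendsto_const lim) simp_all
  have "(\<lambda>j. l - inverse (real (Suc (r j)))) \<longlonglongrightarrow> l - 0"
    using LIMSEQ_subseq_LIMSEQ[OF LIMSEQ_inverse_real_of_nat r(1)]
    by (intro tendsto_diff tendsto_const) (simp add: o_def)
  hence "l - 0 \<le> quad_form a n x"
    by (rule LIMSEQ_le[OF _ q]) (use X(2) less_imp_le in blast)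
  hence ql: "quad_form a n x = l" using up[OF x1] by simp
  have "quad_form a n y \<le> l * sq_norm n y" for y
  proof (cases "sq_norm n y = 0")
    case True
    hence "y i = 0" if "i < n" for i using sq_norm_coord[OF that, of y] by simp
    hence "quad_form a n y = 0" by (simp add: quad_form_def)
    thus ?thesis using True by simp
  next
    case False
    define N where "N = sq_norm n y"
    have N: "N > 0" using False sq_norm_nonneg[of n y] by (simp add: N_def)
    define c where "c = 1 / sqrt N"
    have c: "c\<^sup>2 = 1 / N" using N by (simp add: c_def power_divide)
    have "sq_norm n (\<lambda>i. c * y i) = 1" using N by (simp add: sq_norm_scale c N_def[symmetric])
    hence "quad_form a n (\<lambda>i. c * y i) \<le> l" by (rule up)
    thus ?thesis using N by (simp add: quad_form_scale c N_def[symmetric] field_simps)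
  qed
  thus ?thesis using x1 ql by blast
qed

lemma nonpos_quadratic_linear_zero:
  fixes b c :: real
  assumes "\<And>t. 2 * t * b + t\<^sup>2 * c \<le> 0"
  shows "b = 0"
proof (rule ccontr)
  assume b: "b \<noteq> 0"
  define t where "t = b / (\<bar>c\<bar> + 1)"
  have p: "\<bar>c\<bar> + 1 > 0" by simp
  have "t * (\<bar>c\<bar> + 1) = b" using p by (simp add: t_def)
  hence "2 * t * b + t\<^sup>2 * c = t\<^sup>2 * (2 * (\<bar>c\<bar> + 1) + c)" by (auto simp: power2_eq_square algebra_simps)
  moreover have "t\<^sup>2 > 0" using b p by (simp add: t_def)
  moreover have "2 * (\<bar>c\<bar> + 1) + c > 0" by (simp add: abs_if)
  ultimately show False using assms[of t] mult_pos_pos by (metis not_le)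
qed

text \<open>First-order condition at the maximum: along the line through \<open>x\<close> in
  coordinate direction \<open>k\<close>, the difference of the two sides is a nonpositive quadratic
  with linear coefficient \<open>2 * (A - l * x k)\<close>, which must vanish.\<close>

lemma rayleigh_maximizer_eigen:
  assumes sym: "\<And>i j. i < n \<Longrightarrow> j < n \<Longrightarrow> a i j = a j i"
    and x: "sq_norm n x = 1" "\<And>y. quad_form a n y \<le> quad_form a n x * sq_norm n y" and k: "k < n"
  shows "(\<Sum>j<n. a k j * x j) = quad_form a n x * x k"
proof -
  define l where "l = quad_form a n x"
  define A where "A = (\<Sum>j<n. a k j * x j)"
  define d where "d i = (if i = k then 1 else 0 :: real)" for i
  have "2 * t * (A - l * x k) + t\<^sup>2 * (a k k - l) \<le> 0" for t
  proof -
    have dsum: "(\<Sum>i<n. f i * d i) = f k" for f :: "nat \<Rightarrow> real"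
      using k by (simp add: d_def sum.delta if_distrib cong: if_cong)
    have N: "sq_norm n (\<lambda>i. x i + t * d i) = 1 + 2 * t * x k + t\<^sup>2"
    proof -
      have "sq_norm n (\<lambda>i. x i + t * d i) = (\<Sum>i<n. (x i)\<^sup>2 + 2 * t * (x i * d i) + t\<^sup>2 * (1 * d i))"
        unfolding sq_norm_def by (intro sum.cong) (auto simp: d_def power2_eq_square algebra_simps)
      also have "\<dots> = sq_norm n x + 2 * t * (\<Sum>i<n. x i * d i) + t\<^sup>2 * (\<Sum>i<n. 1 * d i)"
        by (simp add: sum.distrib sum_distrib_left sq_norm_def)
      finally show ?thesis using x(1) by (simp only: dsum)
    qed
    have Q: "quad_form a n (\<lambda>i. x i + t * d i) = l + 2 * t * A + t\<^sup>2 * a k k"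
    proof -
      have "quad_form a n (\<lambda>i. x i + t * d i)
        = (\<Sum>i<n. (\<Sum>j<n. a i j * x i * x j) + t * (\<Sum>j<n. (a i j * x i) * d j)
            + t * ((\<Sum>j<n. a i j * x j) * d i) + t\<^sup>2 * ((\<Sum>j<n. a i j * d j) * d i))"
        unfolding quad_form_def
        by (intro sum.cong) (auto simp: sum_distrib_left sum_distrib_right sum.distrib[symmetric] algebra_simps power2_eq_square)
      also have "\<dots> = (\<Sum>i<n. (\<Sum>j<n. a i j * x i * x j) + t * (a i k * x i) + t * ((\<Sum>j<n. a i j * x j) * d i) + t\<^sup>2 * (a i k * d i))"
        by (simp only: dsum)
      also have "\<dots> = l + t * (\<Sum>i<n. a i k * x i) + t * (\<Sum>i<n. (\<Sum>j<n. a i j * x j) * d i) + t\<^sup>2 * (\<Sum>i<n. a i k * d i)"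
        by (simp add: sum.distrib sum_distrib_left l_def quad_form_def)
      also have "\<dots> = l + t * (\<Sum>i<n. a i k * x i) + t * A + t\<^sup>2 * a k k" by (simp only: dsum A_def)
      also have "(\<Sum>i<n. a i k * x i) = A" unfolding A_def using sym k by (intro sum.cong) auto
      finally show ?thesis by simp
    qed
    show ?thesis using x(2)[of "\<lambda>i. x i + t * d i"] unfolding N Q l_def[symmetric] by (simp add: algebra_simps)
  qed
  hence "A - l * x k = 0" by (rule nonpos_quadratic_linear_zero)
  thus ?thesis by (simp add: A_def l_def)
qed

text \<open>At an index where the ratio of the absolute value of \<open>y i\<close> to
  \<open>w i\<close> is largest, the eigenvalue equation taken in absolute values is dominated by
  the inequality for \<open>w\<close>. One explicit positive vector thus bounds every eigenvalue
  from above.\<close>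

lemma collatz_wielandt:
  fixes a :: "nat \<Rightarrow> nat \<Rightarrow> real"
  assumes "\<And>i j. i < n \<Longrightarrow> j < n \<Longrightarrow> 0 \<le> a i j"
    and w: "\<And>i. i < n \<Longrightarrow> 0 < w i" "\<And>i. i < n \<Longrightarrow> (\<Sum>j<n. a i j * w j) \<le> l * w i"
    and y: "\<And>i. i < n \<Longrightarrow> (\<Sum>j<n. a i j * y j) = \<mu> * y i" "k < n" "y k \<noteq> 0"
  shows "\<mu> \<le> l"
proof -
  define f where "f i = \<bar>y i\<bar> / w i" for i
  have fin: "finite (f ` {..<n})" "f ` {..<n} \<noteq> {}" using y(2) by auto
  obtain i where i: "i \<in> {..<n}" "f i = Max (f ` {..<n})" using Max_in[OF fin] by (metis imageE)
  have fmax: "f j \<le> f i" if "j \<in> {..<n}" for j unfolding i(2) using fin that by (intro Max_ge) auto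
  have "0 < f k" using y w by (simp add: f_def)
  hence fi: "0 < f i" using fmax[of k] y(2) by simp
  have yj: "\<bar>y j\<bar> \<le> f i * w j" if "j < n" for j
    using fmax[of j] w(1)[OF that] that unfolding f_def[of j] by (simp add: field_simps)
  have yi: "\<bar>y i\<bar> = f i * w i" using w(1)[of i] i(1) by (simp add: f_def)
  have "\<mu> * \<bar>y i\<bar> \<le> \<bar>\<Sum>j<n. a i j * y j\<bar>" using y(1)[of i] i(1) by (simp add: abs_mult mult_right_mono)
  also have "\<dots> \<le> (\<Sum>j<n. \<bar>a i j * y j\<bar>)" by (rule sum_abs)
  also have "\<dots> \<le> (\<Sum>j<n. f i * (a i j * w j))"
  proof (rule sum_mono)
    fix j assume "j \<in> {..<n}"
    hence "a i j * \<bar>y j\<bar> \<le> a i j * (f i * w j)" using assms(1)[of i j] i(1) yj[of j] by (intro mult_left_mono) auto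
    thus "\<bar>a i j * y j\<bar> \<le> f i * (a i j * w j)" using assms(1)[of i j] i(1) \<open>j \<in> _\<close> by (simp add: abs_mult mult_ac)
  qed
  also have "\<dots> = f i * (\<Sum>j<n. a i j * w j)" by (simp add: sum_distrib_left)
  also have "\<dots> \<le> f i * (l * w i)" using w(2)[of i] i(1) fi by (intro mult_left_mono) auto
  also have "\<dots> = l * \<bar>y i\<bar>" by (simp add: yi)
  finally show ?thesis using fi w(1)[of i] i(1) by (simp add: yi)
qed

text \<open>The quadratic is the eigenvalue equation of the aligned cycle at a linking vertex:
  \<open>m - 2\<close> neighbours of weight 1 and one of weight \<open>1 + t\<close> give
  \<open>(m - 2) + (1 + t) = (m - 2 + 2 * t) * (1 + t)\<close>. It implies
  \<open>(m - 1) * t \<le> 1\<close>, whence the bound \<open>3 / m\<close>.\<close>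

lemma positive_root_exists:
  fixes m :: nat
  assumes "m \<ge> 3"
  shows "\<exists>t>0. 2 * t\<^sup>2 + (real m - 1) * t = 1 \<and> 2 * t \<le> 3 / real m"
proof -
  define D where "D = (real m - 1)\<^sup>2 + 8"
  define t where "t = (sqrt D - (real m - 1)) / 4"
  have D: "D > (real m - 1)\<^sup>2" by (simp add: D_def)
  have m1: "real m - 1 \<ge> 2" using assms by simp
  have "sqrt D > real m - 1" using real_sqrt_less_mono[OF D] m1 by simp
  hence t: "t > 0" by (simp add: t_def)
  have D0: "0 \<le> D" by (simp add: D_def)
  have "4 * t + (real m - 1) = sqrt D" by (simp add: t_def field_simps)
  hence "(4 * t + (real m - 1))\<^sup>2 = (real m - 1)\<^sup>2 + 8" using D0 by (simp add: D_def)
  hence "16 * t\<^sup>2 + 8 * (real m - 1) * t = 8" by (simp add: power2_eq_square algebra_simps)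
  hence e: "2 * t\<^sup>2 + (real m - 1) * t = 1" by (simp add: power2_eq_square algebra_simps)
  have "(real m - 1) * t \<le> 1" using e zero_le_power2[of t] by linarith
  moreover have "2 * real m \<le> 3 * (real m - 1)" using assms by simp
  hence "2 * real m * t \<le> 3 * (real m - 1) * t" using t by (intro mult_right_mono) auto
  ultimately have "2 * real m * t \<le> 3" by (simp add: algebra_simps)
  hence "2 * t \<le> 3 / real m" using assms by (simp add: field_simps)
  thus ?thesis using t e by blast
qed

text \<open>Testing the Rayleigh quotient on \<open>1 + t * e\<close>, where \<open>e\<close> is the degree in the graph of extra edges \<open>f\<close>.
  For the aligned cycle this is the Perron vector, with eigenvalue \<open>m - 2 + 2 * t\<close>.\<close>

lemma extra_edges_extremal:
  fixes b f :: "nat \<Rightarrow> nat \<Rightarrow> real" and k m n :: nat and t :: real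
  assumes b: "\<And>x y. x < n \<Longrightarrow> y < n \<Longrightarrow> b x y = b y x" "\<And>x y. x < n \<Longrightarrow> y < n \<Longrightarrow> 0 \<le> b x y"
    and bdeg: "\<And>x. x < n \<Longrightarrow> (\<Sum>y<n. b x y) = real m - 2"
    and f: "\<And>x y. x < n \<Longrightarrow> y < n \<Longrightarrow> f x y = f y x" "\<And>x y. x < n \<Longrightarrow> y < n \<Longrightarrow> f x y = 0 \<or> f x y = 1"
    and e: "\<And>x. e x = (\<Sum>y<n. f x y)"
    and n: "n = k * m" "0 < m"
    and t: "0 < t" "2 * t\<^sup>2 + (real m - 1) * t = 1"
    and ray: "quad_form (\<lambda>x y. b x y + f x y) n (\<lambda>x. 1 + t * e x) \<le> (real m - 2 + 2 * t) * sq_norm n (\<lambda>x. 1 + t * e x)"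
    and many: "2 * real k \<le> (\<Sum>x<n. e x)"
  shows "(\<Sum>x<n. e x) = 2 * real k" "\<And>x. x < n \<Longrightarrow> e x = 0 \<or> e x = 1"
    "\<And>x y. x < n \<Longrightarrow> y < n \<Longrightarrow> b x y * (e x * e y) = 0"
proof -
  have e_nat: "e x = real (card {y. y < n \<and> f x y = 1})" if "x < n" for x
  proof -
    have "e x = (\<Sum>y<n. if f x y = 1 then 1 else 0)" unfolding e using f(2)[OF that] by (intro sum.cong) auto
    also have "\<dots> = real (card {y. y < n \<and> f x y = 1})"
      by (simp add: sum.If_cases Int_def)
    finally show ?thesis .
  qed
  have e01: "e x = 0 \<or> 1 \<le> e x" if "x < n" for x using e_nat[OF that] by (cases "card {y. y < n \<and> f x y = 1}") auto
  have e0: "0 \<le> e x" if "x < n" for x using e01[OF that] by auto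
  have fe: "1 \<le> e x \<and> 1 \<le> e y" if "x < n" "y < n" "f x y = 1" for x y
  proof -
    have pos: "0 \<le> f u v" if "u < n" "v < n" for u v using f(2)[OF that] by auto
    have "f u v \<le> e u" if "u < n" "v < n" for u v
      unfolding e by (rule member_le_sum) (use pos that in auto)
    hence "f x y \<le> e x" "f y x \<le> e y" using that by blast+
    thus ?thesis using f(1)[OF that(1,2)] that(3) by simp
  qed
  define K where "K = (\<Sum>x<n. e x)"
  define Q where "Q = (\<Sum>x<n. (e x)\<^sup>2)"
  define SB where "SB = (\<Sum>x<n. \<Sum>y<n. b x y * (e x * e y))"
  define SX where "SX = (\<Sum>x<n. \<Sum>y<n. f x y * (e x * e y))"
  have expand: "quad_form g n (\<lambda>x. 1 + t * e x)
     = (\<Sum>x<n. \<Sum>y<n. g x y) + 2 * t * (\<Sum>x<n. e x * (\<Sum>y<n. g x y)) + t\<^sup>2 * (\<Sum>x<n. \<Sum>y<n. g x y * (e x * e y))"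
    if g: "\<And>x y. x < n \<Longrightarrow> y < n \<Longrightarrow> g x y = g y x" for g
  proof -
    have "quad_form g n (\<lambda>x. 1 + t * e x) = (\<Sum>x<n. \<Sum>y<n. g x y) + t * (\<Sum>x<n. \<Sum>y<n. g x y * e x)
      + t * (\<Sum>x<n. \<Sum>y<n. g x y * e y) + t\<^sup>2 * (\<Sum>x<n. \<Sum>y<n. g x y * (e x * e y))"
      unfolding quad_form_def sum_distrib_left sum.distrib[symmetric]
      by (intro sum.cong refl) (simp add: algebra_simps power2_eq_square)
    moreover have "(\<Sum>x<n. \<Sum>y<n. g x y * e y) = (\<Sum>y<n. \<Sum>x<n. g x y * e y)" by (rule sum.swap)
    moreover have "\<dots> = (\<Sum>x<n. \<Sum>y<n. g x y * e x)" using g by (intro sum.cong refl) auto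
    moreover have "(\<Sum>x<n. \<Sum>y<n. g x y * e x) = (\<Sum>x<n. e x * (\<Sum>y<n. g x y))"
      by (simp add: sum_distrib_left mult.commute)
    ultimately show ?thesis by simp
  qed
  have nm: "real n = real k * real m" using n by simp
  have "quad_form b n (\<lambda>x. 1 + t * e x) = real n * (real m - 2) + 2 * t * ((real m - 2) * K) + t\<^sup>2 * SB"
    using expand[OF b(1)] bdeg by (simp add: K_def SB_def sum_distrib_left[symmetric] sum_distrib_right[symmetric] mult.commute)
  moreover have "quad_form f n (\<lambda>x. 1 + t * e x) = K + 2 * t * Q + t\<^sup>2 * SX"
    using expand[OF f(1)] by (simp add: K_def SX_def Q_def e[symmetric] power2_eq_square)
  moreover have "quad_form (\<lambda>x y. b x y + f x y) n z = quad_form b n z + quad_form f n z" for z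
    by (simp add: quad_form_def sum.distrib distrib_right)
  ultimately have quad: "quad_form (\<lambda>x y. b x y + f x y) n (\<lambda>x. 1 + t * e x)
    = real n * (real m - 2) + 2 * t * ((real m - 2) * K) + t\<^sup>2 * SB + K + 2 * t * Q + t\<^sup>2 * SX" by simp
  have norm: "sq_norm n (\<lambda>x. 1 + t * e x) = real n + 2 * t * K + t\<^sup>2 * Q"
  proof -
    have "sq_norm n (\<lambda>x. 1 + t * e x) = (\<Sum>x<n. 1 + 2 * t * e x + t\<^sup>2 * (e x)\<^sup>2)"
      unfolding sq_norm_def by (intro sum.cong refl) (simp add: power2_eq_square algebra_simps)
    thus ?thesis by (simp add: sum.distrib sum_distrib_left K_def Q_def)
  qed
  have sq: "e x \<le> (e x)\<^sup>2" if "x < n" for x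
    using e01[OF that] by (auto simp: power2_eq_square)
  have QK: "K \<le> Q" unfolding K_def Q_def using sq by (intro sum_mono) auto
  have SXK: "K \<le> SX"
  proof -
    have "f x y \<le> f x y * (e x * e y)" if "x < n" "y < n" for x y
    proof (cases "f x y = 1")
      case True
      have "1 * 1 \<le> e x * e y" using fe[OF that True] by (intro mult_mono) auto
      thus ?thesis using True by simp
    qed (use f(2)[OF that] in auto)
    thus ?thesis unfolding K_def SX_def e by (intro sum_mono) (auto simp: e)
  qed
  have SB0: "0 \<le> SB" unfolding SB_def using b(2) e0 by (intro sum_nonneg mult_nonneg_nonneg) auto
  have tl: "t * (real m - 2 + 2 * t) = 1 - t" using t(2) by (simp add: algebra_simps power2_eq_square)
  have "(real m - 2 + 2 * t) * t\<^sup>2 = t * (t * (real m - 2 + 2 * t))" by (simp add: power2_eq_square)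
  also have "\<dots> = t - t\<^sup>2" unfolding tl by (simp add: power2_eq_square algebra_simps)
  finally have tl2: "(real m - 2 + 2 * t) * t\<^sup>2 = t - t\<^sup>2" .
  have c: "2 * t - (real m - 2 + 2 * t) * t\<^sup>2 > 0"
    unfolding tl2 using t(1) zero_le_power2[of t] by linarith
  \<comment> \<open>By the equation for \<open>t\<close> the coefficient of \<open>K\<close>
    collapses to \<open>m * t\<close>; set against \<open>2 * t * n = m * t * (2 * k)\<close> it
    leaves a multiple of \<open>K - 2 * k\<close>.\<close>
  have bracket: "2 * t * (real m - 2) + 1 - 2 * (real m - 2 + 2 * t) * t + 2 * t - (real m - 2 + 2 * t) * t\<^sup>2 + t\<^sup>2 = real m * t"
    unfolding tl2 using t(2) by (simp add: power2_eq_square algebra_simps)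
  have "quad_form (\<lambda>x y. b x y + f x y) n (\<lambda>x. 1 + t * e x) - (real m - 2 + 2 * t) * sq_norm n (\<lambda>x. 1 + t * e x)
    = (2 * t * (real m - 2) + 1 - 2 * (real m - 2 + 2 * t) * t + 2 * t - (real m - 2 + 2 * t) * t\<^sup>2 + t\<^sup>2) * K - 2 * t * real n
      + (Q - K) * (2 * t - (real m - 2 + 2 * t) * t\<^sup>2) + t\<^sup>2 * (SX - K) + t\<^sup>2 * SB"
    unfolding quad norm by (simp add: algebra_simps)
  also have "\<dots> = real m * t * (K - 2 * real k)
      + (Q - K) * (2 * t - (real m - 2 + 2 * t) * t\<^sup>2) + t\<^sup>2 * (SX - K) + t\<^sup>2 * SB"
    unfolding bracket nm by (simp add: algebra_simps)
  \<comment> \<open>All four terms are nonnegative. They measure the surplus of extra edges over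
    \<open>k\<close>, vertices of extra degree above 1, extra edges at such vertices, and ends of
    extra edges that are adjacent inside a copy.\<close>
  finally have le: "real m * t * (K - 2 * real k) + (Q - K) * (2 * t - (real m - 2 + 2 * t) * t\<^sup>2) + t\<^sup>2 * (SX - K) + t\<^sup>2 * SB \<le> 0"
    using ray by linarith
  have nn: "0 \<le> real m * t * (K - 2 * real k)" "0 \<le> (Q - K) * (2 * t - (real m - 2 + 2 * t) * t\<^sup>2)"
    "0 \<le> t\<^sup>2 * (SX - K)" "0 \<le> t\<^sup>2 * SB"
    using many t(1) QK c SXK SB0 unfolding K_def[symmetric] by (auto intro!: mult_nonneg_nonneg)
  have "real m * t * (K - 2 * real k) = 0" "(Q - K) * (2 * t - (real m - 2 + 2 * t) * t\<^sup>2) = 0" "t\<^sup>2 * SB = 0"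
    using le nn by linarith+
  hence z: "K = 2 * real k" "Q = K" "SB = 0" using n t c by auto
  show "(\<Sum>x<n. e x) = 2 * real k" using z by (simp add: K_def)
  show "e x = 0 \<or> e x = 1" if "x < n" for x
  proof -
    have "(\<Sum>x<n. (e x)\<^sup>2 - e x) = 0" using z by (simp add: sum_subtractf K_def Q_def)
    hence "\<forall>x\<in>{..<n}. (e x)\<^sup>2 - e x = 0" using sq by (subst sum_nonneg_eq_0_iff[symmetric]) auto
    hence "e x * (e x - 1) = 0" using that by (auto simp: power2_eq_square algebra_simps)
    thus ?thesis by simp
  qed
  show "b x y * (e x * e y) = 0" if "x < n" "y < n" for x y
  proof -
    have p: "0 \<le> b x y * (e x * e y)" if "x < n" "y < n" for x y using that b(2) e0 by simp
    have "\<forall>x\<in>{..<n}. (\<Sum>y<n. b x y * (e x * e y)) = 0"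
      using z(3) p unfolding SB_def by (subst sum_nonneg_eq_0_iff[symmetric]) (auto intro!: sum_nonneg)
    hence "(\<Sum>y<n. b x y * (e x * e y)) = 0" using that by simp
    hence "\<forall>y\<in>{..<n}. b x y * (e x * e y) = 0" using p that(1) by (subst sum_nonneg_eq_0_iff[symmetric]) auto
    thus ?thesis using that by simp
  qed
qed

section \<open>Connectivity, dissociation number and isomorphism in terms of arcs\<close>

lemma connected_closed_set:
  assumes "Digraph_Component.connected (with_proj G)" "S \<subseteq> pverts G" "S \<noteq> {}"
    and closed: "\<And>x y. x \<in> S \<Longrightarrow> (x, y) \<in> parcs G \<or> (y, x) \<in> parcs G \<Longrightarrow> y \<in> pverts G \<Longrightarrow> y \<in> S"
  shows "S = pverts G"
proof -
  obtain u where u: "u \<in> S" using assms(3) by blast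
  have "v \<in> S" if v: "v \<in> pverts G" for v
  proof -
    have "(u, v) \<in> rtrancl_on (pverts G) (parcs (mk_symmetric (with_proj G)))"
      using assms(1,2) u v by (auto simp: Digraph_Component.connected_def strongly_connected_def reachable_def)
    thus ?thesis
    proof (induction rule: rtrancl_on_induct)
      case base
      show ?case by (rule u)
    next
      case (step y z)
      have "(y, z) \<in> parcs G \<or> (z, y) \<in> parcs G" using step(2) by (auto simp: parcs_mk_symmetric)
      thus ?case using closed step by blast
    qed
  qed
  thus ?thesis using assms(2) by blast
qed

lemma connectedI_closed_set:
  assumes "pverts G \<noteq> {}"
    and closed: "\<And>S. S \<subseteq> pverts G \<Longrightarrow> S \<noteq> {} \<Longrightarrow>
      (\<And>x y. x \<in> S \<Longrightarrow> (x, y) \<in> parcs G \<Longrightarrow> y \<in> pverts G \<Longrightarrow> y \<in> S) \<Longrightarrow> S = pverts G"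
  shows "Digraph_Component.connected (with_proj G)"
proof -
  have "(u, v) \<in> rtrancl_on (pverts G) (parcs (mk_symmetric (with_proj G)))"
    if uv: "u \<in> pverts G" "v \<in> pverts G" for u v
  proof -
    define S where "S = {w. (u, w) \<in> rtrancl_on (pverts G) (parcs (mk_symmetric (with_proj G)))}"
    have "S = pverts G"
    proof (rule closed)
      show "S \<subseteq> pverts G" using in_rtrancl_on_in_F by (auto simp: S_def)
      show "S \<noteq> {}" using uv(1) by (auto simp: S_def)
      show "y \<in> S" if "x \<in> S" "(x, y) \<in> parcs G" "y \<in> pverts G" for x y
      proof -
        have "(x, y) \<in> parcs (mk_symmetric (with_proj G))" using that by (force simp: parcs_mk_symmetric)
        thus ?thesis using that unfolding S_def by (auto intro: rtrancl_on_into_rtrancl_on)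
      qed
    qed
    thus ?thesis using uv by (auto simp: S_def)
  qed
  thus ?thesis using assms(1)
    by (auto simp: Digraph_Component.connected_def strongly_connected_def reachable_def)
qed

lemma dissociation_set_iff:
  "dissociation_set G S \<longleftrightarrow> S \<subseteq> pverts G \<and> (\<forall>v\<in>S. card {y\<in>S. (v, y) \<in> parcs G} \<le> 1)"
proof -
  have "out_degree (induce_subgraph (with_proj G) S) v = card {y\<in>S. (v, y) \<in> parcs G}" if "v \<in> S" for v
  proof -
    have "out_arcs (induce_subgraph (with_proj G) S) v = Pair v ` {y\<in>S. (v, y) \<in> parcs G}"
      using that by (auto simp: out_arcs_def induce_subgraph_def)
    thus ?thesis by (simp add: out_degree_def card_image inj_on_def)
  qed
  thus ?thesis unfolding dissociation_set_def by auto
qed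

lemma finite_dissociation_cards:
  "finite (pverts G) \<Longrightarrow> finite {card S | S. dissociation_set G S}"
  by (rule finite_subset[of _ "{..card (pverts G)}"]) (auto simp: dissociation_set_def card_mono)

lemma card_le_dissociation_number:
  "finite (pverts G) \<Longrightarrow> dissociation_set G S \<Longrightarrow> card S \<le> dissociation_number G"
  unfolding dissociation_number_def by (rule Max_ge[OF finite_dissociation_cards]) auto

lemma dissociation_number_eqI:
  assumes "finite (pverts G)" "dissociation_set G S" "card S = d"
    "\<And>S. dissociation_set G S \<Longrightarrow> card S \<le> d"
  shows "dissociation_number G = d"
  unfolding dissociation_number_def
  by (rule Max_eqI[OF finite_dissociation_cards[OF assms(1)]]) (use assms in auto)

lemma graph_isoI:
  assumes wf: "\<And>x y. (x, y) \<in> parcs G \<Longrightarrow> x \<in> pverts G \<and> y \<in> pverts G"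
    "\<And>x y. (x, y) \<in> parcs H \<Longrightarrow> x \<in> pverts H \<and> y \<in> pverts H"
    and bij: "bij_betw \<phi> (pverts G) (pverts H)"
    and arcs: "\<And>x y. x \<in> pverts G \<Longrightarrow> y \<in> pverts G \<Longrightarrow> (x, y) \<in> parcs G \<longleftrightarrow> (\<phi> x, \<phi> y) \<in> parcs H"
  shows "graph_iso G H"
proof -
  define hom where "hom = \<lparr>iso_verts = \<phi>, iso_arcs = map_prod \<phi> \<phi>, iso_head = snd, iso_tail = fst\<rparr>"
  have inj: "inj_on \<phi> (pverts G)" and im: "\<phi> ` pverts G = pverts H" using bij by (auto simp: bij_betw_def)
  have "pair_wf_digraph G" by unfold_locales (use wf in force)+
  hence wfG: "wf_digraph (with_proj G)" by (simp add: wf_digraph_wp_iff)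
  have injA: "inj_on (map_prod \<phi> \<phi>) (parcs G)"
  proof (rule inj_onI)
    fix a b assume "a \<in> parcs G" "b \<in> parcs G" "map_prod \<phi> \<phi> a = map_prod \<phi> \<phi> b"
    thus "a = b" using wf(1)[of "fst a" "snd a"] wf(1)[of "fst b" "snd b"] inj
      by (cases a; cases b) (auto dest: inj_onD)
  qed
  have imA: "map_prod \<phi> \<phi> ` parcs G = parcs H"
  proof (intro equalityI subsetI)
    fix a assume "a \<in> map_prod \<phi> \<phi> ` parcs G"
    thus "a \<in> parcs H" using arcs wf(1) by auto
  next
    fix a assume a: "a \<in> parcs H"
    obtain x' y' where a': "a = (x', y')" by (cases a)
    then obtain x y where "x \<in> pverts G" "y \<in> pverts G" "x' = \<phi> x" "y' = \<phi> y"
      using wf(2)[of x' y'] a im by (metis imageE)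
    thus "a \<in> map_prod \<phi> \<phi> ` parcs G" using a a' arcs by (auto intro!: image_eqI[of _ _ "(x, y)"])
  qed
  have "with_proj H = app_iso hom (with_proj G)"
    by (simp add: app_iso_def with_proj_def hom_def im imA)
  moreover have "pre_digraph.digraph_isomorphism (with_proj G) hom"
    unfolding pre_digraph.digraph_isomorphism_def using wfG inj injA by (simp add: hom_def)
  ultimately show ?thesis unfolding graph_iso_def digraph_iso_def by blast
qed

text \<open>The number of arcs is the invariant that keeps the aligned cycle out of the tree
  class.\<close>

lemma graph_iso_card_parcs:
  assumes "graph_iso G H"
  shows "card (parcs G) = card (parcs H)"
proof -
  obtain f where f: "pre_digraph.digraph_isomorphism (with_proj G) f" "with_proj H = app_iso f (with_proj G)"
    using assms by (auto simp: graph_iso_def digraph_iso_def)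
  have "parcs H = iso_arcs f ` parcs G" using arg_cong[OF f(2), of arcs] by simp
  moreover have "inj_on (iso_arcs f) (parcs G)"
    using pre_digraph.digraph_isomorphism_inj_on_arcs[OF f(1)] by simp
  ultimately show ?thesis by (simp add: card_image)
qed

section \<open>Adjacency matrices: the spectral radius and its two-sided bounds\<close>

definition adjacency :: "nat pair_pre_digraph \<Rightarrow> nat \<Rightarrow> nat \<Rightarrow> real" where
  "adjacency G u v = (if (u, v) \<in> parcs G then 1 else 0)"

lemma finite_spectrum:
  assumes "pverts G = {..<n}"
  shows "finite {x. eigenvalue (adj_mat G) x}"
proof -
  have A: "adj_mat G \<in> carrier_mat n n" using assms by (simp add: adj_mat_def)
  have "char_poly (adj_mat G) \<noteq> 0" using degree_monic_char_poly[OF A] by auto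
  hence "finite {x. poly (char_poly (adj_mat G)) x = 0}" by (rule poly_roots_finite)
  thus ?thesis by (simp add: eigenvalue_root_char_poly[OF A])
qed

lemma adj_mat_mult_vec:
  assumes "pverts G = {..<n}" "v \<in> carrier_vec n" "i < n"
  shows "(adj_mat G *\<^sub>v v) $ i = (\<Sum>j<n. adjacency G i j * v $ j)"
  using assms by (simp add: adj_mat_def adjacency_def scalar_prod_def atLeast0LessThan cong: if_cong)

text \<open>The maximiser of the Rayleigh quotient is an eigenvector. Its existence shows both that
  the set of eigenvalues is nonempty, so that the \<open>Max\<close> is attained, and that this
  \<open>Max\<close> dominates every Rayleigh quotient.\<close>

lemma graph_rayleigh:
  assumes "pverts G = {..<n}" "n > 0" and sym: "\<And>x y. (x, y) \<in> parcs G \<Longrightarrow> (y, x) \<in> parcs G"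
  shows "eigenvalue (adj_mat G) (graph_spectral_radius G)"
    "quad_form (adjacency G) n z \<le> graph_spectral_radius G * sq_norm n z"
proof -
  obtain x where x: "sq_norm n x = 1" "\<And>y. quad_form (adjacency G) n y \<le> quad_form (adjacency G) n x * sq_norm n y"
    using rayleigh_maximum[OF assms(2), of "adjacency G"] by blast
  define l where "l = quad_form (adjacency G) n x"
  have s: "adjacency G i j = adjacency G j i" for i j using sym by (auto simp: adjacency_def)
  have ev: "(\<Sum>j<n. adjacency G i j * x j) = l * x i" if "i < n" for i
    unfolding l_def by (rule rayleigh_maximizer_eigen[OF s x that])
  have "eigenvector (adj_mat G) (vec n x) l"
    unfolding eigenvector_def
  proof (intro conjI)
    show "vec n x \<in> carrier_vec (dim_row (adj_mat G))" using assms(1) by (simp add: adj_mat_def)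
    have "vec n x \<noteq> 0\<^sub>v n"
    proof
      assume "vec n x = 0\<^sub>v n"
      hence "x i = 0" if "i < n" for i using that by (metis index_vec index_zero_vec(1))
      hence "sq_norm n x = 0" by (simp add: sq_norm_def)
      thus False using x(1) by simp
    qed
    thus "vec n x \<noteq> 0\<^sub>v (dim_row (adj_mat G))" using assms(1) by (simp add: adj_mat_def)
    show "adj_mat G *\<^sub>v vec n x = l \<cdot>\<^sub>v vec n x"
    proof
      show "dim_vec (adj_mat G *\<^sub>v vec n x) = dim_vec (l \<cdot>\<^sub>v vec n x)" using assms(1) by (simp add: adj_mat_def)
      fix i assume "i < dim_vec (l \<cdot>\<^sub>v vec n x)"
      hence "i < n" by simp
      thus "(adj_mat G *\<^sub>v vec n x) $ i = (l \<cdot>\<^sub>v vec n x) $ i"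
        using adj_mat_mult_vec[OF assms(1), of "vec n x" i] ev[of i] by simp
    qed
  qed
  hence l: "eigenvalue (adj_mat G) l" by (auto simp: eigenvalue_def)
  have "graph_spectral_radius G \<in> {x. eigenvalue (adj_mat G) x}"
    unfolding graph_spectral_radius_def using finite_spectrum[OF assms(1)] l by (intro Max_in) auto
  thus "eigenvalue (adj_mat G) (graph_spectral_radius G)" by simp
  have "l \<le> graph_spectral_radius G"
    unfolding graph_spectral_radius_def using finite_spectrum[OF assms(1)] l by (intro Max_ge) auto
  hence "l * sq_norm n z \<le> graph_spectral_radius G * sq_norm n z"
    using sq_norm_nonneg by (rule mult_right_mono)
  thus "quad_form (adjacency G) n z \<le> graph_spectral_radius G * sq_norm n z"
    using x(2)[of z] by (simp add: l_def)
qed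

lemma graph_spectral_radius_le:
  assumes "pverts G = {..<n}" "n > 0" and sym: "\<And>x y. (x, y) \<in> parcs G \<Longrightarrow> (y, x) \<in> parcs G"
    and w: "\<And>i. i < n \<Longrightarrow> 0 < w i" "\<And>i. i < n \<Longrightarrow> (\<Sum>j<n. adjacency G i j * w j) \<le> l * w i"
  shows "graph_spectral_radius G \<le> l"
proof -
  define \<mu> where "\<mu> = graph_spectral_radius G"
  obtain v where v: "eigenvector (adj_mat G) v \<mu>"
    using graph_rayleigh(1)[OF assms(1-3)] by (auto simp: eigenvalue_def \<mu>_def)
  have dim: "dim_row (adj_mat G) = n" using assms(1) by (simp add: adj_mat_def)
  have vc: "v \<in> carrier_vec n" and v0: "v \<noteq> 0\<^sub>v n" and ev: "adj_mat G *\<^sub>v v = \<mu> \<cdot>\<^sub>v v"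
    using v by (auto simp: eigenvector_def dim)
  obtain k where k: "k < n" "v $ k \<noteq> 0" using v0 vc by (metis carrier_vecD eq_vecI index_zero_vec)
  have "(\<Sum>j<n. adjacency G i j * v $ j) = \<mu> * v $ i" if "i < n" for i
    using adj_mat_mult_vec[OF assms(1) vc that] that vc by (simp add: ev)
  thus ?thesis unfolding \<mu>_def[symmetric]
    using collatz_wielandt[where a = "adjacency G" and n = n and w = w and l = l and y = "\<lambda>i. v $ i" and \<mu> = \<mu> and k = k] w k
    by (auto simp: adjacency_def)
qed

section \<open>Pairings, connectivity and cyclic order\<close>

lemma comatching_subset: "comatching E X \<Longrightarrow> Y \<subseteq> X \<Longrightarrow> comatching E Y"
  unfolding comatching_def by (meson subsetD)

text \<open>A non-adjacent pair is split off while there is one, otherwise any pair. In a comatching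
  the two vertices of a non-adjacent pair are adjacent to all others, so no two non-neighbours are
  ever separated.\<close>

lemma comatching_pairing:
  assumes "finite S" "card S = 2 * r" "comatching E S" "symp E"
  shows "\<exists>h. bij_betw h S {..<2 * r} \<and> (\<forall>x\<in>S. \<forall>y\<in>S. x \<noteq> y \<longrightarrow> \<not> E x y \<longrightarrow> h x div 2 = h y div (2::nat))"
  using assms(1-3)
proof (induction r arbitrary: S)
  case 0
  thus ?case by (auto simp: bij_betw_def)
next
  case (Suc r)
  have "\<exists>x\<in>S. \<exists>y\<in>S. x \<noteq> y \<and> (\<not> E x y \<or> (\<forall>u\<in>S. \<forall>v\<in>S. u \<noteq> v \<longrightarrow> E u v))"
  proof (cases "\<forall>u\<in>S. \<forall>v\<in>S. u \<noteq> v \<longrightarrow> E u v")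
    case True
    have "2 \<le> card S" using Suc.prems(2) by simp
    then obtain T where "T \<subseteq> S" "card T = 2" by (metis obtain_subset_with_card_n)
    then obtain x y where "x \<in> S" "y \<in> S" "x \<noteq> y" by (auto simp: card_2_iff)
    thus ?thesis using True by blast
  qed blast
  then obtain x y where xy: "x \<in> S" "y \<in> S" "x \<noteq> y" "\<not> E x y \<or> (\<forall>u\<in>S. \<forall>v\<in>S. u \<noteq> v \<longrightarrow> E u v)" by blast
  define T where "T = S - {x, y}"
  have "card T = 2 * r" using xy Suc.prems(1,2) by (simp add: T_def card_Diff_subset)
  moreover have "comatching E T" using Suc.prems(3) by (rule comatching_subset) (auto simp: T_def)
  moreover have "finite T" using Suc.prems(1) by (simp add: T_def)
  ultimately obtain h where h: "bij_betw h T {..<2 * r}"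
    "\<And>u v. u \<in> T \<Longrightarrow> v \<in> T \<Longrightarrow> u \<noteq> v \<Longrightarrow> \<not> E u v \<Longrightarrow> h u div 2 = h v div 2" using Suc.IH[of T] by blast
  define g where "g = h(x := 2 * r, y := 2 * r + 1)"
  have gT: "g u = h u" if "u \<in> T" for u using that by (auto simp: g_def T_def)
  have gxy: "g x = 2 * r" "g y = 2 * r + 1" using xy(3) by (auto simp: g_def)
  have S: "S = insert x (insert y T)" "x \<notin> T" "y \<notin> T" using xy by (auto simp: T_def)
  have imT: "g ` T = {..<2 * r}" using h(1) gT by (simp add: bij_betw_def)
  have injT: "inj_on g T" using h(1) gT by (simp add: bij_betw_def inj_on_def)
  have "bij_betw g S {..<2 * Suc r}"
  proof (rule bij_betw_imageI)
    show "inj_on g S" unfolding S(1) using injT imT gxy xy(3) S(2,3) by (auto simp: inj_on_insert)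
    show "g ` S = {..<2 * Suc r}" unfolding S(1) using imT gxy by auto
  qed
  moreover have "g u div 2 = g v div 2" if uv: "u \<in> S" "v \<in> S" "u \<noteq> v" "\<not> E u v" for u v
  proof -
    have nE: "\<not> E x y" using xy uv by blast
    have nE': "\<not> E y x" using nE assms(4) by (auto dest: sympD)
    have nvu: "\<not> E v u" using uv(4) assms(4) by (auto dest: sympD)
    have nx: "E x z" "E z x" if "z \<in> T" for z
    proof -
      show "E x z" by (rule comatchingD[OF Suc.prems(3) xy(1,2)]) (use that nE xy(3) in \<open>auto simp: T_def\<close>)
      thus "E z x" using assms(4) by (auto dest: sympD)
    qed
    have ny: "E y z" "E z y" if "z \<in> T" for z
    proof -
      show "E y z" by (rule comatchingD[OF Suc.prems(3) xy(2,1)]) (use that nE' xy(3) in \<open>auto simp: T_def\<close>)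
      thus "E z y" using assms(4) by (auto dest: sympD)
    qed
    show ?thesis
    proof (cases "u \<in> T \<and> v \<in> T")
      case True
      thus ?thesis using h(2) uv gT by simp
    next
      case False
      hence "(u = x \<and> v = y) \<or> (u = y \<and> v = x)" using uv nx ny S(1) by auto
      thus ?thesis using gxy by auto
    qed
  qed
  ultimately show ?case by blast
qed

text \<open>A set is grown from a single vertex: connectivity always supplies a pair of
  \<open>D\<close> between the current set and a new vertex, and this pair is not among those
  counted so far.\<close>

lemma card_le_card_edges:
  assumes "finite W" "finite D" "W \<noteq> {}"
    and conn: "\<And>S. S \<subseteq> W \<Longrightarrow> S \<noteq> {} \<Longrightarrow>
      (\<And>x y. x \<in> S \<Longrightarrow> y \<in> W \<Longrightarrow> (x, y) \<in> D \<or> (y, x) \<in> D \<Longrightarrow> y \<in> S) \<Longrightarrow> S = W"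
  shows "card W \<le> card D + 1"
proof -
  have "\<exists>S\<subseteq>W. card S = s \<and> card S \<le> card (D \<inter> S \<times> S) + 1" if "1 \<le> s" "s \<le> card W" for s
    using that
  proof (induction s rule: nat_induct_at_least)
    case base
    obtain w where "w \<in> W" using assms(3) by blast
    thus ?case by (intro exI[of _ "{w}"]) auto
  next
    case (Suc s)
    then obtain S where S: "S \<subseteq> W" "card S = s" "card S \<le> card (D \<inter> S \<times> S) + 1" by auto
    have "S \<noteq> W" "S \<noteq> {}" using S Suc by auto
    then obtain x y where xy: "x \<in> S" "y \<in> W" "(x, y) \<in> D \<or> (y, x) \<in> D" "y \<notin> S"
      using conn[OF S(1)] by blast
    obtain d where d: "d \<in> D" "d \<in> insert y S \<times> insert y S" "d \<notin> S \<times> S" using xy by blast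
    have fS: "finite S" using S(1) assms(1) finite_subset by blast
    have "card (insert d (D \<inter> S \<times> S)) \<le> card (D \<inter> insert y S \<times> insert y S)"
      using d assms(2) by (intro card_mono) auto
    moreover have "card (insert d (D \<inter> S \<times> S)) = card (D \<inter> S \<times> S) + 1" using d assms(2) by simp
    moreover have "card (insert y S) = s + 1" using S(2) fS xy by simp
    ultimately show ?case using S xy by (intro exI[of _ "insert y S"]) auto
  qed
  moreover have "1 \<le> card W" using assms by (simp add: Suc_le_eq card_gt_0_iff)
  ultimately obtain S where S: "S \<subseteq> W" "card S = card W" "card S \<le> card (D \<inter> S \<times> S) + 1" by blast
  have "card (D \<inter> S \<times> S) \<le> card D" using assms(2) by (intro card_mono) auto
  thus ?thesis using S by linarith
qed

section \<open>Relabelling a copy, and ordering the copies cyclically\<close>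

lemma half_parity_eqI:
  fixes u v :: nat
  assumes "u div 2 = v div 2" "even u = even v"
  shows "u = v"
proof -
  have "u mod 2 = v mod 2" using assms(2) by (simp add: mod2_eq_if)
  thus ?thesis using assms(1) by (metis div_mult_mod_eq)
qed

text \<open>Normalises the labels of a copy without breaking pairs: the pair of \<open>s\<close> is
  exchanged with \<open>{0, 1}\<close>, so that \<open>s\<close> gets the outgoing linking label 1
  and its non-neighbour the incoming label 0.\<close>

definition block_move :: "nat \<Rightarrow> nat \<Rightarrow> nat" where
  "block_move s y = (if y div 2 = s div 2 then (if y = s then 1 else 0)
     else if y div 2 = 0 then 2 * (s div 2) + y mod 2 else y)"

lemma block_move_div:
  "block_move s y div 2 = (if y div 2 = s div 2 then 0 else if y div 2 = 0 then s div 2 else y div 2)"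
  by (auto simp: block_move_def)

lemma block_move_div_eq_iff: "block_move s x div 2 = block_move s y div 2 \<longleftrightarrow> x div 2 = y div 2"
  unfolding block_move_div by auto

lemma block_move_bij:
  assumes "even m" "s < m"
  shows "bij_betw (block_move s) {..<m} {..<m}"
proof -
  have "block_move s x \<in> {..<m}" if "x \<in> {..<m}" for x
  proof -
    have "2 * (s div 2) + 1 < m" using assms by presburger
    thus ?thesis using that unfolding block_move_def by (auto split: if_splits) (presburger+)?
  qed
  moreover have "inj_on (block_move s) {..<m}"
  proof (rule inj_onI)
    fix x y assume eq: "block_move s x = block_move s y"
    hence d: "x div 2 = y div 2" using block_move_div_eq_iff[of s x y] by simp
    show "x = y"
    proof (cases "x div 2 = s div 2")
      case True
      hence "y div 2 = s div 2" using d by simp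
      thus ?thesis using eq True unfolding block_move_def by (auto split: if_splits)
    next
      case False
      thus ?thesis using eq d unfolding block_move_def by (auto split: if_splits)
    qed
  qed
  ultimately show ?thesis by (intro bij_betw_imageI endo_inj_surj) auto
qed

lemma block_move_self [simp]: "block_move s s = 1"
  by (simp add: block_move_def)

lemma block_move_mate: "y div 2 = s div 2 \<Longrightarrow> y \<noteq> s \<Longrightarrow> block_move s y = 0"
  by (simp add: block_move_def)

text \<open>Alternating the two involutions \<open>p\<close> (follow the extra edge) and \<open>\<mu>\<close> (cross the copy) traverses all
  copies \<open>c x\<close> in cyclic order. Fixpoint-freeness prevents the walk from returning to a copy through the
  port it has not used.\<close>

locale port_walk =
  fixes W :: "'a set" and p \<mu> :: "'a \<Rightarrow> 'a" and c :: "'a \<Rightarrow> nat" and k :: nat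
  assumes finite_W: "finite W" and W_ne: "W \<noteq> {}"
    and p: "\<And>x. x \<in> W \<Longrightarrow> p x \<in> W \<and> p (p x) = x \<and> p x \<noteq> x"
    and \<mu>: "\<And>x. x \<in> W \<Longrightarrow> \<mu> x \<in> W \<and> \<mu> (\<mu> x) = x \<and> \<mu> x \<noteq> x"
    and c_less: "\<And>x. x \<in> W \<Longrightarrow> c x < k"
    and c_eq: "\<And>x y. x \<in> W \<Longrightarrow> y \<in> W \<Longrightarrow> c x = c y \<longleftrightarrow> y = x \<or> y = \<mu> x"
    and conn: "\<And>S. S \<subseteq> {..<k} \<Longrightarrow> S \<noteq> {} \<Longrightarrow> (\<And>x. x \<in> W \<Longrightarrow> c x \<in> S \<Longrightarrow> c (p x) \<in> S) \<Longrightarrow> S = {..<k}"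
begin

definition step where "step x = \<mu> (p x)"

lemma step_W: "x \<in> W \<Longrightarrow> step x \<in> W"
  using p \<mu> by (simp add: step_def)

lemma funpow_step_W: "x \<in> W \<Longrightarrow> (step ^^ d) x \<in> W"
  by (induction d) (auto simp: step_W)

lemma step_inj: "x \<in> W \<Longrightarrow> y \<in> W \<Longrightarrow> step x = step y \<Longrightarrow> x = y"
  using p \<mu> unfolding step_def by metis

lemma funpow_step_inj: "x \<in> W \<Longrightarrow> y \<in> W \<Longrightarrow> (step ^^ d) x = (step ^^ d) y \<Longrightarrow> x = y"
proof (induction d)
  case (Suc d)
  thus ?case using step_inj[of "(step ^^ d) x" "(step ^^ d) y"] funpow_step_W by simp
qed simp

text \<open>Palindrome argument: if \<open>d + 2\<close> steps from \<open>x\<close> end at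
  \<open>\<mu> x\<close>, undoing the last step and dropping the first shows that \<open>d\<close>
  steps from \<open>step x\<close> end at \<open>\<mu> (step x)\<close>. The descent stops at a
  fixed point of \<open>\<mu>\<close> or of \<open>p\<close>.\<close>

lemma funpow_step_ne_mate: "x \<in> W \<Longrightarrow> (step ^^ d) x \<noteq> \<mu> x"
proof (induction d arbitrary: x rule: induct_nat_012)
  case 0
  thus ?case using \<mu> by (simp add: eq_commute)
next
  case 1
  thus ?case using p \<mu> unfolding step_def by simp metis
next
  case (ge2 d)
  show ?case
  proof
    assume eq: "(step ^^ Suc (Suc d)) x = \<mu> x"
    define z where "z = (step ^^ d) (step x)"
    have z: "z \<in> W" using ge2.prems funpow_step_W step_W by (simp add: z_def)
    have "(step ^^ Suc (Suc d)) x = step z" by (simp add: z_def funpow_swap1)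
    hence "\<mu> (p z) = \<mu> x" using eq by (simp add: step_def)
    hence "p z = x" using \<mu> p z ge2.prems by metis
    hence "z = p x" using p z by metis
    also have "\<dots> = \<mu> (step x)" using p \<mu> ge2.prems by (simp add: step_def)
    finally show False using ge2.IH(1)[OF step_W[OF ge2.prems]] by (simp add: z_def)
  qed
qed

theorem cyclic_order:
  "\<exists>v. (\<forall>j. v j \<in> W) \<and> bij_betw (c \<circ> v) {..<k} {..<k} \<and> (\<forall>j<k. v (Suc j mod k) = \<mu> (p (v j)))"
proof -
  obtain w where w: "w \<in> W" using W_ne by blast
  define v where "v j = (step ^^ j) w" for j
  have vW: "v j \<in> W" for j using w funpow_step_W by (simp add: v_def)
  have v_add: "v (d + i) = (step ^^ d) (v i)" for d i by (simp add: v_def funpow_add)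
  have v_Suc: "v (Suc j) = \<mu> (p (v j))" for j by (simp add: v_def step_def)
  \<comment> \<open>A second visit to a copy is at the same port, never at its mate; injectivity of
    \<open>step\<close> shifts the coincidence back to time 0.\<close>
  have ret: "v (j - i) = v 0" if "i \<le> j" "c (v i) = c (v j)" for i j
  proof -
    have j: "v j = (step ^^ (j - i)) (v i)" using v_add[of "j - i" i] that by simp
    hence "v j \<noteq> \<mu> (v i)" using funpow_step_ne_mate[OF vW] by simp
    hence "v j = v i" using c_eq[OF vW vW] that(2) by blast
    moreover have "v j = (step ^^ i) (v (j - i))" using v_add[of i "j - i"] that(1) by simp
    moreover have "v i = (step ^^ i) (v 0)" by (simp add: v_def)
    ultimately show ?thesis using funpow_step_inj[OF vW vW] by metis
  qed
  have "\<exists>l>0. v l = v 0"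
  proof -
    have "\<not> inj_on (c \<circ> v) {..k}"
    proof
      assume "inj_on (c \<circ> v) {..k}"
      hence "card {..k} \<le> card {..<k}"
        using c_less vW by (intro card_inj_on_le[of "c \<circ> v"]) auto
      thus False by simp
    qed
    then obtain i j where "i \<noteq> j" "c (v i) = c (v j)" by (auto simp: inj_on_def)
    thus ?thesis using ret[of i j] ret[of j i] by (cases "i < j") (force intro: exI[of _ "j - i"] exI[of _ "i - j"])+
  qed
  define l where "l = (LEAST l. 0 < l \<and> v l = v 0)"
  have l: "0 < l" "v l = v 0" using LeastI_ex[OF \<open>\<exists>l>0. v l = v 0\<close>] by (auto simp: l_def)
  have lmin: "l \<le> d" if "0 < d" "v d = v 0" for d unfolding l_def using that by (intro Least_le) simp
  have inj: "inj_on (c \<circ> v) {..<l}"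
  proof (rule inj_onI)
    have *: False if "i < j" "j < l" "c (v i) = c (v j)" for i j
      using lmin[of "j - i"] ret[of i j] that by simp
    fix i j assume "i \<in> {..<l}" "j \<in> {..<l}" "(c \<circ> v) i = (c \<circ> v) j"
    thus "i = j" using *[of i j] *[of j i] by (cases i j rule: linorder_cases) auto
  qed
  have per: "v (j + l) = v j" for j using v_add[of j l] v_add[of j 0] l by simp
  have v_mod: "v j = v (j mod l)" for j
  proof (induction j rule: less_induct)
    case (less j)
    show ?case
    proof (cases "j < l")
      case False
      hence "v j = v (j - l)" using per[of "j - l"] by simp
      also have "\<dots> = v ((j - l) mod l)" using less[of "j - l"] False l(1) by simp
      finally show ?thesis using False by (simp add: le_mod_geq)
    qed simp
  qed
  have "range (c \<circ> v) = {..<k}"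
  proof (rule conn)
    fix x assume x: "x \<in> W" "c x \<in> range (c \<circ> v)"
    then obtain j0 where "c (v j0) = c x" by auto
    \<comment> \<open>Going round once more makes the index a successor, so that a preceding port
      exists even for \<open>j0 = 0\<close>.\<close>
    hence j: "c (v (j0 + l)) = c x" by (simp add: per)
    obtain j where j': "j0 + l = Suc j" using l(1) by (cases "j0 + l") auto
    have "x = v (Suc j) \<or> x = \<mu> (v (Suc j))" using c_eq[OF vW x(1), of "Suc j"] j j' by metis
    thus "c (p x) \<in> range (c \<circ> v)"
    proof
      assume "x = v (Suc j)"
      hence "c (p x) = c (v (Suc (Suc j)))"
        using c_eq[of "p x" "v (Suc (Suc j))"] p[OF x(1)] vW v_Suc[of "Suc j"] by metis
      thus ?thesis by auto
    next
      assume "x = \<mu> (v (Suc j))"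
      hence "x = p (v j)" using v_Suc[of j] p[OF vW] \<mu> by metis
      hence "p x = v j" using p[OF vW] by simp
      thus ?thesis by auto
    qed
  qed (use c_less vW in auto)
  moreover have "range (c \<circ> v) = (c \<circ> v) ` {..<l}"
  proof (intro equalityI subsetI)
    fix y assume "y \<in> range (c \<circ> v)"
    then obtain j where "y = c (v (j mod l))" using v_mod by fastforce
    thus "y \<in> (c \<circ> v) ` {..<l}" using l(1) by auto
  qed auto
  ultimately have im: "(c \<circ> v) ` {..<l} = {..<k}" by simp
  have "l = k" using card_image[OF inj] im by simp
  moreover have "v (Suc j mod l) = \<mu> (p (v j))" for j using v_mod[of "Suc j"] v_Suc by simp
  ultimately show ?thesis using inj im vW by (intro exI[of _ v]) (auto simp: bij_betw_def)
qed

end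

section \<open>The aligned cycle\<close>

lemma copies_arc_iff:
  "((i, a), (j, b)) \<in> parcs (disjoint_copies k (cp_graph m)) \<longleftrightarrow>
   i = j \<and> i < k \<and> a < m \<and> b < m \<and> a div 2 \<noteq> b div 2"
  by (auto simp: disjoint_copies_def cp_graph_def)

lemma aligned_arc_iff:
  "((i, a), (j, b)) \<in> parcs (aligned_cp_cycle k m) \<longleftrightarrow>
   (i = j \<and> i < k \<and> a < m \<and> b < m \<and> a div 2 \<noteq> b div 2) \<or>
   (i < k \<and> a = 1 \<and> j = Suc i mod k \<and> b = 0) \<or> (j < k \<and> b = 1 \<and> i = Suc j mod k \<and> a = 0)"
  unfolding aligned_cp_cycle_def add_edges_def using copies_arc_iff[of i a j b k m] by auto

lemma pverts_copies [simp]: "pverts (disjoint_copies k (cp_graph m)) = {..<k} \<times> {..<m}"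
  by (simp add: disjoint_copies_def cp_graph_def)

lemma pverts_aligned [simp]: "pverts (aligned_cp_cycle k m) = {..<k} \<times> {..<m}"
  by (simp add: aligned_cp_cycle_def add_edges_def)

lemma card_other_pairs:
  assumes "a < m" "even m"
  shows "card {b. b < m \<and> b div 2 \<noteq> a div 2} = m - 2"
proof -
  have "{b. b < m \<and> b div 2 \<noteq> a div 2} = {..<m} - {2 * (a div 2), 2 * (a div 2) + 1}"
    by auto
  moreover have "2 * (a div 2) + 1 < m" using assms by presburger
  hence "{2 * (a div 2), 2 * (a div 2) + 1} \<subseteq> {..<m}" by auto
  ultimately show ?thesis by (simp add: card_Diff_subset)
qed

definition position :: "nat \<Rightarrow> nat \<Rightarrow> nat \<times> nat" where
  "position m x = (x div m, x mod m)"

lemma position_bij: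
  assumes "0 < m"
  shows "bij_betw (position m) {..<k * m} ({..<k} \<times> {..<m})"
  unfolding bij_betw_def
proof
  show "inj_on (position m) {..<k * m}"
    by (rule inj_onI) (metis position_def prod.inject div_mult_mod_eq)
  show "position m ` {..<k * m} = {..<k} \<times> {..<m}"
  proof (intro equalityI subsetI)
    fix z assume "z \<in> position m ` {..<k * m}"
    thus "z \<in> {..<k} \<times> {..<m}" using assms by (auto simp: position_def less_mult_imp_div_less)
  next
    fix z assume z: "z \<in> {..<k} \<times> {..<m}"
    obtain i a where ia: "z = (i, a)" "i < k" "a < m" using z by auto
    have "i * m + a < Suc i * m" using ia by simp
    also have "\<dots> \<le> k * m" using ia by (intro mult_right_mono) auto
    finally show "z \<in> position m ` {..<k * m}"
      using ia by (intro image_eqI[of _ _ "i * m + a"]) (auto simp: position_def)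
  qed
qed

lemma position_add: "a < m \<Longrightarrow> position m (i * m + a) = (i, a)"
  by (simp add: position_def)

lemma position_less: "i < k \<Longrightarrow> a < m \<Longrightarrow> i * m + a < k * (m :: nat)"
proof -
  assume "i < k" "a < m"
  hence "i * m + a < Suc i * m" "Suc i * m \<le> k * m" by (simp, intro mult_right_mono, auto)
  thus ?thesis by linarith
qed

text \<open>The aligned cycle moved to an initial segment of the naturals, the only vertex sets that
  \<open>dissoc_class\<close> and \<open>adj_mat\<close> deal with.\<close>

definition cycle_graph :: "nat \<Rightarrow> nat \<Rightarrow> nat pair_pre_digraph" where
  "cycle_graph k m = \<lparr>pverts = {..<k * m},
     parcs = {(x, y). x < k * m \<and> y < k * m \<and> (position m x, position m y) \<in> parcs (aligned_cp_cycle k m)}\<rparr>"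

lemma cycle_graph_verts [simp]: "pverts (cycle_graph k m) = {..<k * m}"
  by (simp add: cycle_graph_def)

lemma cycle_arc_iff:
  "(x, y) \<in> parcs (cycle_graph k m) \<longleftrightarrow>
   x < k * m \<and> y < k * m \<and> (position m x, position m y) \<in> parcs (aligned_cp_cycle k m)"
  by (simp add: cycle_graph_def)

lemma cycle_arc_sym: "(x, y) \<in> parcs (cycle_graph k m) \<Longrightarrow> (y, x) \<in> parcs (cycle_graph k m)"
  unfolding cycle_arc_iff position_def aligned_arc_iff by auto

lemma cycle_pair_graph: "pair_graph (cycle_graph k m)"
proof -
  have "parcs (cycle_graph k m) \<subseteq> {..<k * m} \<times> {..<k * m}" by (auto simp: cycle_graph_def)
  hence fin: "finite (parcs (cycle_graph k m))" by (rule finite_subset) simp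
  have loop: "(x, x) \<notin> parcs (cycle_graph k m)" for x
    unfolding cycle_arc_iff position_def aligned_arc_iff by auto
  show ?thesis
  proof
    show "fst e \<noteq> snd e" if "e \<in> parcs (cycle_graph k m)" for e using that loop by (cases e) auto
    show "symmetric (with_proj (cycle_graph k m))"
      unfolding symmetric_def by (auto intro!: symI cycle_arc_sym)
  qed (use fin in \<open>auto simp: cycle_graph_def\<close>)
qed

lemma cycle_connected:
  assumes "k \<ge> 1" "m \<ge> 4"
  shows "Digraph_Component.connected (with_proj (cycle_graph k m))"
proof (rule connectedI_closed_set)
  show "pverts (cycle_graph k m) \<noteq> {}" using assms by (auto simp: lessThan_empty_iff)
next
  fix S assume S: "S \<subseteq> pverts (cycle_graph k m)" "S \<noteq> {}"
    and closed: "\<And>x y. x \<in> S \<Longrightarrow> (x, y) \<in> parcs (cycle_graph k m) \<Longrightarrow> y \<in> pverts (cycle_graph k m) \<Longrightarrow> y \<in> S"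
  have step: "j * m + b \<in> S" if "i * m + a \<in> S" "i < k" "a < m" "j < k" "b < m"
    "((i, a), (j, b)) \<in> parcs (aligned_cp_cycle k m)" for i a j b
    by (rule closed[OF that(1)]) (use that position_less in \<open>auto simp: cycle_arc_iff position_add\<close>)
  have copy: "i * m + b \<in> S" if "i * m + a \<in> S" "i < k" "a < m" "b < m" for i a b
  proof (cases "a div 2 = b div 2")
    case False
    thus ?thesis using step[OF that(1-3) that(2,4)] that by (simp add: aligned_arc_iff)
  next
    case True
    \<comment> \<open>Labels of the same pair are non-adjacent in the copy; the detour uses a label
      of another pair, which exists as \<open>m \<ge> 4\<close>.\<close>
    define d where "d = (if a div 2 = 0 then 2 else 0 :: nat)"
    have d: "d < m" "d div 2 \<noteq> a div 2" using assms by (auto simp: d_def)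
    have "i * m + d \<in> S" using step[OF that(1-3) that(2) d(1)] that d by (simp add: aligned_arc_iff)
    thus ?thesis using step[of i d i b] that d True by (simp add: aligned_arc_iff)
  qed
  obtain x where x: "x \<in> S" using S(2) by blast
  define i0 where "i0 = x div m"
  have i0: "i0 < k" using x S assms by (auto simp: i0_def less_mult_imp_div_less)
  have "i0 * m + x mod m \<in> S" using x by (simp add: i0_def)
  hence base: "i0 * m + 0 \<in> S" using copy[of i0 "x mod m" 0] i0 assms by simp
  have all: "((i0 + d) mod k) * m + 0 \<in> S" for d
  proof (induction d)
    case 0
    thus ?case using base i0 by simp
  next
    case (Suc d)
    define i where "i = (i0 + d) mod k"
    have i: "i < k" using assms by (simp add: i_def)
    have "i * m + 1 \<in> S" using copy[of i 0 1] Suc i assms by (simp add: i_def)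
    hence "(Suc i mod k) * m + 0 \<in> S" using step[of i 1 "Suc i mod k" 0] i assms by (simp add: aligned_arc_iff)
    thus ?case by (simp add: i_def mod_Suc_eq)
  qed
  have "y \<in> S" if y: "y < k * m" for y
  proof -
    have j: "y div m < k" using y by (simp add: less_mult_imp_div_less)
    have "i0 + (y div m + k - i0) = y div m + k" using i0 by simp
    hence "(i0 + (y div m + k - i0)) mod k = y div m" using j by simp
    hence "y div m * m + 0 \<in> S" using all[of "y div m + k - i0"] by simp
    thus ?thesis using copy[of "y div m" 0 "y mod m"] j assms by simp
  qed
  thus "S = pverts (cycle_graph k m)" using S by auto
qed

text \<open>Three vertices of \<open>CP_m\<close> never lie in one pair, so one of them is adjacent
  to both of the others.\<close>

lemma cp_dissociated_card_le:
  fixes S :: "nat set"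
  assumes "finite S" "\<forall>v\<in>S. card {y\<in>S. v div 2 \<noteq> y div 2} \<le> 1"
  shows "card S \<le> 2"
proof (rule ccontr)
  assume "\<not> ?thesis"
  hence "3 \<le> card S" by simp
  then obtain T where T: "T \<subseteq> S" "card T = 3" by (metis obtain_subset_with_card_n)
  then obtain x y z where xyz: "T = {x, y, z}" "x \<noteq> y" "x \<noteq> z" "y \<noteq> z" by (auto simp: card_3_iff)
  have two: False if "u \<in> S" "v \<in> S" "w \<in> S" "v \<noteq> w" "u div 2 \<noteq> v div 2" "u div 2 \<noteq> w div 2" for u v w
  proof -
    have "card {v, w} \<le> card {y\<in>S. u div 2 \<noteq> y div 2}"
      using that assms(1) by (intro card_mono) auto
    thus False using assms(2) that by fastforce
  qed
  have xS: "x \<in> S" "y \<in> S" "z \<in> S" using T xyz by auto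
  consider "x div 2 \<noteq> y div 2" "x div 2 \<noteq> z div 2" | "y div 2 \<noteq> x div 2" "y div 2 \<noteq> z div 2"
    | "z div 2 \<noteq> x div 2" "z div 2 \<noteq> y div 2" | "x div 2 = y div 2" "y div 2 = z div 2" by metis
  thus False
  proof cases
    case 1
    thus False using two[of x y z] xS xyz by simp
  next
    case 2
    thus False using two[of y x z] xS xyz by simp
  next
    case 3
    thus False using two[of z x y] xS xyz by simp
  next
    case 4
    have "even x = even y \<or> even x = even z \<or> even y = even z" by blast
    thus False using 4 xyz half_parity_eqI[of x y] half_parity_eqI[of x z] half_parity_eqI[of y z] by simp
  qed
qed

lemma cycle_dissociation_number:
  assumes "k \<ge> 1" "m \<ge> 4"
  shows "dissociation_number (cycle_graph k m) = 2 * k"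
proof (rule dissociation_number_eqI)
  \<comment> \<open>Labels 2 and 3 form a non-adjacent pair that avoids the linking labels 0 and 1,
    so \<open>S\<close> is even independent.\<close>
  define S where "S = (\<lambda>(i, a). i * m + a) ` ({..<k} \<times> {2, 3})"
  have inj: "inj_on (\<lambda>(i, a). i * m + a) ({..<k} \<times> {2, 3})"
  proof (rule inj_onI, clarify)
    fix i a j b assume "a \<in> {2, 3 :: nat}" "b \<in> {2, 3 :: nat}" "i * m + a = j * m + b"
    thus "i = j \<and> a = b" using position_add[of a m i] position_add[of b m j] assms by auto
  qed
  show "card S = 2 * k" unfolding S_def card_image[OF inj] by simp
  have SV: "S \<subseteq> pverts (cycle_graph k m)"
    using assms position_less[of _ k 2 m] position_less[of _ k 3 m] by (auto simp: S_def)
  have noarc: "(x, y) \<notin> parcs (cycle_graph k m)" if xy: "x \<in> S" "y \<in> S" for x y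
  proof -
    obtain i a j b where ij: "x = i * m + a" "y = j * m + b" "a = 2 \<or> a = 3" "b = 2 \<or> b = 3"
      using xy unfolding S_def by fastforce
    have "a < m" "b < m" using ij(3,4) assms by auto
    hence "position m x = (i, a)" "position m y = (j, b)" unfolding ij(1,2) by (simp_all only: position_add)
    thus ?thesis using ij(3,4) by (auto simp: cycle_arc_iff aligned_arc_iff)
  qed
  have "card {y\<in>S. (v, y) \<in> parcs (cycle_graph k m)} \<le> 1" if "v \<in> S" for v
  proof -
    have "{y\<in>S. (v, y) \<in> parcs (cycle_graph k m)} = {}" using noarc[OF that] by blast
    thus ?thesis by (simp only: card.empty)
  qed
  thus "dissociation_set (cycle_graph k m) S" using SV unfolding dissociation_set_iff by blast
next
  fix S assume S: "dissociation_set (cycle_graph k m) S"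
  have SV: "S \<subseteq> {..<k * m}" and deg: "\<And>v. v \<in> S \<Longrightarrow> card {y\<in>S. (v, y) \<in> parcs (cycle_graph k m)} \<le> 1"
    using S by (auto simp: dissociation_set_iff)
  have fS: "finite S" using SV finite_subset by blast
  define T where "T i = {x\<in>S. x div m = i}" for i
  have "card (T i) \<le> 2" if i: "i < k" for i
  proof -
    have mod_inj: "inj_on (\<lambda>x. x mod m) (T i)"
      by (rule inj_onI) (metis (mono_tags, lifting) T_def div_mult_mod_eq mem_Collect_eq)
    have "card ((\<lambda>x. x mod m) ` T i) \<le> 2"
    proof (rule cp_dissociated_card_le)
      show "finite ((\<lambda>x. x mod m) ` T i)" using fS by (simp add: T_def)
      show "\<forall>v\<in>(\<lambda>x. x mod m) ` T i. card {y\<in>(\<lambda>x. x mod m) ` T i. v div 2 \<noteq> y div 2} \<le> 1"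
      proof
        fix v assume "v \<in> (\<lambda>x. x mod m) ` T i"
        then obtain x where x: "x \<in> T i" "v = x mod m" by blast
        have sub: "{y\<in>T i. v div 2 \<noteq> y mod m div 2} \<subseteq> {y\<in>S. (x, y) \<in> parcs (cycle_graph k m)}"
          using x i SV assms by (auto simp: T_def cycle_arc_iff position_def aligned_arc_iff)
        have "{y\<in>(\<lambda>x. x mod m) ` T i. v div 2 \<noteq> y div 2} = (\<lambda>x. x mod m) ` {y\<in>T i. v div 2 \<noteq> y mod m div 2}"
          by auto
        hence "card {y\<in>(\<lambda>x. x mod m) ` T i. v div 2 \<noteq> y div 2} \<le> card {y\<in>T i. v div 2 \<noteq> y mod m div 2}"
          using fS by (simp add: card_image_le T_def)
        also have "\<dots> \<le> card {y\<in>S. (x, y) \<in> parcs (cycle_graph k m)}"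
          using sub fS by (intro card_mono) auto
        also have "\<dots> \<le> 1" using x by (intro deg) (simp add: T_def)
        finally show "card {y\<in>(\<lambda>x. x mod m) ` T i. v div 2 \<noteq> y div 2} \<le> 1" .
      qed
    qed
    thus ?thesis by (simp add: card_image[OF mod_inj])
  qed
  hence "(\<Sum>i<k. card (T i)) \<le> (\<Sum>i<k. 2)" by (intro sum_mono) auto
  moreover have "S \<subseteq> (\<Union>i<k. T i)" using SV by (auto simp: T_def less_mult_imp_div_less)
  hence "card S \<le> card (\<Union>i<k. T i)" using fS by (intro card_mono) (auto simp: T_def)
  moreover have "card (\<Union>i<k. T i) \<le> (\<Sum>i<k. card (T i))" by (rule card_UN_le) simp
  ultimately show "card S \<le> 2 * k" by simp
qed simp

lemma cycle_graph_iso: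
  assumes "m \<ge> 2"
  shows "graph_iso (cycle_graph k m) (aligned_cp_cycle k m)"
proof (rule graph_isoI[where \<phi> = "position m"])
  show "x \<in> pverts (aligned_cp_cycle k m) \<and> y \<in> pverts (aligned_cp_cycle k m)"
    if "(x, y) \<in> parcs (aligned_cp_cycle k m)" for x y
    using that assms by (cases x; cases y) (auto simp: aligned_arc_iff)
qed (use assms position_bij[of m k] in \<open>auto simp: cycle_arc_iff\<close>)

section \<open>Arc count and spectral radius of the aligned cycle\<close>

lemma finite_copies_arcs: "finite (parcs (disjoint_copies k (cp_graph m)))"
proof (rule finite_subset)
  show "parcs (disjoint_copies k (cp_graph m)) \<subseteq> ({..<k} \<times> {..<m}) \<times> ({..<k} \<times> {..<m})"
    by (auto simp: disjoint_copies_def cp_graph_def)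
qed simp

text \<open>Links run from label 1 to label 0. They therefore differ from their reverses and from
  the arcs of the copies, even for \<open>k = 1\<close>, where the single link joins the two
  vertices of one pair.\<close>

lemma aligned_card_arcs:
  assumes "k \<ge> 1"
  shows "card (parcs (aligned_cp_cycle k m)) = card (parcs (disjoint_copies k (cp_graph m))) + 2 * k"
proof -
  define F where "F = {((i, 1 :: nat), (Suc i mod k, 0 :: nat)) | i. i < k}"
  have F: "F = (\<lambda>i. ((i, 1), (Suc i mod k, 0))) ` {..<k}" by (auto simp: F_def)
  have cF: "card F = k" unfolding F by (subst card_image) (auto simp: inj_on_def)
  have fF: "finite F" unfolding F by simp
  have "parcs (aligned_cp_cycle k m) = parcs (disjoint_copies k (cp_graph m)) \<union> (F \<union> F\<inverse>)"
    by (auto simp: aligned_cp_cycle_def add_edges_def F_def)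
  moreover have "parcs (disjoint_copies k (cp_graph m)) \<inter> (F \<union> F\<inverse>) = {}"
    by (auto simp: F_def copies_arc_iff)
  moreover have "F \<inter> F\<inverse> = {}" by (auto simp: F_def)
  ultimately show ?thesis using fF finite_copies_arcs[of k m] cF by (simp add: card_Un_disjoint card_inverse)
qed

lemma cycle_not_tree:
  assumes "k \<ge> 1" "m \<ge> 2"
  shows "cycle_graph k m \<notin> cp_tree_class (k * m) k"
proof
  assume "cycle_graph k m \<in> cp_tree_class (k * m) k"
  moreover have "k * m div k = m" using assms by simp
  ultimately obtain F where F: "F \<subseteq> {((i, a), (j, b)). i < j \<and> j < k \<and> a < m \<and> b < m}" "card F = k - 1"
    "graph_iso (cycle_graph k m) (add_edges (disjoint_copies k (cp_graph m)) F)"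
    unfolding cp_tree_class_def by auto
  have "F \<subseteq> ({..<k} \<times> {..<m}) \<times> ({..<k} \<times> {..<m})" using F(1) by auto
  hence fF: "finite F" by (rule finite_subset) simp
  have "card (parcs (add_edges (disjoint_copies k (cp_graph m)) F))
    \<le> card (parcs (disjoint_copies k (cp_graph m)) \<union> F) + card (F\<inverse>)"
    unfolding add_edges_def by (simp only: pair_pre_digraph.simps) (rule card_Un_le)
  also have "\<dots> \<le> card (parcs (disjoint_copies k (cp_graph m))) + card F + card (F\<inverse>)"
    by (intro add_right_mono card_Un_le)
  finally have "card (parcs (add_edges (disjoint_copies k (cp_graph m)) F))
    \<le> card (parcs (disjoint_copies k (cp_graph m))) + 2 * (k - 1)" using F(2) by (simp add: card_inverse)
  thus False
    using graph_iso_card_parcs[OF F(3)] graph_iso_card_parcs[OF cycle_graph_iso[OF assms(2), of k]]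
      aligned_card_arcs[OF assms(1), of m] assms(1) by linarith
qed

lemma cycle_in_class:
  assumes "k \<ge> 1" "m \<ge> 4"
  shows "cycle_graph k m \<in> dissoc_class (k * m) (2 * k) - cp_tree_class (k * m) k"
  using cycle_pair_graph cycle_connected[OF assms] cycle_dissociation_number[OF assms] cycle_not_tree[of k m] assms
  by (simp add: dissoc_class_def)

lemma cycle_spectral_radius_le:
  assumes km: "k \<ge> 1" "m \<ge> 4" "even m" and t: "0 < t" "2 * t\<^sup>2 + (real m - 1) * t = 1"
  shows "graph_spectral_radius (cycle_graph k m) \<le> real m - 2 + 2 * t"
proof -
  define w where "w x = (if x mod m \<le> 1 then 1 + t else 1)" for x :: nat
  have "(\<Sum>y<k * m. adjacency (cycle_graph k m) x y * w y) \<le> (real m - 2 + 2 * t) * w x" if x: "x < k * m" for x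
  proof -
    define i where "i = x div m"
    define a where "a = x mod m"
    have i: "i < k" and a: "a < m" using x km by (auto simp: i_def a_def less_mult_imp_div_less)
    define N where "N = {y. y < k * m \<and> y div m = i \<and> y mod m div 2 \<noteq> a div 2}"
    define R where "R = {b. b < m \<and> b div 2 \<noteq> a div 2}"
    \<comment> \<open>The neighbour across a link, in the next copy for label 1 and in the previous
      one for label 0; \<open>Suc (y div m) mod k = i\<close> avoids writing a predecessor modulo
      \<open>k\<close>.\<close>
    define X where "X = {y. y < k * m \<and> ((a = 1 \<and> y = Suc i mod k * m) \<or> (a = 0 \<and> y mod m = 1 \<and> Suc (y div m) mod k = i))}"
    have fin: "finite N" "finite X" "finite R" by (auto simp: N_def X_def R_def)
    have "(x, y) \<in> parcs (cycle_graph k m) \<longleftrightarrow> y \<in> N \<or> y \<in> X" if "y < k * m" for y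
    proof -
      have "(y div m = Suc i mod k \<and> y mod m = 0) \<longleftrightarrow> y = Suc i mod k * m"
        using km by (metis add.right_neutral div_mult_mod_eq mod_mult_self2_is_0 nonzero_mult_div_cancel_right not_numeral_le_zero)
      moreover have "y div m < k" using that by (simp add: less_mult_imp_div_less)
      moreover have "y mod m < m" using km by simp
      ultimately show ?thesis using that x i a
        unfolding cycle_arc_iff position_def aligned_arc_iff N_def X_def i_def[symmetric] a_def[symmetric] by auto
    qed
    hence "(\<Sum>y<k * m. adjacency (cycle_graph k m) x y * w y) = (\<Sum>y<k * m. if y \<in> N \<union> X then w y else 0)"
      by (intro sum.cong refl) (auto simp: adjacency_def)
    also have "\<dots> = sum w (N \<union> X)"
      by (simp add: sum.If_cases) (auto simp: N_def X_def intro!: sum.cong)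
    also have "\<dots> \<le> sum w N + sum w X"
      using fin sum_nonneg[of "N \<inter> X" w] t by (subst sum_Un) (auto simp: w_def)
    also have "sum w N = (\<Sum>b\<in>R. 1 + (if b \<le> 1 then t else 0))"
    proof -
      have "N = (\<lambda>b. i * m + b) ` R"
      proof (intro equalityI subsetI)
        fix y assume "y \<in> N"
        thus "y \<in> (\<lambda>b. i * m + b) ` R" using km
          by (intro image_eqI[of _ _ "y mod m"]) (auto simp: N_def R_def)
      qed (use i position_less in \<open>auto simp: N_def R_def\<close>)
      moreover have "inj_on (\<lambda>b. i * m + b) R" by (simp add: inj_on_def)
      ultimately have "sum w N = (\<Sum>b\<in>R. w (i * m + b))" by (simp add: sum.reindex)
      also have "\<dots> = (\<Sum>b\<in>R. 1 + (if b \<le> 1 then t else 0))"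
        by (intro sum.cong refl) (auto simp: w_def R_def)
      finally show ?thesis .
    qed
    also have "\<dots> = real (card R) + t * real (card {b\<in>R. b \<le> 1})"
      using fin by (simp add: sum.distrib sum.If_cases Int_def)
    also have "card R = m - 2" unfolding R_def by (rule card_other_pairs[OF a km(3)])
    also have "{b\<in>R. b \<le> 1} = (if a \<le> 1 then {} else {0, 1})"
      using km by (auto simp: R_def)
    also have "sum w X \<le> (if a \<le> 1 then 1 + t else 0)"
    proof -
      have "\<exists>z. X \<subseteq> {z}" if "a \<le> 1"
      proof (cases "a = 1")
        case True
        thus ?thesis by (intro exI[of _ "Suc i mod k * m"]) (auto simp: X_def)
      next
        case False
        have "y = y'" if "y \<in> X" "y' \<in> X" for y y'
        proof -
          have d: "y div m < k" "y' div m < k" using that by (auto simp: X_def less_mult_imp_div_less)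
          have e: "y mod m = y' mod m" "Suc (y div m) mod k = Suc (y' div m) mod k" using that False by (auto simp: X_def)
          have "y div m = y' div m" using e(2) d by (auto simp: mod_Suc split: if_splits)
          thus ?thesis using e(1) by (metis div_mult_mod_eq)
        qed
        thus ?thesis by (cases "X = {}") blast+
      qed
      moreover have "X = {}" if "\<not> a \<le> 1" using that by (auto simp: X_def)
      moreover have "w z \<le> 1 + t" "0 \<le> w z" for z using t by (auto simp: w_def)
      ultimately show ?thesis using t by (auto dest!: subset_singletonD)
    qed
    finally have le: "(\<Sum>y<k * m. adjacency (cycle_graph k m) x y * w y)
      \<le> real (m - 2) + t * real (card (if a \<le> 1 then {} else {0, 1 :: nat})) + (if a \<le> 1 then 1 + t else 0)" by simp
    have m2: "real (m - 2) = real m - 2" using km by simp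
    show ?thesis
    proof (cases "a \<le> 1")
      case True
      have "(real m - 2 + 2 * t) * (1 + t) = real m - 2 + 1 + t + (2 * t\<^sup>2 + (real m - 1) * t - 1)"
        by (simp add: power2_eq_square algebra_simps)
      hence "(real m - 2 + 2 * t) * w x = real m - 2 + 1 + t" using True t by (simp add: w_def a_def)
      thus ?thesis using le True m2 by simp
    next
      case False
      have "w x = 1" using False by (simp add: w_def a_def)
      thus ?thesis using le False m2 by simp
    qed
  qed
  moreover have "0 < w i" for i using t by (simp add: w_def)
  ultimately show ?thesis
    by (intro graph_spectral_radius_le[where n = "k * m" and w = w]) (use km cycle_arc_sym in auto)
qed

section \<open>Extremal graphs\<close>

text \<open>Glues the pairings of the parts together. Only one implication holds for adjacency: the
  two vertices of a pair may be adjacent as well, for instance in a complete part, and such edges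
  later count as extra.\<close>

lemma labelling_exists:
  assumes "symp E" "finite V" "even m"
    and P: "\<And>i. i < k \<Longrightarrow> card (P i) = m" "\<And>i. i < k \<Longrightarrow> comatching E (P i)"
    and disj: "\<And>i j. i < k \<Longrightarrow> j < k \<Longrightarrow> i \<noteq> j \<Longrightarrow> P i \<inter> P j = {}" and un: "(\<Union>i<k. P i) = V"
  shows "\<exists>c h. bij_betw (\<lambda>x. (c x, h x)) V ({..<k} \<times> {..<m}) \<and>
    (\<forall>x\<in>V. \<forall>y\<in>V. c x = c y \<longrightarrow> h x div 2 \<noteq> h y div (2 :: nat) \<longrightarrow> E x y)"
proof -
  have PV: "P i \<subseteq> V" if "i < k" for i using un that by blast
  have "\<exists>g. bij_betw g (P i) {..<m} \<and> (\<forall>x\<in>P i. \<forall>y\<in>P i. x \<noteq> y \<longrightarrow> \<not> E x y \<longrightarrow> g x div 2 = g y div (2 :: nat))"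
    if "i < k" for i
    using comatching_pairing[of "P i" "m div 2" E] P[OF that] assms(1-3) finite_subset[OF PV[OF that]] by simp
  then obtain g where g: "\<And>i. i < k \<Longrightarrow> bij_betw (g i) (P i) {..<m}"
    "\<And>i x y. i < k \<Longrightarrow> x \<in> P i \<Longrightarrow> y \<in> P i \<Longrightarrow> x \<noteq> y \<Longrightarrow> \<not> E x y \<Longrightarrow> g i x div 2 = g i y div 2" by metis
  have "\<forall>x\<in>V. \<exists>i. i < k \<and> x \<in> P i" using un by blast
  then obtain c where c: "\<And>x. x \<in> V \<Longrightarrow> c x < k" "\<And>x. x \<in> V \<Longrightarrow> x \<in> P (c x)" by metis
  define h where "h x = g (c x) x" for x
  have "bij_betw (\<lambda>x. (c x, h x)) V ({..<k} \<times> {..<m})"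
  proof (rule bij_betw_imageI)
    show "inj_on (\<lambda>x. (c x, h x)) V"
    proof (rule inj_onI)
      fix x y assume xy: "x \<in> V" "y \<in> V" "(c x, h x) = (c y, h y)"
      hence "g (c x) x = g (c x) y" "y \<in> P (c x)" using c(2)[of y] by (auto simp: h_def)
      thus "x = y" using g(1)[OF c(1)[OF xy(1)]] c(2)[OF xy(1)] by (auto simp: bij_betw_def dest: inj_onD)
    qed
    show "(\<lambda>x. (c x, h x)) ` V = {..<k} \<times> {..<m}"
    proof (intro equalityI subsetI)
      fix z assume "z \<in> (\<lambda>x. (c x, h x)) ` V"
      then obtain x where x: "x \<in> V" "z = (c x, h x)" by blast
      have "h x \<in> {..<m}" using g(1)[OF c(1)[OF x(1)]] c(2)[OF x(1)] by (auto simp: h_def bij_betw_def)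
      thus "z \<in> {..<k} \<times> {..<m}" using x c(1) by auto
    next
      fix z assume "z \<in> {..<k} \<times> {..<m}"
      then obtain i a where ia: "z = (i, a)" "i < k" "a < m" by auto
      have "a \<in> g i ` P i" using g(1)[OF ia(2)] ia(3) by (simp add: bij_betw_def)
      then obtain x where x: "x \<in> P i" "g i x = a" by blast
      have xV: "x \<in> V" using x PV ia by blast
      have "c x = i" using disj[OF c(1)[OF xV] ia(2)] c(2)[OF xV] x(1) by blast
      thus "z \<in> (\<lambda>x. (c x, h x)) ` V" using xV x ia by (intro image_eqI[of _ _ x]) (auto simp: h_def)
    qed
  qed
  moreover have "E x y" if "x \<in> V" "y \<in> V" "c x = c y" "h x div 2 \<noteq> h y div 2" for x y
    using g(2)[OF c(1)[OF that(1)] c(2)[OF that(1)], of y] c(2)[OF that(2)] that(3,4) by (auto simp: h_def)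
  ultimately show ?thesis by blast
qed

text \<open>Under the labelling \<open>x \<mapsto> (c x, h x)\<close> the graph contains \<open>k\<close> disjoint copies of \<open>CP\<^sub>m\<close>; the arcs
  \<open>base x y\<close> are theirs and the arcs \<open>extra x y\<close> are the remaining ones.\<close>

locale labelled_graph =
  fixes G :: "nat pair_pre_digraph" and k m n :: nat and c h :: "nat \<Rightarrow> nat" and t :: real
  assumes graph: "pair_graph G" and verts: "pverts G = {..<n}"
    and conn: "Digraph_Component.connected (with_proj G)"
    and not_tree: "G \<notin> cp_tree_class n k"
    and k: "k \<ge> 1" and m: "m \<ge> 4" "even m" and n: "n = k * m"
    and label: "bij_betw (\<lambda>x. (c x, h x)) {..<n} ({..<k} \<times> {..<m})"
    and base_arc: "\<And>x y. x < n \<Longrightarrow> y < n \<Longrightarrow> c x = c y \<Longrightarrow> h x div 2 \<noteq> h y div 2 \<Longrightarrow> (x, y) \<in> parcs G"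
    and t: "0 < t" "2 * t\<^sup>2 + (real m - 1) * t = 1"
    and radius: "graph_spectral_radius G \<le> real m - 2 + 2 * t"
begin

definition base where "base x y \<longleftrightarrow> x < n \<and> y < n \<and> c x = c y \<and> h x div 2 \<noteq> h y div 2"
definition extra where "extra x y \<longleftrightarrow> (x, y) \<in> parcs G \<and> \<not> base x y"
definition ext_deg :: "nat \<Rightarrow> real" where "ext_deg x = (\<Sum>y<n. if extra x y then 1 else 0)"
definition ports where "ports = {x. x < n \<and> ext_deg x = 1}"

lemma arc_less: "(x, y) \<in> parcs G \<Longrightarrow> x < n \<and> y < n"
proof -
  interpret G: pair_graph G by (rule graph)
  show "(x, y) \<in> parcs G \<Longrightarrow> x < n \<and> y < n" using G.in_arcsD1 G.in_arcsD2 verts by auto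
qed

lemma arc_sym: "(x, y) \<in> parcs G \<Longrightarrow> (y, x) \<in> parcs G"
proof -
  interpret G: pair_graph G by (rule graph)
  show "(x, y) \<in> parcs G \<Longrightarrow> (y, x) \<in> parcs G" by (rule G.arcs_symmetric)
qed

lemma arc_irrefl: "(x, x) \<notin> parcs G"
proof -
  interpret G: pair_graph G by (rule graph)
  show ?thesis using G.no_loops' by blast
qed

lemma arc_iff: "(x, y) \<in> parcs G \<longleftrightarrow> base x y \<or> extra x y"
  using base_arc by (auto simp: extra_def base_def)

lemma extra_not_base: "extra x y \<Longrightarrow> \<not> base x y"
  by (simp add: extra_def)

lemma base_sym: "base x y \<Longrightarrow> base y x"
  by (auto simp: base_def)

lemma extra_sym: "extra x y \<Longrightarrow> extra y x"
  using base_sym arc_sym by (auto simp: extra_def)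

lemma extra_less: "extra x y \<Longrightarrow> x < n \<and> y < n"
  using arc_less[of x y] by (simp add: extra_def)

lemma extra_ne: "extra x y \<Longrightarrow> x \<noteq> y"
  using arc_irrefl by (auto simp: extra_def)

lemma label_inj: "x < n \<Longrightarrow> y < n \<Longrightarrow> c x = c y \<Longrightarrow> h x = h y \<Longrightarrow> x = y"
  using label by (auto simp: bij_betw_def dest: inj_onD)

lemma label_fst_less: "x < n \<Longrightarrow> c x < k" and label_snd_less: "x < n \<Longrightarrow> h x < m"
  using label by (auto simp: bij_betw_def image_subset_iff)

lemma label_surj: "i < k \<Longrightarrow> a < m \<Longrightarrow> \<exists>x<n. c x = i \<and> h x = a"
proof -
  assume "i < k" "a < m"
  hence "(i, a) \<in> (\<lambda>x. (c x, h x)) ` {..<n}" using label by (simp add: bij_betw_def)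
  thus ?thesis by auto
qed

text \<open>Base arcs stay inside a copy, so connectivity of \<open>G\<close> passes to the quotient
  whose vertices are the copies and whose edges come from the extra ones.\<close>

lemma closed_set:
  assumes "S \<subseteq> {..<k}" "S \<noteq> {}" "\<And>x y. extra x y \<Longrightarrow> c x \<in> S \<Longrightarrow> c y \<in> S"
  shows "S = {..<k}"
proof -
  define T where "T = {x. x < n \<and> c x \<in> S}"
  have surj: "\<exists>x\<in>{..<n}. c x = i" if "i < k" for i using label_surj[OF that, of 0] m by auto
  have "T = pverts G"
  proof (rule connected_closed_set[OF conn])
    show "T \<subseteq> pverts G" by (auto simp: T_def verts)
    show "T \<noteq> {}" using surj assms(1,2) by (fastforce simp: T_def)
    fix x y assume xy: "x \<in> T" "(x, y) \<in> parcs G \<or> (y, x) \<in> parcs G" "y \<in> pverts G"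
    hence "(x, y) \<in> parcs G" using arc_sym by blast
    hence "base x y \<or> extra x y" by (simp add: arc_iff)
    thus "y \<in> T" using xy assms(3)[of x y] by (auto simp: T_def base_def verts)
  qed
  thus ?thesis using surj assms(1) by (fastforce simp: T_def verts)
qed

lemma base_deg:
  assumes "x < n"
  shows "(\<Sum>y<n. if base x y then 1 else 0 :: real) = real m - 2"
proof -
  have "(\<Sum>y<n. if base x y then 1 else 0 :: real) = real (card {y. y < n \<and> base x y})"
    by (simp add: sum.If_cases Int_def)
  also have "card {y. y < n \<and> base x y} = card {b. b < m \<and> b div 2 \<noteq> h x div 2}"
  proof (rule bij_betw_same_card[of h], rule bij_betw_imageI)
    show "inj_on h {y. y < n \<and> base x y}"
      by (rule inj_onI) (auto simp: base_def intro: label_inj)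
    show "h ` {y. y < n \<and> base x y} = {b. b < m \<and> b div 2 \<noteq> h x div 2}"
    proof (intro equalityI subsetI)
      fix b assume b: "b \<in> {b. b < m \<and> b div 2 \<noteq> h x div 2}"
      then obtain y where "y < n" "c y = c x" "h y = b" using label_surj[OF label_fst_less[OF assms], of b] by auto
      thus "b \<in> h ` {y. y < n \<and> base x y}" using b assms by (auto simp: base_def)
    qed (auto simp: base_def label_snd_less)
  qed
  also have "\<dots> = m - 2" by (rule card_other_pairs[OF label_snd_less[OF assms] m(2)])
  finally show ?thesis using m by simp
qed

text \<open>With fewer than \<open>k\<close> extra edges, connectivity of the quotient uses up
  \<open>k - 1\<close> of them between different copies and leaves none inside a copy; the labelling
  then exhibits \<open>G\<close> as a member of the tree class.\<close>

lemma extra_many: "2 * real k \<le> (\<Sum>x<n. ext_deg x)"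
proof (rule ccontr)
  assume neg: "\<not> ?thesis"
  define XS where "XS = {(x, y). extra x y}"
  \<comment> \<open>One ordered pair per crossing edge, oriented as in \<open>cp_tree_class\<close>;
    an extra edge inside a copy appears in \<open>XI\<close> in both orders.\<close>
  define XC where "XC = {(x, y). extra x y \<and> c x < c y}"
  define XI where "XI = {(x, y). extra x y \<and> c x = c y}"
  have "XS \<subseteq> {..<n} \<times> {..<n}" using extra_less by (auto simp: XS_def)
  hence fXS: "finite XS" by (rule finite_subset) simp
  have split: "XS = XC \<union> XC\<inverse> \<union> XI" using extra_sym by (auto simp: XS_def XC_def XI_def)
  have fin: "finite XC" "finite XI" using fXS split by auto
  have "(\<Sum>x<n. ext_deg x) = (\<Sum>z\<in>{..<n} \<times> {..<n}. if z \<in> XS then 1 else 0)"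
    by (simp add: ext_deg_def XS_def sum.cartesian_product case_prod_unfold)
  also have "\<dots> = real (card XS)"
    using \<open>XS \<subseteq> {..<n} \<times> {..<n}\<close> by (simp add: sum.If_cases Int_absorb1)
  finally have "card XS < 2 * k" using neg by simp
  moreover have "card XS = 2 * card XC + card XI"
  proof -
    have "card (XC \<union> XC\<inverse>) = card XC + card (XC\<inverse>)"
      using fin by (intro card_Un_disjoint) (auto simp: XC_def)
    moreover have "card ((XC \<union> XC\<inverse>) \<union> XI) = card (XC \<union> XC\<inverse>) + card XI"
      using fin by (intro card_Un_disjoint) (auto simp: XC_def XI_def)
    ultimately show ?thesis unfolding split by (simp add: card_inverse)
  qed
  ultimately have lt: "2 * card XC + card XI < 2 * k" by simp
  define D where "D = (\<lambda>(x, y). (c x, c y)) ` XC"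
  have "card {..<k} \<le> card D + 1"
  proof (rule card_le_card_edges)
    show "finite D" using fin by (simp add: D_def)
    show "{..<k} \<noteq> {}" using k by (auto simp: lessThan_empty_iff)
    fix S assume S: "S \<subseteq> {..<k}" "S \<noteq> {}"
      and cl: "\<And>x y. x \<in> S \<Longrightarrow> y \<in> {..<k} \<Longrightarrow> (x, y) \<in> D \<or> (y, x) \<in> D \<Longrightarrow> y \<in> S"
    show "S = {..<k}"
    proof (rule closed_set[OF S])
      fix x y assume xy: "extra x y" "c x \<in> S"
      show "c y \<in> S"
      proof (cases "c x = c y")
        case False
        hence "(x, y) \<in> XC \<or> (y, x) \<in> XC" using xy(1) extra_sym by (auto simp: XC_def)
        hence "(c x, c y) \<in> D \<or> (c y, c x) \<in> D" by (force simp: D_def)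
        thus ?thesis using cl[OF xy(2)] label_fst_less extra_less[OF xy(1)] by blast
      qed (use xy in simp)
    qed
  qed simp
  moreover have "card D \<le> card XC" unfolding D_def by (rule card_image_le[OF fin(1)])
  ultimately have kXC: "k \<le> card XC + 1" by simp
  \<comment> \<open>An extra edge inside a copy gives two ordered pairs, and
    \<open>2 * (k - 1) + 2\<close> reaches the excluded value \<open>2 * k\<close>.\<close>
  have XI: "XI = {}"
  proof (rule ccontr)
    assume "XI \<noteq> {}"
    then obtain x y where xy: "(x, y) \<in> XI" by auto
    hence "{(x, y), (y, x)} \<subseteq> XI" using extra_sym by (auto simp: XI_def)
    hence "card {(x, y), (y, x)} \<le> card XI" using fin by (intro card_mono)
    moreover have "card {(x, y), (y, x)} = 2" using extra_ne[of x y] xy by (simp add: XI_def)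
    ultimately show False using lt kXC by simp
  qed
  hence cXC: "card XC = k - 1" using lt kXC by simp
  define \<phi> where "\<phi> x = (c x, h x)" for x
  define F where "F = (\<lambda>(x, y). (\<phi> x, \<phi> y)) ` XC"
  have inj: "x = y" if "x < n" "y < n" "\<phi> x = \<phi> y" for x y using label_inj that by (simp add: \<phi>_def)
  have "inj_on (\<lambda>(x, y). (\<phi> x, \<phi> y)) XC"
    by (rule inj_onI) (use inj extra_less in \<open>auto simp: XC_def\<close>)
  hence cF: "card F = k - 1" using cXC by (simp add: F_def card_image)
  have nk: "n div k = m" using n k by simp
  have Fsub: "F \<subseteq> {((i, a), (j, b)). i < j \<and> j < k \<and> a < n div k \<and> b < n div k}"
    unfolding nk using extra_less label_fst_less label_snd_less by (auto simp: F_def \<phi>_def XC_def)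
  have Fiff: "(\<phi> x, \<phi> y) \<in> F \<longleftrightarrow> extra x y \<and> c x < c y" if "x < n" "y < n" for x y
  proof
    assume "(\<phi> x, \<phi> y) \<in> F"
    then obtain x' y' where "(x', y') \<in> XC" "\<phi> x = \<phi> x'" "\<phi> y = \<phi> y'" by (auto simp: F_def)
    moreover from this have "x' < n" "y' < n" using extra_less by (auto simp: XC_def)
    ultimately show "extra x y \<and> c x < c y" using inj that by (auto simp: XC_def)
  qed (auto simp: F_def XC_def)
  have "graph_iso G (add_edges (disjoint_copies k (cp_graph (n div k))) F)"
    unfolding nk
  proof (rule graph_isoI[where \<phi> = \<phi>])
    show "x \<in> pverts G \<and> y \<in> pverts G" if "(x, y) \<in> parcs G" for x y using arc_less[OF that] verts by simp
    show "x \<in> pverts (add_edges (disjoint_copies k (cp_graph m)) F) \<and> y \<in> pverts (add_edges (disjoint_copies k (cp_graph m)) F)"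
      if "(x, y) \<in> parcs (add_edges (disjoint_copies k (cp_graph m)) F)" for x y
      using that Fsub unfolding nk add_edges_def by (cases x; cases y) (auto simp: copies_arc_iff)
    show "bij_betw \<phi> (pverts G) (pverts (add_edges (disjoint_copies k (cp_graph m)) F))"
      using label by (simp add: add_edges_def verts \<phi>_def[abs_def])
    fix x y assume "x \<in> pverts G" "y \<in> pverts G"
    hence xy: "x < n" "y < n" by (auto simp: verts)
    have "base x y \<longleftrightarrow> (\<phi> x, \<phi> y) \<in> parcs (disjoint_copies k (cp_graph m))"
      using xy label_fst_less label_snd_less by (auto simp: base_def \<phi>_def copies_arc_iff)
    moreover have "extra x y \<longleftrightarrow> (\<phi> x, \<phi> y) \<in> F \<union> F\<inverse>"
      using Fiff[OF xy] Fiff[OF xy(2,1)] XI extra_sym by (auto simp: XI_def)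
    ultimately show "(x, y) \<in> parcs G \<longleftrightarrow> (\<phi> x, \<phi> y) \<in> parcs (add_edges (disjoint_copies k (cp_graph m)) F)"
      by (auto simp: arc_iff add_edges_def)
  qed
  hence "G \<in> cp_tree_class n k"
    unfolding cp_tree_class_def using verts conn Fsub cF by blast
  thus False using not_tree by blast
qed

lemma extremal:
  shows "(\<Sum>x<n. ext_deg x) = 2 * real k" "x < n \<Longrightarrow> ext_deg x = 0 \<or> ext_deg x = 1"
    "base x y \<Longrightarrow> ext_deg x = 0 \<or> ext_deg y = 0"
proof -
  define b where "b x y = (if base x y then 1 else 0 :: real)" for x y
  define f where "f x y = (if extra x y then 1 else 0 :: real)" for x y
  have n0: "0 < n" using n k m by simp
  have "adjacency G = (\<lambda>x y. b x y + f x y)"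
    using extra_not_base by (intro ext) (auto simp: adjacency_def b_def f_def arc_iff)
  hence "quad_form (\<lambda>x y. b x y + f x y) n (\<lambda>x. 1 + t * ext_deg x)
      \<le> graph_spectral_radius G * sq_norm n (\<lambda>x. 1 + t * ext_deg x)"
    using graph_rayleigh(2)[OF verts n0 arc_sym] by simp
  also have "\<dots> \<le> (real m - 2 + 2 * t) * sq_norm n (\<lambda>x. 1 + t * ext_deg x)"
    using radius sq_norm_nonneg by (rule mult_right_mono)
  finally have ray: "quad_form (\<lambda>x y. b x y + f x y) n (\<lambda>x. 1 + t * ext_deg x)
      \<le> (real m - 2 + 2 * t) * sq_norm n (\<lambda>x. 1 + t * ext_deg x)" .
  have m0: "0 < m" using m by simp
  have bs: "b x y = b y x" "0 \<le> b x y" for x y using base_sym by (auto simp: b_def)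
  have fs: "f x y = f y x" "f x y = 0 \<or> f x y = 1" for x y using extra_sym by (auto simp: f_def)
  have bd: "(\<Sum>y<n. b x y) = real m - 2" if "x < n" for x using base_deg[OF that] by (simp add: b_def)
  have ed: "ext_deg x = (\<Sum>y<n. f x y)" for x by (simp add: ext_deg_def f_def)
  note ex = extra_edges_extremal[OF bs bd fs ed n m0 t ray extra_many]
  show "(\<Sum>x<n. ext_deg x) = 2 * real k" using ex(1) by blast
  show "x < n \<Longrightarrow> ext_deg x = 0 \<or> ext_deg x = 1" using ex(2) by blast
  show "base x y \<Longrightarrow> ext_deg x = 0 \<or> ext_deg y = 0" using ex(3)[of x y] by (auto simp: b_def base_def)
qed

section \<open>Ports, their partners and mates, and the cycle they form\<close>

lemma ext_deg_card: "ext_deg x = real (card {y. y < n \<and> extra x y})"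
  by (simp add: ext_deg_def sum.If_cases Int_def)

lemma extra_ports: "extra x y \<Longrightarrow> x \<in> ports"
proof -
  assume xy: "extra x y"
  hence "{y. y < n \<and> extra x y} \<noteq> {}" using extra_less by blast
  hence "ext_deg x \<noteq> 0" by (simp add: ext_deg_card)
  thus ?thesis using extremal(2)[of x] extra_less[OF xy] by (simp add: ports_def)
qed

lemma partner: "x \<in> ports \<Longrightarrow> \<exists>!y. extra x y"
proof -
  assume "x \<in> ports"
  hence "card {y. y < n \<and> extra x y} = 1" by (simp add: ports_def ext_deg_card)
  then obtain y where y: "{y. y < n \<and> extra x y} = {y}" by (auto simp: card_1_singleton_iff)
  show ?thesis using y extra_less by (intro ex1I[of _ y]) blast+
qed

lemma card_ports: "card ports = 2 * k"
proof -
  have "(\<Sum>x<n. ext_deg x) = (\<Sum>x<n. if ext_deg x = 1 then 1 else 0)"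
    using extremal(2) by (intro sum.cong) auto
  also have "\<dots> = real (card ports)" by (simp add: sum.If_cases Int_def ports_def)
  finally show ?thesis using extremal(1) by simp
qed

lemma finite_ports: "finite ports"
  by (simp add: ports_def)

lemma ports_less: "x \<in> ports \<Longrightarrow> x < n"
  by (simp add: ports_def)

lemma ports_mates:
  assumes "x \<in> ports" "y \<in> ports" "c x = c y"
  shows "h x div 2 = h y div 2"
  using extremal(3)[of x y] assms by (auto simp: base_def ports_def)

text \<open>All ports of one copy lie in the same pair, so there are at most two; with
  \<open>2 * k\<close> ports in total no copy can have fewer.\<close>

lemma card_ports_copy:
  assumes "i < k"
  shows "card {x\<in>ports. c x = i} = 2"
proof -
  have le: "card {x\<in>ports. c x = j} \<le> 2" for j
  proof (rule ccontr)
    assume "\<not> ?thesis"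
    then obtain T where T: "T \<subseteq> {x\<in>ports. c x = j}" "card T = 3"
      by (metis (no_types, lifting) not_less_eq_eq numeral_3_eq_3 numeral_2_eq_2 obtain_subset_with_card_n)
    then obtain x y z where xyz: "T = {x, y, z}" "x \<noteq> y" "x \<noteq> z" "y \<noteq> z" by (auto simp: card_3_iff)
    have p: "x \<in> ports" "y \<in> ports" "z \<in> ports" "c x = j" "c y = j" "c z = j" using T xyz by auto
    have eq: "u = v" if "u \<in> ports" "v \<in> ports" "c u = j" "c v = j" "even (h u) = even (h v)" for u v
    proof -
      have cuv: "c u = c v" using that by simp
      have "h u div 2 = h v div 2" using ports_mates[OF that(1,2) cuv] .
      hence "h u = h v" using that(5) by (rule half_parity_eqI)
      thus ?thesis by (rule label_inj[OF ports_less[OF that(1)] ports_less[OF that(2)] cuv])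
    qed
    have "even (h x) = even (h y) \<or> even (h x) = even (h z) \<or> even (h y) = even (h z)" by blast
    thus False using eq[OF p(1,2,4,5)] eq[OF p(1,3,4,6)] eq[OF p(2,3,5,6)] xyz(2-4) by blast
  qed
  have "ports = (\<Union>j<k. {x\<in>ports. c x = j})" using label_fst_less ports_less by auto
  moreover have "card (\<Union>j<k. {x\<in>ports. c x = j}) = (\<Sum>j<k. card {x\<in>ports. c x = j})"
    using finite_ports by (intro card_UN_disjoint) auto
  ultimately have "card ports = (\<Sum>j<k. card {x\<in>ports. c x = j})" by metis
  hence "(\<Sum>j<k. card {x\<in>ports. c x = j}) = (\<Sum>j<k. 2)" using card_ports by simp
  show ?thesis
  proof (rule ccontr)
    assume "card {x\<in>ports. c x = i} \<noteq> 2"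
    hence "card {x\<in>ports. c x = i} < 2" using le[of i] by simp
    hence "(\<Sum>j<k. card {x\<in>ports. c x = j}) < (\<Sum>j<k. 2)"
      using le assms by (intro sum_strict_mono_ex1) auto
    thus False using \<open>(\<Sum>j<k. card {x\<in>ports. c x = j}) = (\<Sum>j<k. 2)\<close> by simp
  qed
qed

definition across where "across x = (THE y. extra x y)"
definition mate where "mate x = (THE y. y \<in> ports \<and> c y = c x \<and> y \<noteq> x)"

lemma across: "x \<in> ports \<Longrightarrow> extra x (across x)"
  unfolding across_def by (rule theI') (rule partner)

lemma across_unique: "extra x y \<Longrightarrow> y = across x"
  using partner[OF extra_ports] across[OF extra_ports] by blast

lemma mate_ex1: "x \<in> ports \<Longrightarrow> \<exists>!y. y \<in> ports \<and> c y = c x \<and> y \<noteq> x"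
proof -
  assume x: "x \<in> ports"
  have "card {z\<in>ports. c z = c x} = 2" using card_ports_copy label_fst_less ports_less x by simp
  then obtain u v where uv: "{z\<in>ports. c z = c x} = {u, v}" "u \<noteq> v" by (auto simp: card_2_iff)
  hence "x = u \<or> x = v" using x by blast
  thus ?thesis
  proof
    assume "x = u"
    thus ?thesis using uv by (intro ex1I[of _ v]) blast+
  next
    assume "x = v"
    thus ?thesis using uv by (intro ex1I[of _ u]) blast+
  qed
qed

lemma mate: "x \<in> ports \<Longrightarrow> mate x \<in> ports \<and> c (mate x) = c x \<and> mate x \<noteq> x"
  unfolding mate_def by (rule theI') (rule mate_ex1)

lemma mate_unique: "x \<in> ports \<Longrightarrow> y \<in> ports \<Longrightarrow> c y = c x \<Longrightarrow> y \<noteq> x \<Longrightarrow> y = mate x"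
  using mate_ex1[of x] mate[of x] by blast

sublocale port_walk ports across mate c k
proof
  show "ports \<noteq> {}" using card_ports k by auto
  show "across x \<in> ports \<and> across (across x) = x \<and> across x \<noteq> x" if "x \<in> ports" for x
  proof -
    have e: "extra x (across x)" by (rule across[OF that])
    thus ?thesis using extra_sym[OF e] extra_ports[OF extra_sym[OF e]] across_unique[OF extra_sym[OF e]] extra_ne[OF e] by metis
  qed
  show "mate x \<in> ports \<and> mate (mate x) = x \<and> mate x \<noteq> x" if "x \<in> ports" for x
    using mate[OF that] mate_unique[of "mate x" x] that by metis
  show "c x = c y \<longleftrightarrow> y = x \<or> y = mate x" if "x \<in> ports" "y \<in> ports" for x y
    using mate[OF that(1)] mate_unique[OF that] by metis
  show "S = {..<k}" if "S \<subseteq> {..<k}" "S \<noteq> {}" "\<And>x. x \<in> ports \<Longrightarrow> c x \<in> S \<Longrightarrow> c (across x) \<in> S" for S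
  proof (rule closed_set[OF that(1,2)])
    fix x y assume "extra x y" "c x \<in> S"
    thus "c y \<in> S" using that(3)[OF extra_ports] across_unique by metis
  qed
qed (use finite_ports label_fst_less ports_less in auto)

text \<open>Copies are renumbered by their place in the cyclic order. Inside a copy
  \<open>block_move\<close> sends the port \<open>v j\<close>, by which the walk leaves, to label 1,
  and hence its mate, by which the walk arrives, to label 0.\<close>

theorem iso_aligned: "graph_iso G (aligned_cp_cycle k m)"
proof -
  obtain v where v: "\<And>j. v j \<in> ports" "bij_betw (c \<circ> v) {..<k} {..<k}"
    "\<And>j. j < k \<Longrightarrow> v (Suc j mod k) = mate (across (v j))" using cyclic_order by blast
  define J where "J = inv_into {..<k} (c \<circ> v)"
  have J: "J i < k" "c (v (J i)) = i" if "i < k" for i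
    using bij_betw_inv_into_right[OF v(2), of i] bij_betwE[OF bij_betw_inv_into[OF v(2)], rule_format, of i] that
    by (auto simp: J_def)
  have Jc: "J (c (v j)) = j" if "j < k" for j
    using bij_betw_inv_into_left[OF v(2), of j] that by (simp add: J_def)
  define \<psi> where "\<psi> x = (J (c x), block_move (h (v (J (c x)))) (h x))" for x
  have bm: "bij_betw (block_move (h (v j))) {..<m} {..<m}" for j
    using block_move_bij[OF m(2) label_snd_less[OF ports_less[OF v(1)]]] .
  have J_eq: "J (c x) = J (c y) \<longleftrightarrow> c x = c y" if "x < n" "y < n" for x y
    using J(2)[OF label_fst_less[OF that(1)]] J(2)[OF label_fst_less[OF that(2)]] by metis
  have inj: "x = y" if "x < n" "y < n" "\<psi> x = \<psi> y" for x y
  proof -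
    have c: "c x = c y" using that(3) J_eq[OF that(1,2)] by (simp add: \<psi>_def)
    hence "block_move (h (v (J (c x)))) (h x) = block_move (h (v (J (c x)))) (h y)" using that by (simp add: \<psi>_def)
    hence "h x = h y"
      using inj_onD[OF bij_betw_imp_inj_on[OF bm[of "J (c x)"]]] label_snd_less[OF that(1)] label_snd_less[OF that(2)] by blast
    thus ?thesis by (rule label_inj[OF that(1,2) c])
  qed
  have bij: "bij_betw \<psi> {..<n} ({..<k} \<times> {..<m})"
  proof (rule bij_betw_imageI)
    show i: "inj_on \<psi> {..<n}" using inj by (auto intro: inj_onI)
    have "\<psi> x \<in> {..<k} \<times> {..<m}" if "x < n" for x
      using J(1)[OF label_fst_less[OF that]] bij_betwE[OF bm] label_snd_less[OF that] by (auto simp: \<psi>_def)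
    hence "\<psi> ` {..<n} \<subseteq> {..<k} \<times> {..<m}" by blast
    moreover have "card (\<psi> ` {..<n}) = card ({..<k} \<times> {..<m})" unfolding card_image[OF i] by (simp add: n)
    ultimately show "\<psi> ` {..<n} = {..<k} \<times> {..<m}" by (intro card_subset_eq) auto
  qed
  have \<psi>v: "\<psi> (v j) = (j, 1)" if "j < k" for j using Jc[OF that] by (simp add: \<psi>_def)
  have \<psi>m: "\<psi> (mate (v j)) = (j, 0)" if "j < k" for j
  proof -
    have mt: "mate (v j) \<in> ports" "c (mate (v j)) = c (v j)" "mate (v j) \<noteq> v j" using mate[OF v(1)] by auto
    have "h (mate (v j)) div 2 = h (v j) div 2" using ports_mates[OF mt(1) v(1) mt(2)] .
    moreover have "h (mate (v j)) \<noteq> h (v j)" using label_inj[OF ports_less[OF mt(1)] ports_less[OF v(1)] mt(2)] mt(3) by blast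
    ultimately show ?thesis using mt(2) Jc[OF that] by (simp add: \<psi>_def block_move_mate)
  qed
  have extv: "across (v j) = mate (v (Suc j mod k))" if "j < k" for j
    unfolding v(3)[OF that] using mate mate_unique[of "mate (across (v j))" "across (v j)"] p[OF v(1)] by metis
  have sk: "Suc j mod k < k" for j using k by simp
  have forward: "(\<psi> x, \<psi> y) \<in> parcs (aligned_cp_cycle k m)" if xy: "extra x y" for x y
  proof -
    have x: "x \<in> ports" "x < n" using extra_ports[OF xy] extra_less[OF xy] by auto
    define j where "j = J (c x)"
    have j: "j < k" "c (v j) = c x" using J[OF label_fst_less[OF x(2)]] by (auto simp: j_def)
    have "x = v j \<or> x = mate (v j)" using mate_unique[OF v(1) x(1)] j(2) by metis
    thus ?thesis
    proof
      assume x': "x = v j"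
      hence "y = mate (v (Suc j mod k))" using across_unique[OF xy] extv[OF j(1)] by simp
      thus ?thesis using \<psi>v[OF j(1)] \<psi>m[OF sk] x' j by (simp add: aligned_arc_iff)
    next
      assume x': "x = mate (v j)"
      \<comment> \<open>The predecessor of \<open>j\<close> modulo \<open>k\<close>; adding
        \<open>k\<close> first keeps the subtraction from truncating at
        \<open>j = 0\<close>.\<close>
      define j' where "j' = (j + k - 1) mod k"
      have j': "j' < k" "Suc j' mod k = j" using j(1) k by (auto simp: j'_def mod_Suc_eq)
      have "x = across (v j')" using extv[OF j'(1)] j'(2) x' by simp
      hence "y = v j'" using across_unique[OF xy] p[OF v(1)] by simp
      thus ?thesis using \<psi>v[OF j'(1)] \<psi>m[OF j(1)] x' j'  by (simp add: aligned_arc_iff)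
    qed
  qed
  have backward: "extra x y" if xy: "x < n" "y < n" "\<psi> x = (i, 1)" "\<psi> y = (Suc i mod k, 0)" "i < k" for x y i
  proof -
    have "x = v i" using inj[OF xy(1) ports_less[OF v(1)]] xy(3) \<psi>v[OF xy(5)] by simp
    moreover have "y = mate (v (Suc i mod k))"
      using inj[OF xy(2) ports_less] mate[OF v(1)] xy(4) \<psi>m[OF sk] by metis
    ultimately show ?thesis using across[OF v(1)[of i]] unfolding extv[OF xy(5)] by simp
  qed
  show ?thesis
  proof (rule graph_isoI[where \<phi> = \<psi>])
    show "x \<in> pverts G \<and> y \<in> pverts G" if "(x, y) \<in> parcs G" for x y using arc_less[OF that] verts by simp
    show "x \<in> pverts (aligned_cp_cycle k m) \<and> y \<in> pverts (aligned_cp_cycle k m)"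
      if "(x, y) \<in> parcs (aligned_cp_cycle k m)" for x y
      using that m by (cases x; cases y) (auto simp: aligned_arc_iff)
    show "bij_betw \<psi> (pverts G) (pverts (aligned_cp_cycle k m))" using bij by (simp add: verts)
    fix x y assume "x \<in> pverts G" "y \<in> pverts G"
    hence xy: "x < n" "y < n" by (auto simp: verts)
    obtain i a j b where ia: "\<psi> x = (i, a)" "\<psi> y = (j, b)" by (meson surj_pair)
    have lt: "i < k" "a < m" "j < k" "b < m" using bij xy ia by (auto simp: bij_betw_def image_subset_iff dest!: equalityD1)
    have base_iff: "base x y \<longleftrightarrow> i = j \<and> a div 2 \<noteq> b div 2"
    proof (cases "c x = c y")
      case True
      hence "i = j" "a = block_move (h (v i)) (h x)" "b = block_move (h (v i)) (h y)" using ia by (auto simp: \<psi>_def)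
      thus ?thesis using True xy block_move_div_eq_iff by (simp add: base_def)
    next
      case False
      hence "i \<noteq> j" using ia J_eq[OF xy] by (auto simp: \<psi>_def)
      thus ?thesis using False by (simp add: base_def)
    qed
    show "(x, y) \<in> parcs G \<longleftrightarrow> (\<psi> x, \<psi> y) \<in> parcs (aligned_cp_cycle k m)"
    proof
      assume "(x, y) \<in> parcs G"
      thus "(\<psi> x, \<psi> y) \<in> parcs (aligned_cp_cycle k m)"
        using forward[of x y] base_iff lt unfolding arc_iff by (auto simp: ia aligned_arc_iff)
    next
      assume "(\<psi> x, \<psi> y) \<in> parcs (aligned_cp_cycle k m)"
      then consider "i = j \<and> a div 2 \<noteq> b div 2" | "a = 1 \<and> j = Suc i mod k \<and> b = 0"
        | "b = 1 \<and> i = Suc j mod k \<and> a = 0" unfolding ia aligned_arc_iff by blast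
      thus "(x, y) \<in> parcs G"
      proof cases
        case 1
        thus ?thesis using base_iff arc_iff by blast
      next
        case 2
        thus ?thesis using backward[OF xy, of i] ia lt arc_iff by simp
      next
        case 3
        thus ?thesis using backward[OF xy(2,1), of j] ia lt arc_iff extra_sym by simp
      qed
    qed
  qed
qed

end

text \<open>The Rayleigh bound at an indicator vector; taken for all \<open>X\<close> it supplies
  the hereditary density hypothesis of \<open>comatching_partition\<close>.\<close>

lemma indicator_rayleigh:
  assumes "pverts G = {..<n}" "n > 0" "\<And>x y. (x, y) \<in> parcs G \<Longrightarrow> (y, x) \<in> parcs G" "X \<subseteq> {..<n}"
  shows "degsum (\<lambda>x y. (x, y) \<in> parcs G) X \<le> graph_spectral_radius G * real (card X)"
proof -
  define z where "z x = (if x \<in> X then 1 else 0 :: real)" for x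
  have fX: "finite X" using assms(4) finite_subset by blast
  have sub: "(\<Sum>x<n. if x \<in> X then g x else 0) = sum g X" for g :: "nat \<Rightarrow> real"
    using assms(4) by (simp add: sum.If_cases Int_absorb1)
  have "quad_form (adjacency G) n z = (\<Sum>x<n. if x \<in> X then \<Sum>y<n. if y \<in> X then adjacency G x y else 0 else 0)"
    unfolding quad_form_def by (intro sum.cong refl) (auto simp: z_def intro!: sum.cong)
  also have "\<dots> = (\<Sum>x\<in>X. \<Sum>y\<in>X. adjacency G x y)" by (simp only: sub)
  also have "\<dots> = degsum (\<lambda>x y. (x, y) \<in> parcs G) X"
    unfolding degsum_def using fX by (intro sum.cong refl) (simp add: adjacency_def nbrs_def sum.If_cases Int_def)
  finally have "quad_form (adjacency G) n z = degsum (\<lambda>x y. (x, y) \<in> parcs G) X" .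
  moreover have "sq_norm n z = (\<Sum>x<n. if x \<in> X then 1 else 0)"
    unfolding sq_norm_def by (intro sum.cong refl) (auto simp: z_def)
  hence "sq_norm n z = real (card X)" by (simp only: sub) simp
  ultimately show ?thesis using graph_rayleigh(2)[OF assms(1-3), of z] by simp
qed

theorem theorem8p6:
  fixes k :: nat
  assumes "k \<ge> 1"
  shows "\<exists>N. \<forall>n\<ge>N. 2 * k dvd n \<longrightarrow>
    (\<forall>G. is_arg_min graph_spectral_radius (\<lambda>H. H \<in> dissoc_class n (2 * k) - cp_tree_class n k) G
         \<longrightarrow> graph_iso G (aligned_cp_cycle k (n div k)))"
proof -
  obtain m0 where m0: "\<And>m (V :: nat set) E. m \<ge> m0 \<Longrightarrow> bounded_dissociation V E k \<Longrightarrow> card V = k * m \<Longrightarrow>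
    (\<And>X. X \<subseteq> V \<Longrightarrow> degsum E X \<le> (real m - 2 + 3 / real m) * real (card X)) \<Longrightarrow>
    \<exists>P. (\<forall>i<k. card (P i) = m \<and> comatching E (P i)) \<and>
      (\<forall>i<k. \<forall>j<k. i \<noteq> j \<longrightarrow> P i \<inter> P j = {}) \<and> (\<Union>i<k. P i) = V"
    using comatching_partition[OF assms, where ?'a = nat] by metis
  show ?thesis
  \<comment> \<open>This bound makes \<open>n div k\<close> at least \<open>m0\<close> and at least
    4, the latter so that a copy has a pair apart from its linking vertices.\<close>
  proof (intro exI[of _ "k * max m0 4"] allI impI)
    fix n G
    assume N: "k * max m0 4 \<le> n" and dvd: "2 * k dvd n"
      and min: "is_arg_min graph_spectral_radius (\<lambda>H. H \<in> dissoc_class n (2 * k) - cp_tree_class n k) G"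
    define m where "m = n div k"
    \<comment> \<open>Divisibility by \<open>2 * k\<close> rather than by \<open>k\<close> makes
      \<open>m\<close> even, which pairing up a part requires.\<close>
    obtain r where r: "n = 2 * k * r" using dvd by blast
    have m: "m = 2 * r" "n = k * m" using assms r by (auto simp: m_def)
    have "max m0 4 \<le> m" using N m(2) assms by simp
    hence mm: "m0 \<le> m" "4 \<le> m" by auto
    have ev: "even m" using m by simp
    have n0: "0 < n" using m mm assms by simp
    obtain t where t: "0 < t" "2 * t\<^sup>2 + (real m - 1) * t = 1" "2 * t \<le> 3 / real m"
      using positive_root_exists[of m] mm by auto
    have G: "pair_graph G" "pverts G = {..<n}" "Digraph_Component.connected (with_proj G)"
      "dissociation_number G = 2 * k" "G \<notin> cp_tree_class n k"
      using min by (auto simp: is_arg_min_def dissoc_class_def)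
    interpret pair_graph G by (rule G(1))
    have sym: "(y, x) \<in> parcs G" if "(x, y) \<in> parcs G" for x y using arcs_symmetric[OF that] .
    have "\<not> graph_spectral_radius (cycle_graph k m) < graph_spectral_radius G"
      using min cycle_in_class[OF assms mm(2)] m(2) by (auto simp: is_arg_min_def)
    hence radius: "graph_spectral_radius G \<le> real m - 2 + 2 * t"
      using cycle_spectral_radius_le[OF assms mm(2) ev t(1,2)] by linarith
    define E where "E x y \<longleftrightarrow> (x, y) \<in> parcs G" for x y
    have E: "E = (\<lambda>x y. (x, y) \<in> parcs G)" by (intro ext) (simp add: E_def)
    have bd: "bounded_dissociation {..<n} E k"
    proof
      show "symp E" using sym by (auto simp: E_def intro: sympI)
      have "\<not> E x x" for x using no_loops'[of x x] by (auto simp: E_def)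
      thus "irreflp E" by (rule irreflpI)
      show "card S \<le> 2 * k" if S: "S \<subseteq> {..<n}" "\<forall>v\<in>S. card (nbrs E S v) \<le> 1" for S
      proof -
        have "dissociation_set G S" using S G(2) by (auto simp: dissociation_set_iff nbrs_def E_def)
        thus ?thesis using card_le_dissociation_number[of G S] G(2,4) by simp
      qed
    qed simp
    have "\<exists>P. (\<forall>i<k. card (P i) = m \<and> comatching E (P i)) \<and>
      (\<forall>i<k. \<forall>j<k. i \<noteq> j \<longrightarrow> P i \<inter> P j = {}) \<and> (\<Union>i<k. P i) = {..<n}"
    proof (rule m0[OF mm(1) bd])
      fix X assume X: "X \<subseteq> {..<n}"
      have "degsum E X \<le> graph_spectral_radius G * real (card X)"
        unfolding E by (rule indicator_rayleigh[OF G(2) n0 sym X])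
      also have "\<dots> \<le> (real m - 2 + 3 / real m) * real (card X)"
        using radius t(3) by (intro mult_right_mono) auto
      finally show "degsum E X \<le> (real m - 2 + 3 / real m) * real (card X)" .
    qed (use m in simp)
    then obtain P where P: "\<And>i. i < k \<Longrightarrow> card (P i) = m" "\<And>i. i < k \<Longrightarrow> comatching E (P i)"
      "\<And>i j. i < k \<Longrightarrow> j < k \<Longrightarrow> i \<noteq> j \<Longrightarrow> P i \<inter> P j = {}" "(\<Union>i<k. P i) = {..<n}" by metis
    have "symp E" using sym by (auto simp: E_def intro: sympI)
    from labelling_exists[OF this finite_lessThan ev P]
    obtain c h where ch: "bij_betw (\<lambda>x. (c x, h x)) {..<n} ({..<k} \<times> {..<m})"
      "\<forall>x\<in>{..<n}. \<forall>y\<in>{..<n}. c x = c y \<longrightarrow> h x div 2 \<noteq> h y div (2 :: nat) \<longrightarrow> E x y" by blast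
    interpret labelled_graph G k m n c h t
    proof
      show "(x, y) \<in> parcs G" if "x < n" "y < n" "c x = c y" "h x div 2 \<noteq> h y div 2" for x y
        using ch(2) that by (simp add: E_def)
    qed (use G assms mm ev m(2) ch(1) t radius in auto)
    show "graph_iso G (aligned_cp_cycle k (n div k))" using iso_aligned by (simp add: m_def)
  qed
qed

end
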